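(* Let $0<p<1$ and $k,r\in\mathbb{N}$. There is a constant $C$, independent of $f$ and $\delta$, such that for every function $f$ on $\mathbb{T}$ with $f^{(r-1)}\in AC(\mathbb{T})$ and every $\delta>0$, $$\omega_{r+k}(f,\delta)_p\le C\delta^{r+\frac1p-1}\left(\int_0^\delta\frac{\omega_k(f^{(r)},t)_p^p}{t^{2-p}}\,dt\right)^{\frac1p}.$$
   Context: $\mathbb{T}\cong[0,2\pi)$ is the unit circle, and functions on $\mathbb{T}$ are identified with $2\pi$-periodic functions; $\|f\|_p=\left(\int_{\mathbb{T}}|f(x)|^p\,dx\right)^{1/p}$. $AC(\mathbb{T})$ is the set of absolutely continuous ($2\pi$-periodic) functions; when $f^{(r-1)}\in AC(\mathbb{T})$, $f^{(r)}$ denotes the (a.e. defined, integrable) derivative of $f^{(r-1)}$. For $s\in\mathbb{N}$ the modulus of smoothness of order $s$ is $\omega_s(f,\delta)_p=\sup_{0<h\le\delta}\|\Delta_h^sf\|_p$, where $\Delta_h^sf(x)=\sum_{\nu=0}^s\binom{s}{\nu}(-1)^\nu f(x+\nu h)$. The right-hand side is allowed to be $+\infty$, in which case the inequality is trivial. *)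

theory Defs
  imports "HOL-Analysis.Analysis"
begin

text \<open>Functions on the circle are complex-valued \<open>2\<pi>\<close>-periodic functions on the real line.\<close>

definition periodic :: "(real \<Rightarrow> complex) \<Rightarrow> bool" where
  "periodic f \<longleftrightarrow> (\<forall>x. f (x + 2 * pi) = f x)"

definition absolutely_continuous_on :: "real set \<Rightarrow> (real \<Rightarrow> complex) \<Rightarrow> bool" where
  "absolutely_continuous_on S g \<longleftrightarrow>
     (\<forall>\<epsilon>>0. \<exists>d>0. \<forall>(n::nat) (a :: nat \<Rightarrow> real) b.
        (\<forall>i<n. a i \<le> b i \<and> {a i..b i} \<subseteq> S) \<and>
        disjoint_family_on (\<lambda>i. {a i<..<b i}) {..<n} \<and>
        (\<Sum>i<n. b i - a i) < d
        \<longrightarrow> (\<Sum>i<n. norm (g (b i) - g (a i))) < \<epsilon>)"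

definition AC_circle :: "(real \<Rightarrow> complex) set" where
  "AC_circle = {g. periodic g \<and> absolutely_continuous_on {0..2 * pi} g}"

text \<open>The \<open>j\<close>-th derivative. Where a function is not differentiable, \<open>vector_derivative\<close> has an
  unspecified value. The derivative of an absolutely continuous function is affected by this
  only on a null set, and all quantities below ignore null sets.\<close>

definition nth_deriv :: "nat \<Rightarrow> (real \<Rightarrow> complex) \<Rightarrow> real \<Rightarrow> complex" where
  "nth_deriv j f = ((\<lambda>g x. vector_derivative g (at x)) ^^ j) f"

text \<open>For \<open>r \<ge> 1\<close>: \<open>f\<close> is a function on the circle whose derivatives up to order \<open>r - 1\<close> exist
  everywhere, the one of order \<open>r - 1\<close> being absolutely continuous.\<close>

definition deriv_AC :: "nat \<Rightarrow> (real \<Rightarrow> complex) \<Rightarrow> bool" where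
  "deriv_AC r f \<longleftrightarrow> periodic f \<and>
     (\<forall>j<r - 1. \<forall>x. nth_deriv j f differentiable (at x)) \<and>
     nth_deriv (r - 1) f \<in> AC_circle"

text \<open>Extended nonnegative powers; only used with exponents \<open>a > 0\<close>.\<close>

definition ennreal_powr :: "ennreal \<Rightarrow> real \<Rightarrow> ennreal" where
  "ennreal_powr x a = (if x = \<infinity> then \<infinity> else ennreal (enn2real x powr a))"

definition Lp_circle :: "real \<Rightarrow> (real \<Rightarrow> complex) \<Rightarrow> ennreal" where
  "Lp_circle p f =
     ennreal_powr (\<integral>\<^sup>+x\<in>{0..<2 * pi}. ennreal (norm (f x) powr p) \<partial>lebesgue) (1 / p)"

definition fwd_diff :: "nat \<Rightarrow> real \<Rightarrow> (real \<Rightarrow> complex) \<Rightarrow> real \<Rightarrow> complex" where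
  "fwd_diff s h f x = (\<Sum>\<nu>\<le>s. of_nat (s choose \<nu>) * (-1) ^ \<nu> * f (x + real \<nu> * h))"

definition modulus :: "nat \<Rightarrow> (real \<Rightarrow> complex) \<Rightarrow> real \<Rightarrow> real \<Rightarrow> ennreal" where
  "modulus s f \<delta> p = (SUP h\<in>{0<..\<delta>}. Lp_circle p (fwd_diff s h f))"

end

theory Submission
  imports Defs "HOL-Computational_Algebra.Polynomial"
begin

text \<open>
  Put \<open>g = f\<^sup>(\<^sup>r\<^sup>)\<close>, let \<open>\<tau>\<close> be the translation by the step under consideration, so that the difference
  of order \<open>s\<close> is \<open>(1 - \<tau>)\<^sup>s\<close>, and let \<open>J \<phi> = \<integral>|\<phi>|\<^sup>p\<close> over one period (\<open>Lpow p \<phi>\<close> below). For \<open>p \<le> 1\<close> the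
  functional \<open>J\<close> is subadditive and translation invariant, hence a linear combination of
  translates with coefficients \<open>c\<^sub>i\<close> increases it at most by the factor \<open>\<Sum>|c\<^sub>i|\<^sup>p\<close>.

  Up to sign, \<open>h\<^sup>-\<^sup>r\<close> times the difference of order \<open>r + k\<close> of \<open>f\<close> is an \<open>r\<close>-fold mean over intervals of
  length \<open>h\<close> of the \<open>k\<close>-th difference of \<open>g\<close>. For \<open>p < 1\<close> a mean value cannot be estimated by
  integrating translates, so it is approximated by sums over grids of mesh \<open>h / 2\<^sup>j\<close>. Let \<open>D\<^sub>j\<close> be
  such a sum. The coarsest one, \<open>D\<^sub>0\<close>, has boundedly many terms. A refinement \<open>D\<^sub>j\<^sub>+\<^sub>1 - D\<^sub>j\<close> is a
  combination of \<open>O(2\<^sup>j)\<close> translates of the \<open>k\<close>-th difference of \<open>g\<close> with step \<open>h / 2\<^sup>j\<^sup>+\<^sup>1\<close>, with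
  coefficients \<open>O(2\<^sup>-\<^sup>j)\<close>, and therefore \<open>J (D\<^sub>j\<^sub>+\<^sub>1 - D\<^sub>j) \<le> C 2\<^sup>j\<^sup>(\<^sup>1\<^sup>-\<^sup>p\<^sup>) \<omega>\<^sub>k(g, h / 2\<^sup>j\<^sup>+\<^sup>1)\<^sup>p\<close>. Since the
  modulus is increasing, the sum over \<open>j\<close> is at most a constant times \<open>h\<^sup>1\<^sup>-\<^sup>p \<integral> \<omega>\<^sub>k(g, t)\<^sup>p t\<^sup>p\<^sup>-\<^sup>2 dt\<close>
  over \<open>(0, h)\<close>, cut into dyadic pieces. This is \<open>Lpow_quadrature_le\<close>, and it contains the whole
  estimate. For the refinement to contain the full factor \<open>(1 - \<tau>)\<^sup>k\<close>, equal weights are not enough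
  if \<open>k > 1\<close>; a fixed correction polynomial in \<open>\<tau>\<close>, found in \<open>richardson_poly\<close>, makes the quadrature
  exact to order \<open>k\<close>.

  It remains to see that \<open>D\<^sub>j\<close> tends to the mean value; convergence in \<open>L\<^sup>1\<close> over a period is enough,
  because it implies \<open>J\<close>-convergence. The mean over \<open>[x, x + h]\<close> of a derivative is exactly a grid
  average of difference quotients, so the error of the quadrature is controlled by the \<open>L\<^sup>1\<close>
  distance of \<open>g\<close> from the \<open>r\<close>-th difference quotient of \<open>f\<close> with step \<open>h / 2\<^sup>j\<close>. The latter tends to \<open>g\<close>
  almost everywhere, and its \<open>L\<^sup>1\<close> norm is at most that of \<open>g\<close>; Scheffe's lemma gives convergence in
  \<open>L\<^sup>1\<close> (\<open>quadrature_tendsto_L1\<close>). Both facts rest on Lebesgue's theorem for absolutely continuous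
  functions: such a function is differentiable almost everywhere and is the integral of its
  derivative, which is integrable. This is proved from the Vitali covering theorem
  (\<open>AC_circle_derivative\<close>).
\<close>

section \<open>Polynomials in the translation operator\<close>

text \<open>
  The polynomial \<open>P\<close>, evaluated at the operator of translation by \<open>t\<close>. Products of polynomials
  become compositions of operators (\<open>shift_op_mult\<close>), so that relations between differences, means
  and quadrature sums reduce to polynomial identities.
\<close>
definition shift_op :: "complex poly \<Rightarrow> real \<Rightarrow> (real \<Rightarrow> complex) \<Rightarrow> real \<Rightarrow> complex" where
  "shift_op P t \<phi> x = (\<Sum>i\<le>degree P. coeff P i * \<phi> (x + real i * t))"

lemma shift_op_ge_degree:
  assumes "degree P \<le> n"
  shows "shift_op P t \<phi> x = (\<Sum>i\<le>n. coeff P i * \<phi> (x + real i * t))"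
  unfolding shift_op_def
  by (rule sum.mono_neutral_left) (use assms in \<open>auto simp: coeff_eq_0\<close>)

lemma shift_op_0 [simp]: "shift_op 0 t \<phi> x = 0"
  by (simp add: shift_op_def)

lemma shift_op_1 [simp]: "shift_op 1 t \<phi> x = \<phi> x"
  by (simp add: shift_op_def)

lemma shift_op_pCons:
  "shift_op (pCons a P) t \<phi> x = a * \<phi> x + shift_op P t \<phi> (x + t)"
proof -
  have "shift_op (pCons a P) t \<phi> x
      = (\<Sum>i\<le>Suc (degree P). coeff (pCons a P) i * \<phi> (x + real i * t))"
    by (rule shift_op_ge_degree) (simp add: degree_pCons_le)
  also have "\<dots> = a * \<phi> x + (\<Sum>i\<le>degree P. coeff P i * \<phi> (x + t + real i * t))"
    by (subst sum.atMost_Suc_shift) (simp add: algebra_simps)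
  finally show ?thesis
    by (simp add: shift_op_def)
qed

lemma shift_op_add: "shift_op (P + Q) t \<phi> x = shift_op P t \<phi> x + shift_op Q t \<phi> x"
proof -
  define n where "n = max (degree P) (degree Q)"
  have "degree (P + Q) \<le> n" "degree P \<le> n" "degree Q \<le> n"
    by (auto simp: n_def degree_add_le_max)
  then show ?thesis
    by (simp add: shift_op_ge_degree sum.distrib algebra_simps)
qed

lemma shift_op_smult: "shift_op (smult a P) t \<phi> x = a * shift_op P t \<phi> x"
  by (simp add: shift_op_ge_degree[of "smult a P" "degree P"] shift_op_def sum_distrib_left mult.assoc)

lemma shift_op_diff: "shift_op (P - Q) t \<phi> x = shift_op P t \<phi> x - shift_op Q t \<phi> x"
  using shift_op_add[of "P - Q" Q t \<phi> x] by simp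

lemma shift_op_sum: "shift_op (\<Sum>i\<in>I. P i) t \<phi> x = (\<Sum>i\<in>I. shift_op (P i) t \<phi> x)"
  by (induction I rule: infinite_finite_induct) (auto simp: shift_op_add)

lemma shift_op_fun_diff:
  "shift_op P t (\<lambda>x. \<phi> x - \<psi> x) x = shift_op P t \<phi> x - shift_op P t \<psi> x"
  by (simp add: shift_op_def algebra_simps sum_subtractf)

lemma shift_op_fun_scale: "shift_op P t (\<lambda>x. c * \<phi> x) x = c * shift_op P t \<phi> x"
  by (simp add: shift_op_def sum_distrib_left mult_ac)

lemma shift_op_translate: "shift_op P t (\<lambda>x. \<phi> (x + s)) x = shift_op P t \<phi> (x + s)"
  by (simp add: shift_op_def add_ac)

text \<open>
  The base of the calculus: \<open>pCons\<close> adds a multiple of the identity to a translated operator, and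
  both sides respect this.
\<close>
lemma shift_op_mult: "shift_op (P * Q) t \<phi> x = shift_op P t (shift_op Q t \<phi>) x"
  by (induction P arbitrary: x)
     (simp_all add: shift_op_add shift_op_smult shift_op_pCons)

lemma shift_op_commute_steps:
  "shift_op P t (shift_op Q s \<phi>) x = shift_op Q s (shift_op P t \<phi>) x"
  unfolding shift_op_def sum_distrib_left
  by (subst sum.swap) (simp add: mult_ac add_ac)

lemma shift_op_monom_mult: "shift_op (monom 1 n * P) t \<phi> x = shift_op P t \<phi> (x + real n * t)"
  by (induction n arbitrary: x)
     (simp_all add: monom_Suc monom_0 one_pCons[symmetric] shift_op_pCons algebra_simps)

text \<open>
  Substituting \<open>X\<^sup>n\<close> for \<open>X\<close> turns an operator for the step \<open>n t\<close> into one for the step \<open>t\<close>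
  (\<open>shift_op_dilate\<close>). This expresses operators for different steps in terms of the finest one.
\<close>
definition dilate :: "nat \<Rightarrow> complex poly \<Rightarrow> complex poly" where
  "dilate n P = pcompose P (monom 1 n)"

lemma shift_op_dilate: "shift_op (dilate n P) t \<phi> x = shift_op P (real n * t) \<phi> x"
  unfolding dilate_def
  by (induction P arbitrary: x)
     (simp_all add: pcompose_pCons shift_op_add shift_op_pCons shift_op_monom_mult)

lemma dilate_1 [simp]: "dilate n 1 = 1"
  by (simp add: dilate_def pcompose_1)

lemma dilate_mult: "dilate n (P * Q) = dilate n P * dilate n Q"
  by (simp add: dilate_def pcompose_mult)

lemma dilate_power: "dilate n (P ^ k) = dilate n P ^ k"
  by (induction k) (simp_all add: dilate_mult)

lemma dilate_add: "dilate n (P + Q) = dilate n P + dilate n Q"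
  by (simp add: dilate_def pcompose_add)

lemma dilate_smult: "dilate n (smult a P) = smult a (dilate n P)"
  by (simp add: dilate_def pcompose_smult)

lemma dilate_linear: "dilate n [:1, -1:] = 1 - monom 1 n"
  by (simp add: dilate_def pcompose_pCons one_pCons)

lemma dilate_2_linear: "dilate 2 [:1, -1:] = [:1, -1:] * [:1, 1:]"
  by (simp add: dilate_linear numeral_2_eq_2 monom_Suc monom_0 one_pCons)

lemma fwd_diff_eq_shift_op: "fwd_diff s h \<phi> x = shift_op ([:1, -1:] ^ s) h \<phi> x"
proof -
  have *: "shift_op (monom 1 n) h \<phi> y = \<phi> (y + real n * h)" for n y
    by (simp add: shift_op_def degree_monom_eq flip: sum.delta) 
       (subst sum.remove[of _ n], auto)
  have "[:1, -1:] ^ s = (monom (-1) 1 + 1 :: complex poly) ^ s"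
    by (simp add: monom_Suc monom_0 one_pCons)
  also have "\<dots> = (\<Sum>k\<le>s. smult (of_nat (s choose k) * (-1) ^ k) (monom 1 k))"
    by (subst binomial_ring) (simp add: monom_power smult_monom of_nat_poly mult.commute flip: smult_one)
  finally show ?thesis
    by (simp add: shift_op_sum shift_op_smult * fwd_diff_def)
qed

text \<open>
  On \<open>[0, 1]\<close> one has \<open>s \<le> s powr p\<close>; this is applied to the two fractions \<open>a / (a + b)\<close> and
  \<open>b / (a + b)\<close>, whose sum is one.
\<close>
lemma powr_add_le:
  fixes a b p :: real
  assumes "0 \<le> a" "0 \<le> b" "0 < p" "p \<le> 1"
  shows "(a + b) powr p \<le> a powr p + b powr p"
proof (cases "a + b = 0")
  case False
  then have pos: "a + b > 0"
    using assms by auto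
  have *: "u / (a + b) \<le> (u / (a + b)) powr p" if "0 \<le> u" "u \<le> a + b" for u
    using powr_mono'[of p 1 "u / (a + b)"] that assms pos by simp
  have "1 = a / (a + b) + b / (a + b)"
    using pos by (simp flip: add_divide_distrib)
  also have "\<dots> \<le> (a / (a + b)) powr p + (b / (a + b)) powr p"
    using assms by (intro add_mono *) auto
  also have "\<dots> = (a powr p + b powr p) / (a + b) powr p"
    using assms pos by (simp add: powr_divide add_divide_distrib)
  finally show ?thesis
    using pos by (simp add: field_simps)
qed (use assms in auto)

text \<open>
  The factor by which \<open>shift_op P t\<close> can increase the integral of the \<open>p\<close>-th power over a period
  (\<open>Lpow_shift_op_le\<close>).
\<close>
definition coeff_psum :: "real \<Rightarrow> complex poly \<Rightarrow> real" where
  "coeff_psum p P = (\<Sum>i\<le>degree P. norm (coeff P i) powr p)"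

lemma coeff_psum_nonneg: "coeff_psum p P \<ge> 0"
  by (simp add: coeff_psum_def sum_nonneg)

lemma coeff_psum_ge_degree:
  assumes "degree P \<le> n"
  shows "coeff_psum p P = (\<Sum>i\<le>n. norm (coeff P i) powr p)"
  unfolding coeff_psum_def
  by (rule sum.mono_neutral_left) (use assms in \<open>auto simp: coeff_eq_0\<close>)

lemma coeff_psum_0 [simp]: "coeff_psum p 0 = 0"
  by (simp add: coeff_psum_def)

lemma coeff_psum_1 [simp]: "coeff_psum p 1 = 1"
  by (simp add: coeff_psum_def)

lemma coeff_psum_pCons: "coeff_psum p (pCons a P) = norm a powr p + coeff_psum p P"
proof -
  have "coeff_psum p (pCons a P) = (\<Sum>i\<le>Suc (degree P). norm (coeff (pCons a P) i) powr p)"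
    by (rule coeff_psum_ge_degree) (simp add: degree_pCons_le)
  also have "\<dots> = norm a powr p + coeff_psum p P"
    by (subst sum.atMost_Suc_shift) (simp add: coeff_psum_def)
  finally show ?thesis .
qed

lemma coeff_psum_smult: "coeff_psum p (smult a P) = norm a powr p * coeff_psum p P"
  by (simp add: coeff_psum_ge_degree[of "smult a P" "degree P"] coeff_psum_def
      sum_distrib_left norm_mult powr_mult)

lemma coeff_psum_add_le:
  assumes "0 < p" "p \<le> 1"
  shows "coeff_psum p (P + Q) \<le> coeff_psum p P + coeff_psum p Q"
proof -
  define n where "n = max (degree P) (degree Q)"
  have n: "degree (P + Q) \<le> n" "degree P \<le> n" "degree Q \<le> n"
    by (auto simp: n_def degree_add_le_max)
  have "norm (a + b) powr p \<le> norm a powr p + norm b powr p" for a b :: complex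
    using powr_mono2[of p "norm (a + b)" "norm a + norm b"] norm_triangle_ineq[of a b]
      powr_add_le[of "norm a" "norm b" p] assms by simp
  then show ?thesis
    by (simp add: coeff_psum_ge_degree[OF n(1)] coeff_psum_ge_degree[OF n(2)]
        coeff_psum_ge_degree[OF n(3)] sum_mono flip: sum.distrib)
qed

lemma coeff_psum_sum_le:
  assumes "0 < p" "p \<le> 1"
  shows "coeff_psum p (\<Sum>i\<in>I. P i) \<le> (\<Sum>i\<in>I. coeff_psum p (P i))"
proof (induction I rule: infinite_finite_induct)
  case (insert i I)
  then show ?case
    using coeff_psum_add_le[OF assms, of "P i" "\<Sum>i\<in>I. P i"] by auto
qed auto

lemma coeff_psum_mult_le:
  assumes "0 < p" "p \<le> 1"
  shows "coeff_psum p (P * Q) \<le> coeff_psum p P * coeff_psum p Q"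
proof (induction P)
  case (pCons a P)
  have "coeff_psum p (pCons a P * Q)
      \<le> coeff_psum p (smult a Q) + coeff_psum p (pCons 0 (P * Q))"
    by (simp add: coeff_psum_add_le assms)
  also have "\<dots> \<le> norm a powr p * coeff_psum p Q + coeff_psum p P * coeff_psum p Q"
    using pCons assms by (simp add: coeff_psum_smult coeff_psum_pCons)
  finally show ?case
    by (simp add: coeff_psum_pCons algebra_simps)
qed simp

lemma coeff_psum_monom [simp]: "coeff_psum p (monom 1 n) = 1"
  by (induction n) (simp_all add: monom_0 monom_Suc coeff_psum_pCons)

text \<open>
  For the step \<open>h / N\<close> this is the equidistant sum that approximates the mean over \<open>[x, x + h]\<close>.
\<close>
definition avg_poly :: "nat \<Rightarrow> complex poly" where
  "avg_poly N = smult (1 / of_nat N) (\<Sum>i<N. monom 1 i)"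

text \<open>
  The geometric sum. It says that a difference with step \<open>N t\<close> is \<open>N\<close> times the average of the
  differences with step \<open>t\<close>.
\<close>
lemma geometric_avg_poly:
  assumes "N > 0"
  shows "[:1, -1:] * avg_poly N = smult (1 / of_nat N) (dilate N [:1, -1:])"
proof -
  have "[:1, -1:] * (\<Sum>i<N. monom 1 i) = (1 - monom 1 N :: complex poly)"
  proof (induction N)
    case (Suc N)
    then show ?case
      by (simp add: algebra_simps monom_Suc)
  qed (simp add: monom_0 one_pCons)
  then show ?thesis
    by (simp add: avg_poly_def dilate_linear)
qed

lemma avg_poly_double: "avg_poly (2 * N) = dilate 2 (avg_poly N) * [:1/2, 1/2:]"
proof -
  have dm: "dilate 2 (monom 1 i) = monom 1 (2 * i)" for i
    by (induction i) (simp_all add: dilate_def monom_0 monom_Suc pcompose_pCons numeral_2_eq_2 mult.commute)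
  have sum_dilate: "dilate 2 (\<Sum>i\<in>I. P i) = (\<Sum>i\<in>I. dilate 2 (P i))" for I and P :: "nat \<Rightarrow> complex poly"
    by (simp add: dilate_def pcompose_sum)
  have "(\<Sum>i<2 * N. monom 1 i) = (\<Sum>i<N. monom 1 (2 * i)) * ([:1, 1:] :: complex poly)"
  proof (induction N)
    case (Suc N)
    then show ?case
      by (simp add: algebra_simps monom_Suc numeral_2_eq_2)
  qed simp
  moreover have "[:1/2, 1/2:] = smult (1/2) ([:1, 1:] :: complex poly)"
    by simp
  ultimately show ?thesis
    by (simp add: avg_poly_def dilate_smult sum_dilate dm smult_add_right)
qed

lemma coeff_psum_avg_le_1: "coeff_psum 1 (avg_poly N) \<le> 1"
proof -
  have "coeff_psum 1 (\<Sum>i<N. monom 1 i) \<le> (\<Sum>i<N. 1)"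
    using coeff_psum_sum_le[of 1 "\<lambda>i. monom 1 i" "{..<N}"] by simp
  then show ?thesis
    by (cases "N = 0") (auto simp: avg_poly_def coeff_psum_smult norm_divide field_simps)
qed

lemma coeff_psum_avg_power_le_1: "coeff_psum 1 (avg_poly N ^ r) \<le> 1"
proof (induction r)
  case (Suc r)
  have "coeff_psum 1 (avg_poly N ^ Suc r) \<le> coeff_psum 1 (avg_poly N) * coeff_psum 1 (avg_poly N ^ r)"
    using coeff_psum_mult_le[of 1] by simp
  also have "\<dots> \<le> 1"
    using Suc coeff_psum_avg_le_1 by (intro mult_le_one coeff_psum_nonneg) auto
  finally show ?case .
qed simp

text \<open>
  A coefficient of the product is a sum of distinct coefficients of \<open>P\<close>, each divided by \<open>N\<close>.
\<close>
lemma norm_coeff_avg_mult_le: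
  "norm (coeff (avg_poly N * P) n) \<le> coeff_psum 1 P / real N"
proof -
  define c where "c i = (if i < N then 1 / of_nat N else 0 :: complex)" for i
  have c: "coeff (avg_poly N) i = c i" for i
    by (simp add: avg_poly_def coeff_sum c_def)
  have "norm (coeff (avg_poly N * P) n) \<le> (\<Sum>i\<le>n. norm (c i * coeff P (n - i)))"
    unfolding coeff_mult c by (rule norm_sum)
  also have "\<dots> \<le> (\<Sum>i\<le>n. norm (coeff P (n - i)) / real N)"
    by (intro sum_mono) (simp add: c_def norm_mult norm_divide)
  also have "\<dots> = (\<Sum>i\<le>n. norm (coeff P i)) / real N"
    unfolding sum_divide_distrib[symmetric]
    by (intro arg_cong2[of _ _ _ _ "(/)"] sum.reindex_bij_witness[of _ "\<lambda>i. n - i" "\<lambda>i. n - i"]) auto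
  also have "(\<Sum>i\<le>n. norm (coeff P i)) \<le> (\<Sum>i\<le>max n (degree P). norm (coeff P i))"
    by (rule sum_mono2) auto
  also have "\<dots> = coeff_psum 1 P"
    by (subst coeff_psum_ge_degree[of P "max n (degree P)"]) auto
  finally show ?thesis
    by (simp add: divide_right_mono)
qed

text \<open>
  The power has at most \<open>r N\<close> coefficients, and each of them is at most \<open>1 / N\<close>. Estimating the \<open>r\<close>
  factors separately would lose the factor \<open>N powr (1 - p)\<close> each time; the bound on the
  coefficients of the product loses it only once, and this is the exponent that the theorem
  needs.
\<close>
lemma coeff_psum_avg_power_le:
  assumes "0 < p" "p \<le> 1" "r \<ge> 1" "N \<ge> 1"
  shows "coeff_psum p (avg_poly N ^ r) \<le> real r * real N powr (1 - p)"
proof -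
  obtain r' where r: "r = Suc r'"
    using assms by (cases r) auto
  have coeff: "norm (coeff (avg_poly N ^ r) i) \<le> 1 / real N" for i
  proof -
    have "norm (coeff (avg_poly N ^ r) i) \<le> coeff_psum 1 (avg_poly N ^ r') / real N"
      unfolding r power_Suc by (rule norm_coeff_avg_mult_le)
    also have "\<dots> \<le> 1 / real N"
      by (intro divide_right_mono coeff_psum_avg_power_le_1) auto
    finally show ?thesis .
  qed
  have "degree (avg_poly N) \<le> N - 1"
    unfolding avg_poly_def
    by (intro order.trans[OF degree_smult_le] degree_sum_le) (auto intro: order.trans[OF degree_monom_le])
  then have "degree (avg_poly N ^ r) \<le> (N - 1) * r"
    using degree_power_le[of "avg_poly N" r] by (meson mult_le_mono1 order.trans)
  then have "degree (avg_poly N ^ r) + 1 \<le> r * N"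
    using assms by (cases N) (auto simp: algebra_simps r)
  then have deg: "real (degree (avg_poly N ^ r) + 1) \<le> real r * real N"
    by (metis of_nat_le_iff of_nat_mult)
  have "coeff_psum p (avg_poly N ^ r) \<le> (\<Sum>i\<le>degree (avg_poly N ^ r). (1 / real N) powr p)"
    unfolding coeff_psum_def using assms by (intro sum_mono powr_mono2 coeff) auto
  also have "\<dots> = real (degree (avg_poly N ^ r) + 1) * (1 / real N) powr p"
    by simp
  also have "\<dots> \<le> real r * real N * (1 / real N) powr p"
    by (intro mult_right_mono deg) auto
  also have "\<dots> = real r * real N powr (1 - p)"
    using assms by (simp add: powr_diff powr_divide)
  finally show ?thesis .
qed

text \<open>
  The correction of the weights that makes the quadrature exact to order \<open>k\<close>. With \<open>X = e\<^sup>s\<close> the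
  condition determines \<open>M(e\<^sup>s)\<close> up to order \<open>k\<close> as \<open>((e\<^sup>s - 1) / s)\<^sup>r\<close>, because
  \<open>((e\<^sup>2\<^sup>s - 1) / (2 s)) / ((e\<^sup>s - 1) / s) = (1 + e\<^sup>s) / 2\<close>; these are the end corrections of
  Gregory's formula. The induction finds \<open>M\<close> order by order: adding \<open>a (1 - X)\<^sup>k\<close> to \<open>M\<close> changes the
  defect by \<open>a (1 - 2\<^sup>k) (1 - X)\<^sup>k\<close> modulo \<open>(1 - X)\<^sup>k\<^sup>+\<^sup>1\<close>, and \<open>2\<^sup>k \<noteq> 1\<close>.
\<close>
lemma richardson_poly:
  assumes "k \<ge> 1"
  shows "\<exists>M q :: complex poly. poly M 1 = 1 \<and> [:1/2, 1/2:] ^ r * M - dilate 2 M = [:1, -1:] ^ k * q"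
  using assms
proof (induction k rule: dec_induct)
  case base
  have "poly ([:1/2, 1/2:] ^ r * 1 - 1 :: complex poly) 1 = 0"
    by simp
  then have "[:-1, 1:] dvd ([:1/2, 1/2:] ^ r * 1 - 1 :: complex poly)"
    by (simp only: poly_eq_0_iff_dvd)
  moreover have "[:-1, 1:] = - ([:1, -1:] :: complex poly)"
    by simp
  ultimately have "[:1, -1:] dvd ([:1/2, 1/2:] ^ r * 1 - 1 :: complex poly)"
    by (metis minus_dvd_iff)
  then show ?case
    by (metis dvdE poly_1 power_one_right dilate_1)
next
  case (step k)
  then obtain M q :: "complex poly" where M: "poly M 1 = 1"
    and q: "[:1/2, 1/2:] ^ r * M - dilate 2 M = [:1, -1:] ^ k * q"
    by blast
  define a where "a = poly q 1 / (2 ^ k - 1)"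
  define B where "B = q + smult a ([:1/2, 1/2:] ^ r - [:1, 1:] ^ k)"
  have "(2::complex) ^ k \<noteq> 1"
    by (metis One_nat_def one_le_numeral norm_one norm_numeral norm_power power_one_right
        power_strict_increasing_iff numeral_eq_one_iff one_less_numeral_iff semiring_norm(76)
        less_irrefl step.hyps(1) order_less_le_trans zero_less_one power_0)
  then have "poly B 1 = 0"
    by (simp add: B_def a_def poly_power field_simps)
  then have "[:-1, 1:] dvd B"
    by (simp add: poly_eq_0_iff_dvd)
  moreover have "[:-1, 1:] = - ([:1, -1:] :: complex poly)"
    by simp
  ultimately obtain q' where q': "B = [:1, -1:] * q'"
    by (metis minus_dvd_iff dvdE)
  define M' where "M' = M + smult a ([:1, -1:] ^ k)"
  have dilate_pow: "dilate 2 ([:1, -1:] ^ k) = [:1, -1:] ^ k * [:1, 1:] ^ k"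
    by (simp only: dilate_power dilate_2_linear power_mult_distrib)
  have "[:1/2, 1/2:] ^ r * M' - dilate 2 M' = [:1, -1:] ^ k * B"
    using q by (simp add: M'_def B_def dilate_add dilate_smult dilate_pow algebra_simps smult_diff_right)
  then have "[:1/2, 1/2:] ^ r * M' - dilate 2 M' = [:1, -1:] ^ Suc k * q'"
    by (simp only: q' power_Suc mult_ac)
  moreover have "poly M' 1 = 1"
    using M step.hyps(1) by (simp add: M'_def poly_power)
  ultimately show ?case
    by blast
qed

section \<open>Translation invariant power integrals over a period\<close>

lemma periodic_of_int:
  fixes \<psi> :: "real \<Rightarrow> 'a"
  assumes per: "\<And>x. \<psi> (x + L) = \<psi> x"
  shows "\<psi> (x + of_int m * L) = \<psi> x"
proof (induction m)
  case (nonneg n)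
  then show ?case
  proof (induction n arbitrary: x)
    case (Suc n)
    have "\<psi> (x + of_int (int (Suc n)) * L) = \<psi> ((x + of_int (int n) * L) + L)"
      by (simp add: algebra_simps)
    then show ?case
      using per Suc by metis
  qed simp
next
  case (neg n)
  then show ?case
  proof (induction n arbitrary: x)
    case 0
    show ?case using per[of "x - L"] by simp
  next
    case (Suc n)
    have "\<psi> (x + of_int (- int (Suc (Suc n))) * L) = \<psi> (x + of_int (- int (Suc (Suc n))) * L + L)"
      using per by metis
    also have "x + of_int (- int (Suc (Suc n))) * L + L = x + of_int (- int (Suc n)) * L"
      by (simp add: algebra_simps)
    finally show ?case
      using Suc by metis
  qed
qed

lemma nn_integral_periodic_shift:
  fixes \<psi> :: "real \<Rightarrow> ennreal"
  assumes [measurable]: "\<psi> \<in> borel_measurable borel" and per: "\<And>x. \<psi> (x + L) = \<psi> x" and "L > 0"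
  shows "(\<integral>\<^sup>+x\<in>{0..<L}. \<psi> (x + s) \<partial>lborel) = (\<integral>\<^sup>+x\<in>{0..<L}. \<psi> x \<partial>lborel)"
proof -
  define c where "c = s - of_int \<lfloor>s / L\<rfloor> * L"
  have "s / L - of_int \<lfloor>s / L\<rfloor> \<ge> 0" "s / L - of_int \<lfloor>s / L\<rfloor> < 1"
    by linarith+
  moreover have "c = (s / L - of_int \<lfloor>s / L\<rfloor>) * L"
    using \<open>L > 0\<close> by (simp add: c_def field_simps)
  ultimately have c: "0 \<le> c" "c < L"
    using \<open>L > 0\<close> by auto
  have "\<psi> (x + s) = \<psi> (x + c)" for x
    using periodic_of_int[of \<psi> L "x + c" "\<lfloor>s / L\<rfloor>"] per by (simp add: c_def)
  then have "(\<integral>\<^sup>+x\<in>{0..<L}. \<psi> (x + s) \<partial>lborel) = (\<integral>\<^sup>+x. \<psi> (x + c) * indicator {0..<L} x \<partial>lborel)"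
    by simp
  also have "\<dots> = (\<integral>\<^sup>+x. \<psi> x * indicator {c..<L + c} x \<partial>lborel)"
    by (subst nn_integral_real_affine[where c = 1 and t = c and f = "\<lambda>x. \<psi> x * indicator {c..<L + c} x"])
       (auto simp: indicator_def add.commute intro!: nn_integral_cong)
  also have "\<dots> = (\<integral>\<^sup>+x. \<psi> x * indicator {c..<L} x + \<psi> x * indicator {L..<L + c} x \<partial>lborel)"
    using c by (intro nn_integral_cong) (auto simp: indicator_def)
  also have "\<dots> = (\<integral>\<^sup>+x. \<psi> x * indicator {c..<L} x \<partial>lborel) + (\<integral>\<^sup>+x. \<psi> x * indicator {L..<L + c} x \<partial>lborel)"
    by (rule nn_integral_add) measurable
  also have "(\<integral>\<^sup>+x. \<psi> x * indicator {L..<L + c} x \<partial>lborel) = (\<integral>\<^sup>+x. \<psi> x * indicator {0..<c} x \<partial>lborel)"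
    by (subst nn_integral_real_affine[where c = 1 and t = L])
       (auto simp: indicator_def per add.commute[of L] intro!: nn_integral_cong)
  also have "(\<integral>\<^sup>+x. \<psi> x * indicator {c..<L} x \<partial>lborel) + \<dots>
      = (\<integral>\<^sup>+x. \<psi> x * indicator {c..<L} x + \<psi> x * indicator {0..<c} x \<partial>lborel)"
    by (rule nn_integral_add[symmetric]) measurable
  also have "\<dots> = (\<integral>\<^sup>+x\<in>{0..<L}. \<psi> x \<partial>lborel)"
    using c by (intro nn_integral_cong) (auto simp: indicator_def)
  finally show ?thesis .
qed

text \<open>
  The \<open>p\<close>-th power of the \<open>L\<^sub>p\<close> quasinorm. For \<open>p \<le> 1\<close> the power satisfies the triangle inequality, and
  the case \<open>p = 1\<close> is the \<open>L\<^sup>1\<close> norm, so one set of lemmas serves both exponents.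
\<close>
definition Lpow :: "real \<Rightarrow> (real \<Rightarrow> complex) \<Rightarrow> ennreal" where
  "Lpow p \<phi> = (\<integral>\<^sup>+x\<in>{0..<2 * pi}. ennreal (norm (\<phi> x) powr p) \<partial>lborel)"

lemma Lpow_translate:
  assumes [measurable]: "\<phi> \<in> borel_measurable borel" and "periodic \<phi>"
  shows "Lpow p (\<lambda>x. \<phi> (x + s)) = Lpow p \<phi>"
  unfolding Lpow_def
  by (rule nn_integral_periodic_shift) (use assms in \<open>auto simp: periodic_def\<close>)

lemma Lpow_add_le:
  assumes [measurable]: "\<phi> \<in> borel_measurable borel" "\<psi> \<in> borel_measurable borel"
    and p: "0 < p" "p \<le> 1"
  shows "Lpow p (\<lambda>x. \<phi> x + \<psi> x) \<le> Lpow p \<phi> + Lpow p \<psi>"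
proof -
  have *: "norm (a + b) powr p \<le> norm a powr p + norm b powr p" for a b :: complex
    using powr_mono2[of p "norm (a + b)" "norm a + norm b"] norm_triangle_ineq[of a b]
      powr_add_le[of "norm a" "norm b" p] p by simp
  have "Lpow p (\<lambda>x. \<phi> x + \<psi> x)
     \<le> (\<integral>\<^sup>+x. ennreal (norm (\<phi> x) powr p) * indicator {0..<2 * pi} x +
             ennreal (norm (\<psi> x) powr p) * indicator {0..<2 * pi} x \<partial>lborel)"
    unfolding Lpow_def
    by (intro nn_integral_mono) (auto simp: indicator_def * simp flip: ennreal_plus intro!: ennreal_leI)
  also have "\<dots> = Lpow p \<phi> + Lpow p \<psi>"
    unfolding Lpow_def by (rule nn_integral_add) measurable
  finally show ?thesis .
qed

lemma Lpow_cmult: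
  assumes [measurable]: "\<phi> \<in> borel_measurable borel"
  shows "Lpow p (\<lambda>x. c * \<phi> x) = ennreal (norm c powr p) * Lpow p \<phi>"
proof -
  have "Lpow p (\<lambda>x. c * \<phi> x) =
    (\<integral>\<^sup>+x. ennreal (norm c powr p) * (ennreal (norm (\<phi> x) powr p) * indicator {0..<2 * pi} x) \<partial>lborel)"
    unfolding Lpow_def by (intro nn_integral_cong) (simp add: norm_mult powr_mult ennreal_mult mult.assoc)
  also have "\<dots> = ennreal (norm c powr p) * Lpow p \<phi>"
    unfolding Lpow_def by (rule nn_integral_cmult) measurable
  finally show ?thesis .
qed

lemma Lpow_sum_le:
  assumes [measurable]: "\<And>i. i \<in> I \<Longrightarrow> \<phi> i \<in> borel_measurable borel" and p: "0 < p" "p \<le> 1" "finite I"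
  shows "Lpow p (\<lambda>x. \<Sum>i\<in>I. \<phi> i x) \<le> (\<Sum>i\<in>I. Lpow p (\<phi> i))"
  using p(3) assms(1)
proof (induction I rule: finite_induct)
  case empty
  show ?case by (simp add: Lpow_def)
next
  case (insert i I)
  have [measurable]: "\<phi> i \<in> borel_measurable borel" "\<And>j. j \<in> I \<Longrightarrow> \<phi> j \<in> borel_measurable borel"
    using insert.prems by auto
  have "Lpow p (\<lambda>x. \<Sum>i\<in>insert i I. \<phi> i x) = Lpow p (\<lambda>x. \<phi> i x + (\<Sum>i\<in>I. \<phi> i x))"
    using insert by simp
  also have "\<dots> \<le> Lpow p (\<phi> i) + Lpow p (\<lambda>x. \<Sum>i\<in>I. \<phi> i x)"
    by (rule Lpow_add_le) (use p in measurable)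
  also have "\<dots> \<le> Lpow p (\<phi> i) + (\<Sum>i\<in>I. Lpow p (\<phi> i))"
    by (intro add_left_mono insert) auto
  finally show ?case
    using insert by simp
qed

lemma shift_op_measurable [measurable]:
  assumes [measurable]: "\<phi> \<in> borel_measurable borel"
  shows "shift_op P t \<phi> \<in> borel_measurable borel"
  unfolding shift_op_def[abs_def] by measurable

lemma fwd_diff_measurable [measurable]:
  assumes [measurable]: "\<phi> \<in> borel_measurable borel"
  shows "fwd_diff s h \<phi> \<in> borel_measurable borel"
  unfolding fwd_diff_def[abs_def] by measurable

lemma periodic_shift_op:
  assumes "periodic \<phi>"
  shows "periodic (shift_op P t \<phi>)"
proof -
  have "\<phi> (x + 2 * pi + s) = \<phi> (x + s)" for x s
    using assms unfolding periodic_def by (metis add.assoc add.commute)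
  then show ?thesis
    by (simp add: periodic_def shift_op_def)
qed

lemma periodic_fwd_diff: "periodic \<phi> \<Longrightarrow> periodic (fwd_diff s h \<phi>)"
  using periodic_shift_op by (auto simp: fwd_diff_eq_shift_op[abs_def])

lemma Lpow_shift_op_le:
  assumes [measurable]: "\<phi> \<in> borel_measurable borel" and "periodic \<phi>" "0 < p" "p \<le> 1"
  shows "Lpow p (shift_op P t \<phi>) \<le> ennreal (coeff_psum p P) * Lpow p \<phi>"
proof -
  have "Lpow p (shift_op P t \<phi>)
      \<le> (\<Sum>i\<le>degree P. Lpow p (\<lambda>x. coeff P i * \<phi> (x + real i * t)))"
    unfolding shift_op_def[abs_def] by (rule Lpow_sum_le) (use assms in auto)
  also have "\<dots> = (\<Sum>i\<le>degree P. ennreal (norm (coeff P i) powr p) * Lpow p \<phi>)"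
    using assms by (intro sum.cong refl) (simp add: Lpow_cmult Lpow_translate)
  also have "\<dots> = ennreal (coeff_psum p P) * Lpow p \<phi>"
    by (simp add: coeff_psum_def sum_distrib_right[symmetric])
  finally show ?thesis .
qed

section \<open>Dyadic refinement of corrected averages\<close>

lemma fwd_diff_as_shift_op: "fwd_diff s h \<phi> = shift_op ([:1, -1:] ^ s) h \<phi>"
  by (rule ext) (rule fwd_diff_eq_shift_op)

lemma shift_op_fwd_diff_commute:
  "shift_op P t (fwd_diff s h \<phi>) x = fwd_diff s h (shift_op P t \<phi>) x"
  by (simp add: fwd_diff_as_shift_op shift_op_commute_steps)

text \<open>
  The sum on the grid of mesh \<open>h / N\<close> that approximates the \<open>r\<close>-fold mean of \<open>\<phi>\<close> over intervals of
  length \<open>h\<close>, with the weights corrected by \<open>M\<close>.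
\<close>
definition quadrature :: "nat \<Rightarrow> nat \<Rightarrow> complex poly \<Rightarrow> real \<Rightarrow> (real \<Rightarrow> complex) \<Rightarrow> real \<Rightarrow> complex" where
  "quadrature N r M h \<phi> = shift_op (avg_poly N ^ r * M) (h / real N) \<phi>"

text \<open>
  Halving the mesh multiplies the averages by \<open>((1 + X) / 2)\<^sup>r\<close>, where \<open>X\<close> is the translation by the
  finer step, so both sums have the factor \<open>dilate 2 (avg_poly N ^ r)\<close>. What remains is the defect
  of \<open>M\<close>, and its factor \<open>(1 - X)\<^sup>k\<close> is the \<open>k\<close>-th difference with the finer step.
\<close>
lemma quadrature_refine:
  fixes h :: real
  assumes q: "[:1/2, 1/2:] ^ r * M - dilate 2 M = [:1, -1:] ^ k * q" and "N \<ge> 1"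
  defines "t \<equiv> h / real (2 * N)"
  shows "quadrature (2 * N) r M h \<phi> x - quadrature N r M h \<phi> x
    = shift_op (avg_poly N ^ r) (2 * t) (shift_op q t (fwd_diff k t \<phi>)) x"
proof -
  have "h / real N = 2 * t"
    by (simp add: t_def)
  then have "quadrature N r M h \<phi> x = shift_op (dilate 2 (avg_poly N ^ r * M)) t \<phi> x"
    by (simp add: quadrature_def shift_op_dilate)
  moreover have "quadrature (2 * N) r M h \<phi> x = shift_op (avg_poly (2 * N) ^ r * M) t \<phi> x"
    by (simp add: quadrature_def t_def)
  ultimately have "quadrature (2 * N) r M h \<phi> x - quadrature N r M h \<phi> x
      = shift_op (avg_poly (2 * N) ^ r * M - dilate 2 (avg_poly N ^ r * M)) t \<phi> x"
    by (simp add: shift_op_diff)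
  also have "avg_poly (2 * N) ^ r * M - dilate 2 (avg_poly N ^ r * M)
      = dilate 2 (avg_poly N ^ r) * ([:1/2, 1/2:] ^ r * M - dilate 2 M)"
    by (simp only: avg_poly_double dilate_mult dilate_power power_mult_distrib right_diff_distrib mult.assoc)
  also have "\<dots> = dilate 2 (avg_poly N ^ r) * (q * [:1, -1:] ^ k)"
    by (simp only: q mult.commute[of q])
  also have "shift_op \<dots> t \<phi> x
      = shift_op (avg_poly N ^ r) (2 * t) (shift_op q t (fwd_diff k t \<phi>)) x"
    by (simp add: shift_op_mult[abs_def] shift_op_dilate fwd_diff_as_shift_op)
  finally show ?thesis .
qed

lemma Lpow_quadrature_refine_le:
  assumes q: "[:1/2, 1/2:] ^ r * M - dilate 2 M = [:1, -1:] ^ k * q"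
    and g [measurable]: "g \<in> borel_measurable borel" and per: "periodic g"
    and p: "0 < p" "p \<le> 1" and "r \<ge> 1" "N \<ge> 1"
  shows "Lpow p (\<lambda>x. quadrature (2 * N) r M h (fwd_diff k h g) x - quadrature N r M h (fwd_diff k h g) x)
    \<le> ennreal (real r * coeff_psum p q * coeff_psum p ([:1, -1:] ^ k) * real N powr (1 - p))
       * Lpow p (fwd_diff k (h / real (2 * N)) g)"
proof -
  define t where "t = h / real (2 * N)"
  let ?G = "fwd_diff k t g"
  have [measurable]: "?G \<in> borel_measurable borel" and perG: "periodic ?G"
    using periodic_fwd_diff[OF per] by auto
  have swap: "fwd_diff k t (fwd_diff k h g) = fwd_diff k h ?G"
    using shift_op_fwd_diff_commute[of "[:1, -1:] ^ k" t k h g]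
    by (simp add: fun_eq_iff fwd_diff_as_shift_op[of k t])
  have "Lpow p (\<lambda>x. quadrature (2 * N) r M h (fwd_diff k h g) x - quadrature N r M h (fwd_diff k h g) x)
    = Lpow p (shift_op (avg_poly N ^ r) (2 * t) (shift_op q t (fwd_diff k h ?G)))"
    unfolding quadrature_refine[OF q \<open>N \<ge> 1\<close>] t_def[symmetric] swap ..
  also have "\<dots> \<le> ennreal (coeff_psum p (avg_poly N ^ r)) * Lpow p (shift_op q t (fwd_diff k h ?G))"
    by (rule Lpow_shift_op_le) (auto intro!: periodic_shift_op periodic_fwd_diff per p)
  also have "\<dots> \<le> ennreal (coeff_psum p (avg_poly N ^ r)) * (ennreal (coeff_psum p q) * Lpow p (fwd_diff k h ?G))"
    by (intro mult_left_mono Lpow_shift_op_le) (auto intro!: periodic_fwd_diff per p)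
  also have "\<dots> \<le> ennreal (coeff_psum p (avg_poly N ^ r)) * (ennreal (coeff_psum p q) *
       (ennreal (coeff_psum p ([:1, -1:] ^ k)) * Lpow p ?G))"
    unfolding fwd_diff_as_shift_op[of k h]
    by (intro mult_left_mono Lpow_shift_op_le) (auto intro!: perG p)
  also have "\<dots> \<le> ennreal (real r * real N powr (1 - p)) * (ennreal (coeff_psum p q) *
       (ennreal (coeff_psum p ([:1, -1:] ^ k)) * Lpow p ?G))"
    by (intro mult_right_mono ennreal_leI coeff_psum_avg_power_le) (use assms in auto)
  also have "\<dots> = ennreal (real r * coeff_psum p q * coeff_psum p ([:1, -1:] ^ k) * real N powr (1 - p)) * Lpow p ?G"
    by (simp add: ennreal_mult'' coeff_psum_nonneg ac_simps)
  finally show ?thesis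
    by (simp add: t_def)
qed

text \<open>
  The integral over \<open>(0, h)\<close> of the theorem bounds the modulus at \<open>h / 2\<close>, through the values on
  \<open>[h / 2, h)\<close>, but not directly the one at \<open>h\<close>. The passage to half the step is
  \<open>1 - X\<^sup>2 = (1 + X) (1 - X)\<close>.
\<close>
lemma Lpow_quadrature_1_le:
  assumes g [measurable]: "g \<in> borel_measurable borel" and per: "periodic g"
    and p: "0 < p" "p \<le> 1"
  shows "Lpow p (quadrature 1 r M h (fwd_diff k h g))
    \<le> ennreal (coeff_psum p M * coeff_psum p ([:1, 1:] ^ k)) * Lpow p (fwd_diff k (h / 2) g)"
proof -
  let ?G = "fwd_diff k (h / 2) g"
  have [measurable]: "?G \<in> borel_measurable borel" and perG: "periodic ?G"
    using periodic_fwd_diff[OF per] by auto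
  have dil: "dilate 2 ([:1, -1:] ^ k) = [:1, 1:] ^ k * [:1, -1:] ^ k"
    by (simp only: dilate_power dilate_2_linear power_mult_distrib mult.commute)
  have eq: "fwd_diff k h g = shift_op ([:1, 1:] ^ k) (h / 2) ?G"
  proof
    fix x
    have "fwd_diff k h g x = shift_op (dilate 2 ([:1, -1:] ^ k)) (h / 2) g x"
      by (simp add: fwd_diff_eq_shift_op shift_op_dilate)
    then show "fwd_diff k h g x = shift_op ([:1, 1:] ^ k) (h / 2) ?G x"
      unfolding dil by (simp add: shift_op_mult fwd_diff_as_shift_op)
  qed
  have "Lpow p (quadrature 1 r M h (fwd_diff k h g)) = Lpow p (shift_op M h (fwd_diff k h g))"
    by (simp add: quadrature_def avg_poly_def monom_0 flip: one_pCons)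
  also have "\<dots> \<le> ennreal (coeff_psum p M) * Lpow p (fwd_diff k h g)"
    by (rule Lpow_shift_op_le) (auto intro!: periodic_fwd_diff per p)
  also have "\<dots> \<le> ennreal (coeff_psum p M) * (ennreal (coeff_psum p ([:1, 1:] ^ k)) * Lpow p ?G)"
    unfolding eq by (intro mult_left_mono Lpow_shift_op_le) (auto intro!: perG p)
  finally show ?thesis
    by (simp add: ennreal_mult'' coeff_psum_nonneg ac_simps)
qed

text \<open>
  On \<open>[h / 2\<^sup>j\<^sup>+\<^sup>1, h / 2\<^sup>j)\<close> the integrand is at least the value of \<open>W\<close> at the left end, divided by the
  power of the right end. The integral of this step function is, up to the constant, the sum.
\<close>
lemma dyadic_sum_le_integral:
  fixes W :: "real \<Rightarrow> ennreal"
  assumes mono: "\<And>s t. 0 < s \<Longrightarrow> s \<le> t \<Longrightarrow> W s \<le> W t" and h: "0 < h" "h \<le> \<delta>" and p: "p < 1"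
  shows "(\<Sum>j<n. ennreal ((2 ^ j) powr (1 - p)) * W (h / 2 ^ Suc j))
    \<le> ennreal (2 * h powr (1 - p)) * (\<integral>\<^sup>+t\<in>{0<..<\<delta>}. W t / ennreal (t powr (2 - p)) \<partial>lebesgue)"
proof -
  define A where "A j = {h / 2 ^ Suc j..<h / 2 ^ j}" for j :: nat
  define c where "c j = W (h / 2 ^ Suc j) / ennreal ((h / 2 ^ j) powr (2 - p))" for j :: nat
  define f where "f t = W t / ennreal (t powr (2 - p)) * indicator {0<..<\<delta>} t" for t
  have A_uniq: "i = j" if "t \<in> A i" "t \<in> A j" for t i j
  proof -
    have "\<not> (a < b)" if "t \<in> A a" "t \<in> A b" for a b
    proof
      assume "a < b"
      then have "h / 2 ^ b \<le> h / 2 ^ Suc a"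
        using h by (intro divide_left_mono power_increasing) auto
      then show False
        using that by (auto simp: A_def)
    qed
    then show ?thesis
      using that by (meson nat_neq_iff)
  qed
  have c_le: "c j \<le> f t" if "t \<in> A j" for j t
  proof -
    have t: "h / 2 ^ Suc j \<le> t" "t < h / 2 ^ j"
      using that by (auto simp: A_def)
    have "0 < h / 2 ^ Suc j" "h / 2 ^ j \<le> h"
      using h by (auto simp: field_simps)
    with t h have "0 < t" "t < \<delta>"
      by linarith+
    moreover have "W (h / 2 ^ Suc j) \<le> W t"
      by (rule mono) (use t \<open>0 < h / 2 ^ Suc j\<close> in auto)
    moreover have "t powr (2 - p) \<le> (h / 2 ^ j) powr (2 - p)"
      using t p \<open>0 < t\<close> by (intro powr_mono2) auto
    ultimately show ?thesis
      using h \<open>0 < h / 2 ^ Suc j\<close>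
      by (auto simp: c_def f_def divide_ennreal_def inverse_ennreal
          intro!: mult_mono ennreal_leI le_imp_inverse_le)
  qed
  have "(\<Sum>j<n. c j * indicator (A j) t) \<le> f t" for t
  proof (cases "\<exists>i<n. t \<in> A i")
    case True
    then obtain i where i: "i < n" "t \<in> A i" by blast
    then have "(\<Sum>j<n. c j * indicator (A j) t) = (\<Sum>j\<in>{i}. c j * indicator (A j) t)"
      by (intro sum.mono_neutral_right) (auto simp: indicator_def dest: A_uniq)
    then show ?thesis
      using i c_le by simp
  qed (simp add: indicator_def)
  then have "(\<integral>\<^sup>+t. (\<Sum>j<n. c j * indicator (A j) t) \<partial>lebesgue) \<le> (\<integral>\<^sup>+t. f t \<partial>lebesgue)"
    by (intro nn_integral_mono)
  also have "(\<integral>\<^sup>+t. (\<Sum>j<n. c j * indicator (A j) t) \<partial>lebesgue) = (\<Sum>j<n. c j * emeasure lebesgue (A j))"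
    by (subst nn_integral_sum) (auto simp: A_def nn_integral_cmult_indicator
          intro!: borel_measurable_times_ennreal borel_measurable_indicator)
  finally have *: "(\<Sum>j<n. c j * emeasure lebesgue (A j)) \<le> (\<integral>\<^sup>+t. f t \<partial>lebesgue)" .
  have assoc: "ennreal X * (w * ennreal Y * ennreal Z) = ennreal (X * Y * Z) * w"
    if "0 \<le> X" "0 \<le> Y" "0 \<le> Z" for X Y Z :: real and w
    using that by (simp add: ennreal_mult ac_simps)
  have term_eq: "ennreal (2 * h powr (1 - p)) * (c j * emeasure lebesgue (A j))
      = ennreal ((2 ^ j) powr (1 - p)) * W (h / 2 ^ Suc j)" for j
  proof -
    define d where "d = h / 2 ^ j"
    have d: "d > 0" "h / 2 ^ Suc j = d / 2" "h = d * 2 ^ j"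
      using h by (auto simp: d_def)
    have "ennreal (2 * h powr (1 - p)) * (c j * emeasure lebesgue (A j))
       = ennreal (2 * h powr (1 - p)) * (W (d / 2) * ennreal (1 / d powr (2 - p)) * ennreal (d / 2))"
      using d by (simp add: c_def A_def d_def[symmetric] divide_ennreal_def inverse_ennreal d(2)[simplified]
          inverse_eq_divide)
    also have "\<dots> = ennreal (2 * h powr (1 - p) * (1 / d powr (2 - p)) * (d / 2)) * W (d / 2)"
      using d by (intro assoc) auto
    also have "2 * h powr (1 - p) * (1 / d powr (2 - p)) * (d / 2) = (2 ^ j) powr (1 - p)"
    proof -
      have "d powr (2 - p) = d * d powr (1 - p)"
        using d(1) powr_add[of d 1 "1 - p"] by simp
      then show ?thesis
        using d(1) by (simp add: d(3) powr_mult)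
    qed
    finally show ?thesis
      using d by simp
  qed
  show ?thesis
    using mult_left_mono[OF *, of "ennreal (2 * h powr (1 - p))"]
    by (simp add: sum_distrib_left term_eq f_def)
qed

text \<open>
  Where \<open>|\<phi>| \<le> e\<close>, the integrand is at most \<open>e powr p\<close>; elsewhere \<open>|\<phi>| powr p = |\<phi>| powr (p - 1) |\<phi>|\<close>
  is at most \<open>e powr (p - 1) |\<phi>|\<close>.
\<close>
lemma Lpow_le_Lpow_1:
  assumes [measurable]: "\<phi> \<in> borel_measurable borel" and "0 < p" "p \<le> 1" "0 < e"
  shows "Lpow p \<phi> \<le> ennreal (2 * pi * e powr p) + ennreal (e powr (p - 1)) * Lpow 1 \<phi>"
proof -
  have *: "y powr p \<le> e powr p + e powr (p - 1) * y" if "y \<ge> 0" for y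
  proof (cases "y \<le> e")
    case True
    then have "y powr p \<le> e powr p"
      using assms that by (intro powr_mono2) auto
    then show ?thesis
      using that by (simp add: add_increasing2)
  next
    case False
    then have "y powr (p - 1) \<le> e powr (p - 1)"
      using assms by (intro powr_mono2') auto
    then have "y powr p \<le> e powr (p - 1) * y"
      using mult_right_mono[of "y powr (p - 1)" "e powr (p - 1)" y] False assms
      by (simp add: powr_diff)
    then show ?thesis
      by (simp add: add_increasing)
  qed
  have "Lpow p \<phi> \<le> (\<integral>\<^sup>+x. ennreal (e powr p) * indicator {0..<2 * pi} x +
       ennreal (e powr (p - 1)) * (ennreal (norm (\<phi> x) powr 1) * indicator {0..<2 * pi} x) \<partial>lborel)"
    unfolding Lpow_def
    by (intro nn_integral_mono)
       (auto simp: indicator_def * simp flip: ennreal_plus ennreal_mult intro!: ennreal_leI)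
  also have "\<dots> = (\<integral>\<^sup>+x. ennreal (e powr p) * indicator {0..<2 * pi} x \<partial>lborel) +
       (\<integral>\<^sup>+x. ennreal (e powr (p - 1)) * (ennreal (norm (\<phi> x) powr 1) * indicator {0..<2 * pi} x) \<partial>lborel)"
    by (rule nn_integral_add) measurable
  also have "\<dots> = ennreal (2 * pi * e powr p) + ennreal (e powr (p - 1)) * Lpow 1 \<phi>"
    unfolding Lpow_def
    by (subst nn_integral_cmult) (auto simp: nn_integral_cmult_indicator ennreal_mult mult.commute)
  finally show ?thesis .
qed

lemma Lpow_le_of_L1_limit:
  assumes [measurable]: "H \<in> borel_measurable borel" "\<And>n. D n \<in> borel_measurable borel"
    and lim: "(\<lambda>n. Lpow 1 (\<lambda>x. H x - D n x)) \<longlonglongrightarrow> 0"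
    and bound: "\<And>n. Lpow p (D n) \<le> B" and p: "0 < p" "p \<le> 1"
  shows "Lpow p H \<le> B"
proof (rule ennreal_le_epsilon)
  fix \<epsilon> :: real assume "\<epsilon> > 0"
  \<comment> \<open>The threshold for which the first term of \<open>Lpow_le_Lpow_1\<close> is \<open>\<epsilon> / 2\<close>.\<close>
  define e where "e = (\<epsilon> / (4 * pi)) powr (1 / p)"
  have e: "e > 0" "2 * pi * e powr p = \<epsilon> / 2"
    using \<open>\<epsilon> > 0\<close> p by (auto simp: e_def powr_powr)
  have "(\<lambda>n. ennreal (e powr (p - 1)) * Lpow 1 (\<lambda>x. H x - D n x)) \<longlonglongrightarrow> ennreal (e powr (p - 1)) * 0"
    by (intro ennreal_tendsto_cmult lim) auto
  then have "\<forall>\<^sub>F n in sequentially. ennreal (e powr (p - 1)) * Lpow 1 (\<lambda>x. H x - D n x) < ennreal (\<epsilon> / 2)"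
    using \<open>\<epsilon> > 0\<close> by (intro order_tendstoD(2)) auto
  then obtain n where n: "ennreal (e powr (p - 1)) * Lpow 1 (\<lambda>x. H x - D n x) < ennreal (\<epsilon> / 2)"
    by (auto simp: eventually_sequentially)
  have "Lpow p H = Lpow p (\<lambda>x. D n x + (H x - D n x))"
    by simp
  also have "\<dots> \<le> Lpow p (D n) + Lpow p (\<lambda>x. H x - D n x)"
    by (rule Lpow_add_le) (use p in measurable)
  also have "\<dots> \<le> B + (ennreal (2 * pi * e powr p) + ennreal (e powr (p - 1)) * Lpow 1 (\<lambda>x. H x - D n x))"
    by (intro add_mono bound Lpow_le_Lpow_1) (use p e in auto)
  also have "\<dots> \<le> B + (ennreal (\<epsilon> / 2) + ennreal (\<epsilon> / 2))"
    using n by (intro add_mono) (auto simp: e)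
  also have "\<dots> = B + ennreal \<epsilon>"
    using \<open>\<epsilon> > 0\<close> by (simp flip: ennreal_plus)
  finally show "Lpow p H \<le> B + ennreal \<epsilon>" .
qed

text \<open>
  The sum over the grid with \<open>2\<^sup>n\<close> cells is the one with a single cell plus \<open>n\<close> refinements. Here \<open>W\<close>
  stands for the \<open>p\<close>-th power of the modulus of smoothness of order \<open>k\<close>.
\<close>
lemma Lpow_quadrature_le:
  assumes k: "k \<ge> 1" and r: "r \<ge> 1" and p: "0 < p" "p < 1"
    and M: "[:1/2, 1/2:] ^ r * M - dilate 2 M = [:1, -1:] ^ k * q"
  shows "\<exists>C>0. \<forall>g W h \<delta> n. g \<in> borel_measurable borel \<longrightarrow> periodic g \<longrightarrow>
      (\<forall>t>0. Lpow p (fwd_diff k t g) \<le> W t) \<longrightarrow> (\<forall>s t. 0 < s \<longrightarrow> s \<le> t \<longrightarrow> W s \<le> W t) \<longrightarrow>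
      0 < h \<longrightarrow> h \<le> \<delta> \<longrightarrow>
      Lpow p (quadrature (2 ^ n) r M h (fwd_diff k h g))
        \<le> ennreal (C * h powr (1 - p)) * (\<integral>\<^sup>+t\<in>{0<..<\<delta>}. W t / ennreal (t powr (2 - p)) \<partial>lebesgue)"
proof -
  define C0 where "C0 = coeff_psum p M * coeff_psum p ([:1, 1:] ^ k)"
  define C1 where "C1 = real r * coeff_psum p q * coeff_psum p ([:1, -1:] ^ k)"
  have C: "C0 \<ge> 0" "C1 \<ge> 0"
    by (auto simp: C0_def C1_def coeff_psum_nonneg)
  have main: "Lpow p (quadrature (2 ^ n) r M h (fwd_diff k h g))
        \<le> ennreal ((2 * (C0 + C1) + 1) * h powr (1 - p)) *
           (\<integral>\<^sup>+t\<in>{0<..<\<delta>}. W t / ennreal (t powr (2 - p)) \<partial>lebesgue)"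
    if g [measurable]: "g \<in> borel_measurable borel" and per: "periodic g"
      and W: "\<And>t. 0 < t \<Longrightarrow> Lpow p (fwd_diff k t g) \<le> W t"
      and mono: "\<And>s t. 0 < s \<Longrightarrow> s \<le> t \<Longrightarrow> W s \<le> W t" and h: "0 < h" "h \<le> \<delta>"
    for g W h \<delta> n
  proof -
    define D where "D j = quadrature (2 ^ j) r M h (fwd_diff k h g)" for j
    have [measurable]: "D j \<in> borel_measurable borel" for j
      by (simp add: D_def quadrature_def)
    define I where "I = (\<integral>\<^sup>+t\<in>{0<..<\<delta>}. W t / ennreal (t powr (2 - p)) \<partial>lebesgue)"
    define w where "w j = ennreal ((2 ^ j) powr (1 - p)) * W (h / 2 ^ Suc j)" for j :: nat
    have sum_w: "(\<Sum>j<n. w j) \<le> ennreal (2 * h powr (1 - p)) * I" for n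
      unfolding w_def I_def by (rule dyadic_sum_le_integral) (use mono h p in auto)
    have D0: "Lpow p (D 0) \<le> ennreal C0 * w 0"
    proof -
      have "Lpow p (D 0) \<le> ennreal C0 * Lpow p (fwd_diff k (h / 2) g)"
        unfolding D_def C0_def power_0 by (rule Lpow_quadrature_1_le) (use per p in auto)
      also have "\<dots> \<le> ennreal C0 * w 0"
        using W[of "h / 2"] h by (auto simp: w_def intro!: mult_left_mono)
      finally show ?thesis .
    qed
    have step: "Lpow p (\<lambda>x. D (Suc j) x - D j x) \<le> ennreal C1 * w j" for j
    proof -
      have "Lpow p (\<lambda>x. D (Suc j) x - D j x)
        \<le> ennreal (C1 * real (2 ^ j) powr (1 - p)) * Lpow p (fwd_diff k (h / real (2 * 2 ^ j)) g)"
        unfolding D_def C1_def power_Suc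
        by (rule Lpow_quadrature_refine_le[OF M]) (use per p r in auto)
      also have "\<dots> \<le> ennreal (C1 * real (2 ^ j) powr (1 - p)) * W (h / 2 ^ Suc j)"
        using W[of "h / (2 * 2 ^ j)"] h by (auto intro!: mult_left_mono)
      also have "\<dots> = ennreal C1 * w j"
        using C by (simp add: w_def ennreal_mult mult.assoc)
      finally show ?thesis .
    qed
    have "Lpow p (D n) \<le> ennreal C0 * w 0 + ennreal C1 * (\<Sum>j<n. w j)"
    proof (induction n)
      case (Suc n)
      have "Lpow p (D (Suc n)) = Lpow p (\<lambda>x. D n x + (D (Suc n) x - D n x))"
        by simp
      also have "\<dots> \<le> Lpow p (D n) + Lpow p (\<lambda>x. D (Suc n) x - D n x)"
        by (rule Lpow_add_le) (use p in auto)
      also have "\<dots> \<le> ennreal C0 * w 0 + ennreal C1 * (\<Sum>j<n. w j) + ennreal C1 * w n"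
        by (intro add_mono Suc step)
      finally show ?case
        by (simp add: distrib_left add.assoc)
    qed (use D0 in simp)
    also have "\<dots> \<le> ennreal C0 * (ennreal (2 * h powr (1 - p)) * I) + ennreal C1 * (ennreal (2 * h powr (1 - p)) * I)"
      using sum_w[of 1] by (intro add_mono mult_left_mono sum_w) auto
    also have "\<dots> = ennreal ((2 * (C0 + C1)) * h powr (1 - p)) * I"
      using C by (simp add: ennreal_mult ennreal_plus distrib_right distrib_left mult_ac)
    also have "\<dots> \<le> ennreal ((2 * (C0 + C1) + 1) * h powr (1 - p)) * I"
      by (intro mult_right_mono ennreal_leI) auto
    finally show ?thesis
      by (simp add: D_def I_def)
  qed
  show ?thesis
    by (rule exI[of _ "2 * (C0 + C1) + 1"]) (use C main in auto)
qed

section \<open>Absolutely continuous functions are differentiable almost everywhere\<close>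

lemma absolutely_continuous_on_finite_family:
  assumes "absolutely_continuous_on S g" "e > 0"
  shows "\<exists>d>0. \<forall>(A :: 'i set) a b. finite A \<longrightarrow> (\<forall>i\<in>A. a i \<le> b i \<and> {a i..b i} \<subseteq> S) \<longrightarrow>
       disjoint_family_on (\<lambda>i. {a i<..<b i}) A \<longrightarrow> (\<Sum>i\<in>A. b i - a i) < d \<longrightarrow>
       (\<Sum>i\<in>A. norm (g (b i) - g (a i))) < e"
proof -
  from assms(1)[unfolded absolutely_continuous_on_def, THEN spec[of _ e], THEN mp, OF assms(2)]
  obtain d where "d > 0" and d: "\<forall>(n::nat) (a :: nat \<Rightarrow> real) b.
        (\<forall>i<n. a i \<le> b i \<and> {a i..b i} \<subseteq> S) \<and>
        disjoint_family_on (\<lambda>i. {a i<..<b i}) {..<n} \<and>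
        (\<Sum>i<n. b i - a i) < d
        \<longrightarrow> (\<Sum>i<n. norm (g (b i) - g (a i))) < e"
    by (elim exE conjE)
  show ?thesis
  proof (intro exI[of _ d] conjI \<open>d > 0\<close> allI impI)
    fix A :: "'i set" and a b :: "'i \<Rightarrow> real"
    assume A: "finite A" "\<forall>i\<in>A. a i \<le> b i \<and> {a i..b i} \<subseteq> S"
      "disjoint_family_on (\<lambda>i. {a i<..<b i}) A" "(\<Sum>i\<in>A. b i - a i) < d"
    obtain \<pi> where \<pi>: "bij_betw \<pi> {..<card A} A"
      using ex_bij_betw_nat_finite[OF \<open>finite A\<close>] by (auto simp: atLeast0LessThan)
    have in_A: "\<pi> i \<in> A" if "i < card A" for i
      using \<pi> that by (auto simp: bij_betw_def)
    have disj: "disjoint_family_on (\<lambda>i. {a (\<pi> i)<..<b (\<pi> i)}) {..<card A}"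
      unfolding disjoint_family_on_def
    proof (intro ballI impI)
      fix i j assume ij: "i \<in> {..<card A}" "j \<in> {..<card A}" "i \<noteq> j"
      then have "\<pi> i \<noteq> \<pi> j"
        using \<pi> by (auto simp: bij_betw_def inj_on_def)
      then show "{a (\<pi> i)<..<b (\<pi> i)} \<inter> {a (\<pi> j)<..<b (\<pi> j)} = {}"
        using A(3) in_A ij unfolding disjoint_family_on_def by blast
    qed
    have "(\<Sum>i<card A. norm (g (b (\<pi> i)) - g (a (\<pi> i)))) < e"
    proof (rule d[THEN spec, THEN spec, THEN spec, THEN mp], intro conjI disj)
      show "(\<Sum>i<card A. b (\<pi> i) - a (\<pi> i)) < d"
        using A(4) sum.reindex_bij_betw[OF \<pi>, of "\<lambda>i. b i - a i"] by simp
      show "\<forall>i<card A. a (\<pi> i) \<le> b (\<pi> i) \<and> {a (\<pi> i)..b (\<pi> i)} \<subseteq> S"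
        using A(2) in_A by blast
    qed
    then show "(\<Sum>i\<in>A. norm (g (b i) - g (a i))) < e"
      using sum.reindex_bij_betw[OF \<pi>, of "\<lambda>i. norm (g (b i) - g (a i))"] by simp
  qed
qed

lemma sum_division_differences:
  fixes h :: "real \<Rightarrow> real"
  assumes "u \<le> v" and q: "q division_of {u..v}"
  shows "(\<Sum>K\<in>q. h (Sup K) - h (Inf K)) = h v - h u"
proof -
  let ?p = "(\<lambda>K. (Inf K, K)) ` q"
  have K: "\<exists>c d. K = {c..d} \<and> c \<le> d" "K \<subseteq> {u..v}" if "K \<in> q" for K
    using division_ofD(2,3,4)[OF q that] by (auto simp: cbox_interval)
  have "?p tagged_division_of {u..v}"
  proof (rule tagged_division_ofI)
    show "finite ?p"
      using division_ofD(1)[OF q] by simp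
    show "\<Union> {K. \<exists>x. (x, K) \<in> ?p} = {u..v}"
    proof -
      have "{K. \<exists>x. (x, K) \<in> ?p} = q"
        by auto
      then show ?thesis
        using division_ofD(6)[OF q] by simp
    qed
    fix x K assume xK: "(x, K) \<in> ?p"
    then have Kq: "K \<in> q" and x: "x = Inf K"
      by auto
    then obtain c d where "K = {c..d}" "c \<le> d"
      using K by blast
    then show "x \<in> K" "\<exists>a b. K = cbox a b"
      using x by (auto simp: cbox_interval)
    show "K \<subseteq> {u..v}"
      using K Kq by blast
    fix x' K' assume "(x', K') \<in> ?p" "(x, K) \<noteq> (x', K')"
    then show "interior K \<inter> interior K' = {}"
      using xK division_ofD(5)[OF q] by blast
  qed
  from additive_tagged_division_1[OF \<open>u \<le> v\<close> this, of h] show ?thesis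
    by (simp add: sum.reindex inj_on_def)
qed

lemma sum_interval_lengths_eq_measure:
  fixes a b :: "'i \<Rightarrow> real"
  assumes "finite C" "\<And>i. i \<in> C \<Longrightarrow> a i \<le> b i" "disjoint_family_on (\<lambda>i. {a i..b i}) C"
  shows "measure lebesgue (\<Union>i\<in>C. {a i..b i}) = (\<Sum>i\<in>C. b i - a i)"
proof -
  have "measure lebesgue (\<Union>i\<in>C. {a i..b i}) = (\<Sum>i\<in>C. measure lebesgue {a i..b i})"
    by (rule measure_finite_Union) (use assms in auto)
  then show ?thesis
    using assms by simp
qed

text \<open>
  Vitali's theorem gives a countable disjoint family that covers almost all of \<open>S\<close>; by continuity
  of the measure, finitely many of its members leave out less than \<open>e\<close>.
\<close>
lemma Vitali_finite_intervals:
  fixes K :: "(real \<times> real) set"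
  assumes S: "S \<in> lmeasurable" and K: "\<And>s t. (s, t) \<in> K \<Longrightarrow> s < t"
    and cover: "\<And>x d. \<lbrakk>x \<in> S; d > 0\<rbrakk> \<Longrightarrow> \<exists>s t. (s, t) \<in> K \<and> s \<le> x \<and> x \<le> t \<and> t - s < d"
    and "e > 0"
  obtains C where "finite C" "C \<subseteq> K" "disjoint_family_on (\<lambda>i. {fst i..snd i}) C"
    "measure lebesgue S - e < measure lebesgue (S \<inter> (\<Union>i\<in>C. {fst i..snd i}))"
proof -
  define m r where "m i = (fst i + snd i) / 2" and "r i = (snd i - fst i) / 2" for i :: "real \<times> real"
  have cball: "cball (m i) (r i) = {fst i..snd i}" for i
    by (simp add: cball_eq_atLeastAtMost m_def r_def field_simps)
  obtain C where C: "countable C" "C \<subseteq> K"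
     "pairwise (\<lambda>i j. disjnt (cball (m i) (r i)) (cball (m j) (r j))) C"
     "negligible (S - (\<Union>i\<in>C. cball (m i) (r i)))"
  proof (rule Vitali_covering_theorem_cballs[of K r S m])
    show "0 < r i" if "i \<in> K" for i
      using K[of "fst i" "snd i"] that by (simp add: r_def)
    show "\<exists>i. i \<in> K \<and> x \<in> cball (m i) (r i) \<and> r i < d" if xd: "x \<in> S" "0 < d" for x d
    proof -
      obtain s t where "(s, t) \<in> K" "s \<le> x" "x \<le> t" "t - s < d"
        using cover[OF xd] by blast
      moreover from this have "x \<in> cball (m (s, t)) (r (s, t))"
        unfolding cball by simp
      moreover have "r (s, t) < d"
        using \<open>t - s < d\<close> \<open>0 < d\<close> by (simp add: r_def)
      ultimately show ?thesis
        by blast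
    qed
  qed
  define \<D> where "\<D> = (\<lambda>i. S \<inter> {fst i..snd i}) ` C"
  have meas: "D \<in> lmeasurable" if "D \<in> \<D>" for D
    using that S by (auto simp: \<D>_def intro!: fmeasurable_Int_fmeasurable)
  have sub: "\<Union>\<D> \<subseteq> S"
    by (auto simp: \<D>_def)
  obtain D' where D': "D' \<subseteq> \<D>" "finite D'" "measure lebesgue (\<Union>\<D>) - e < measure lebesgue (\<Union>D')"
  proof (rule measure_countable_Union_approachable[of \<D> e "measure lebesgue S"])
    show "countable \<D>"
      using C by (simp add: \<D>_def)
    show "measure lebesgue (\<Union>D') \<le> measure lebesgue S" if "D' \<subseteq> \<D>" "finite D'" for D'
      using that S sub meas
      by (intro measure_mono_fmeasurable fmeasurableD fmeasurable.finite_Union) auto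
  qed (use meas \<open>e > 0\<close> in auto)
  obtain C' where C': "C' \<subseteq> C" "finite C'" "D' = (\<lambda>i. S \<inter> {fst i..snd i}) ` C'"
    using D'(1,2) unfolding \<D>_def by (meson finite_subset_image)
  have "measure lebesgue (\<Union>\<D>) = measure lebesgue S"
  proof (rule measure_negligible_symdiff[OF S])
    have "S - \<Union>\<D> \<union> (\<Union>\<D> - S) \<subseteq> S - (\<Union>i\<in>C. cball (m i) (r i))"
      by (auto simp: \<D>_def cball)
    then show "negligible (S - \<Union>\<D> \<union> (\<Union>\<D> - S))"
      using C(4) negligible_subset by blast
  qed
  moreover have "\<Union>D' = S \<inter> (\<Union>i\<in>C'. {fst i..snd i})"
    by (auto simp: C')
  moreover have "disjoint_family_on (\<lambda>i. {fst i..snd i}) C'"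
  proof (rule disjoint_family_on_mono[OF C'(1)])
    show "disjoint_family_on (\<lambda>i. {fst i..snd i}) C"
      using C(3) unfolding disjoint_family_on_def pairwise_def disjnt_def cball by blast
  qed
  ultimately show thesis
    using that[of C'] C(2) C' D' by auto
qed

text \<open>
  The intervals of \<open>C1\<close> minus those of \<open>C2\<close> are again finitely many nonoverlapping intervals. Their
  family \<open>G\<close> is indexed by pairs, the first component being the interval of \<open>C1\<close> that is divided, so
  that degenerate pieces of different intervals stay distinct. Increments of any function add
  up; with \<open>h x = x\<close> this is the balance of the lengths.
\<close>
lemma interval_family_gaps:
  fixes C1 C2 :: "(real \<times> real) set"
  assumes C1: "finite C1" "disjoint_family_on (\<lambda>i. {fst i..snd i}) C1" "\<And>i. i \<in> C1 \<Longrightarrow> fst i < snd i"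
    and C2: "finite C2" "disjoint_family_on (\<lambda>i. {fst i..snd i}) C2" "\<And>i. i \<in> C2 \<Longrightarrow> fst i < snd i"
    and sub: "\<And>i. i \<in> C2 \<Longrightarrow> \<exists>j\<in>C1. {fst i..snd i} \<subseteq> {fst j..snd j}"
  obtains G :: "((real \<times> real) \<times> real set) set" where "finite G"
    "\<And>i. i \<in> G \<Longrightarrow> Inf (snd i) \<le> Sup (snd i) \<and> (\<exists>j\<in>C1. {Inf (snd i)..Sup (snd i)} \<subseteq> {fst j..snd j})"
    "disjoint_family_on (\<lambda>i. {Inf (snd i)<..<Sup (snd i)}) G"
    "\<And>h :: real \<Rightarrow> real. (\<Sum>j\<in>C1. h (snd j) - h (fst j))
        = (\<Sum>i\<in>C2. h (snd i) - h (fst i)) + (\<Sum>i\<in>G. h (Sup (snd i)) - h (Inf (snd i)))"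
proof -
  define sel where "sel j = {i \<in> C2. {fst i..snd i} \<subseteq> {fst j..snd j}}" for j :: "real \<times> real"
  define J where "J j = (\<lambda>i. {fst i..snd i}) ` sel j" for j
  have J_div: "J j division_of \<Union>(J j)" for j
  proof (rule division_ofI)
    show "finite (J j)"
      using C2(1) by (simp add: J_def sel_def)
    fix K assume K: "K \<in> J j"
    then obtain i where i: "i \<in> C2" "K = {fst i..snd i}"
      by (auto simp: J_def sel_def)
    with C2(3) show "K \<noteq> {}" "\<exists>a b. K = cbox a b"
      unfolding cbox_interval by (auto simp: less_imp_le)
    show "K \<subseteq> \<Union>(J j)"
      using K by blast
    fix K' assume "K' \<in> J j" "K \<noteq> K'"
    then obtain i' where i': "i' \<in> C2" "K' = {fst i'..snd i'}" "i \<noteq> i'"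
      using i by (auto simp: J_def sel_def)
    then have "K \<inter> K' = {}"
      using disjoint_family_onD[OF C2(2) i(1) i'(1,3)] i by simp
    then show "interior K \<inter> interior K' = {}"
      using interior_subset[of K] interior_subset[of K'] by blast
  qed auto
  have "\<exists>q. J j \<subseteq> q \<and> q division_of cbox (fst j) (snd j)" for j
    by (rule partial_division_extend_interval[OF J_div[of j], of "fst j" "snd j"])
       (auto simp: J_def sel_def cbox_interval)
  then obtain q where q: "\<And>j. J j \<subseteq> q j" "\<And>j. q j division_of {fst j..snd j}"
    unfolding cbox_interval by metis
  have K: "K = {Inf K..Sup K}" "Inf K \<le> Sup K" "K \<subseteq> {fst j..snd j}" if "K \<in> q j" for K j
    using division_ofD(2,3,4)[OF q(2) that] by (auto simp: cbox_interval)
  define G where "G = (SIGMA j:C1. q j - J j)"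
  show thesis
  proof (rule that[of G])
    have fin_q: "finite (q j)" for j
      using division_ofD(1)[OF q(2)] .
    then show "finite G"
      by (simp add: G_def C1)
    show "Inf (snd i) \<le> Sup (snd i) \<and> (\<exists>j\<in>C1. {Inf (snd i)..Sup (snd i)} \<subseteq> {fst j..snd j})"
      if "i \<in> G" for i
    proof -
      have "fst i \<in> C1" "snd i \<in> q (fst i)"
        using that by (auto simp: G_def)
      then show ?thesis
        using K[of "snd i" "fst i"] by auto
    qed
    show "disjoint_family_on (\<lambda>i. {Inf (snd i)<..<Sup (snd i)}) G"
      unfolding disjoint_family_on_def
    proof (intro ballI impI)
      fix i i' assume i: "i \<in> G" "i' \<in> G" "i \<noteq> i'"
      obtain j K1 j' K2 where eq: "i = (j, K1)" "i' = (j', K2)"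
        by (metis surj_pair)
      have in_q: "K1 \<in> q j" "K2 \<in> q j'" "j \<in> C1" "j' \<in> C1"
        using i by (auto simp: G_def eq)
      have int: "{Inf K1<..<Sup K1} = interior K1" "{Inf K2<..<Sup K2} = interior K2"
        using K(1)[OF in_q(1)] K(1)[OF in_q(2)] interior_atLeastAtMost_real by metis+
      show "{Inf (snd i)<..<Sup (snd i)} \<inter> {Inf (snd i')<..<Sup (snd i')} = {}"
      proof (cases "j = j'")
        case True
        then have "K1 \<noteq> K2"
          using i eq by auto
        then show ?thesis
          using division_ofD(5)[OF q(2)] in_q True by (simp add: eq int)
      next
        case False
        then have "{fst j..snd j} \<inter> {fst j'..snd j'} = {}"
          using C1(2) in_q by (auto simp: disjoint_family_on_def)
        then show ?thesis
          using K(3) in_q interior_subset unfolding eq snd_conv int by blast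
      qed
    qed
    fix h :: "real \<Rightarrow> real"
    have "(\<Sum>j\<in>C1. h (snd j) - h (fst j)) = (\<Sum>j\<in>C1. \<Sum>K\<in>q j. h (Sup K) - h (Inf K))"
      by (intro sum.cong refl sum_division_differences[symmetric] q less_imp_le C1(3))
    also have "\<dots> = (\<Sum>j\<in>C1. (\<Sum>K\<in>J j. h (Sup K) - h (Inf K)) + (\<Sum>K\<in>q j - J j. h (Sup K) - h (Inf K)))"
      by (intro sum.cong refl) (subst sum.subset_diff[OF q(1) fin_q], simp add: add.commute)
    also have "\<dots> = (\<Sum>j\<in>C1. \<Sum>K\<in>J j. h (Sup K) - h (Inf K)) + (\<Sum>i\<in>G. h (Sup (snd i)) - h (Inf (snd i)))"
      unfolding sum.distrib G_def using C1(1) fin_q by (subst (2) sum.Sigma) (auto intro!: sum.cong)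
    also have "(\<Sum>j\<in>C1. \<Sum>K\<in>J j. h (Sup K) - h (Inf K)) = (\<Sum>j\<in>C1. \<Sum>i\<in>sel j. h (snd i) - h (fst i))"
    proof (intro sum.cong refl)
      fix j
      have "inj_on (\<lambda>i. {fst i..snd i}) (sel j)"
      proof (rule inj_onI)
        fix x y assume xy: "x \<in> sel j" "y \<in> sel j" "{fst x..snd x} = {fst y..snd y}"
        then have "fst x < snd x"
          using C2(3) by (simp add: sel_def)
        with xy(3) show "x = y"
          by (simp add: Icc_eq_Icc prod_eq_iff)
      qed
      moreover have ends: "Inf {fst i..snd i} = fst i" "Sup {fst i..snd i} = snd i" if "i \<in> sel j" for i
        using C2(3)[of i] that by (simp_all add: sel_def less_imp_le)
      ultimately show "(\<Sum>K\<in>J j. h (Sup K) - h (Inf K)) = (\<Sum>i\<in>sel j. h (snd i) - h (fst i))"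
        unfolding J_def using ends by (subst sum.reindex) (auto intro!: sum.cong)
    qed
    also have "\<dots> = (\<Sum>i\<in>(\<Union>j\<in>C1. sel j). h (snd i) - h (fst i))"
    proof (rule sum.UNION_disjoint[symmetric])
      show "\<forall>i\<in>C1. \<forall>j\<in>C1. i \<noteq> j \<longrightarrow> sel i \<inter> sel j = {}"
      proof (intro ballI impI equals0I)
        fix i j c assume "i \<in> C1" "j \<in> C1" "i \<noteq> j" and c: "c \<in> sel i \<inter> sel j"
        then have "{fst i..snd i} \<inter> {fst j..snd j} = {}"
          using C1(2) by (auto simp: disjoint_family_on_def)
        moreover have "fst c \<in> {fst i..snd i} \<inter> {fst j..snd j}"
          using c C2(3)[of c] by (auto simp: sel_def)
        ultimately show False by blast
      qed
    qed (use C1 C2 in \<open>auto simp: sel_def\<close>)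
    also have "(\<Union>j\<in>C1. sel j) = C2"
      using sub by (auto simp: sel_def)
    finally show "(\<Sum>j\<in>C1. h (snd j) - h (fst j))
        = (\<Sum>i\<in>C2. h (snd i) - h (fst i)) + (\<Sum>i\<in>G. h (Sup (snd i)) - h (Inf (snd i)))" .
  qed
qed

lemma disjoint_intervals_open:
  assumes "disjoint_family_on (\<lambda>i. {a i..b i :: real}) A"
  shows "disjoint_family_on (\<lambda>i. {a i<..<b i}) A"
  unfolding disjoint_family_on_def
proof (intro ballI impI)
  fix i j assume "i \<in> A" "j \<in> A" "i \<noteq> j"
  then have "{a i..b i} \<inter> {a j..b j} = {}"
    using assms by (simp add: disjoint_family_on_def)
  moreover have "{a i<..<b i} \<subseteq> {a i..b i}" "{a j<..<b j} \<subseteq> {a j..b j}"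
    by auto
  ultimately show "{a i<..<b i} \<inter> {a j<..<b j} = {}"
    by blast
qed

text \<open>
  Let \<open>C1\<close> be a Vitali family of intervals with slope at most \<open>a\<close> inside an open set that is only
  slightly larger than \<open>E\<close>, and \<open>C2\<close> a Vitali family of intervals with slope at least \<open>b\<close> inside those
  of \<open>C1\<close>. Both exhaust \<open>E\<close> up to little, so the gaps between them have small total length, and by
  absolute continuity \<open>F\<close> changes little on the gaps. Hence the increments of \<open>F\<close> over the two
  families almost agree, and so do the lengths: \<open>b\<close> times the measure of \<open>E\<close> is essentially at most
  \<open>a\<close> times that measure.
\<close>
lemma AC_two_slopes_null:
  fixes F :: "real \<Rightarrow> real" and a b :: real
  assumes AC: "absolutely_continuous_on {u0..v0} (\<lambda>x. complex_of_real (F x))"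
    and "a < b" and E: "E \<subseteq> {u0<..<v0}" "E \<in> lmeasurable"
    and lower: "\<And>x d. \<lbrakk>x \<in> E; d > 0\<rbrakk> \<Longrightarrow>
      \<exists>s t. s < t \<and> s \<le> x \<and> x \<le> t \<and> t - s < d \<and> F t - F s \<le> a * (t - s)"
    and upper: "\<And>x d. \<lbrakk>x \<in> E; d > 0\<rbrakk> \<Longrightarrow>
      \<exists>s t. s < t \<and> s \<le> x \<and> x \<le> t \<and> t - s < d \<and> b * (t - s) \<le> F t - F s"
  shows "measure lebesgue E = 0"
proof (rule ccontr)
  define m where "m = measure lebesgue E"
  assume "measure lebesgue E \<noteq> 0"
  then have m: "m > 0"
    by (simp add: m_def less_le)
  define \<epsilon> where "\<epsilon> = (b - a) * m / 4"
  have "\<epsilon> > 0"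
    using m \<open>a < b\<close> by (simp add: \<epsilon>_def)
  obtain d where "d > 0" and d: "\<forall>(A :: ((real \<times> real) \<times> real set) set) a b. finite A \<longrightarrow>
       (\<forall>i\<in>A. a i \<le> b i \<and> {a i..b i} \<subseteq> {u0..v0}) \<longrightarrow>
       disjoint_family_on (\<lambda>i. {a i<..<b i}) A \<longrightarrow> (\<Sum>i\<in>A. b i - a i) < d \<longrightarrow>
       (\<Sum>i\<in>A. norm (complex_of_real (F (b i)) - complex_of_real (F (a i)))) < \<epsilon>"
    using absolutely_continuous_on_finite_family[OF AC \<open>\<epsilon> > 0\<close>] by (elim exE conjE)
  \<comment> \<open>\<open>\<eta>\<close> bounds each of the three losses: the excess of \<open>T\<close> over \<open>E\<close>, and what \<open>C1\<close> and \<open>C2\<close> leave uncovered.\<close>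
  define \<eta> where "\<eta> = Min {d / 3, m / 2, \<epsilon> / (3 * \<bar>b\<bar> + 1)}"
  have "\<eta> > 0"
    using m \<open>d > 0\<close> \<open>\<epsilon> > 0\<close> by (simp add: \<eta>_def)
  have "\<eta> \<le> d / 3" "\<eta> \<le> m / 2" "\<eta> \<le> \<epsilon> / (3 * \<bar>b\<bar> + 1)"
    unfolding \<eta>_def by (rule Min_le; simp)+
  from this(3) have "\<eta> * (3 * \<bar>b\<bar> + 1) \<le> \<epsilon>"
    by (subst (asm) pos_le_divide_eq) auto
  with \<open>\<eta> > 0\<close> have "\<bar>b\<bar> * (3 * \<eta>) \<le> \<epsilon>"
    by (simp add: algebra_simps)
  with \<open>\<eta> \<le> d / 3\<close> \<open>\<eta> \<le> m / 2\<close> have \<eta>: "3 * \<eta> \<le> d" "\<eta> \<le> m / 2" "\<bar>b\<bar> * (3 * \<eta>) \<le> \<epsilon>"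
    by simp_all
  obtain T0 where T0: "open T0" "E \<subseteq> T0" "T0 - E \<in> lmeasurable" "emeasure lebesgue (T0 - E) < ennreal \<eta>"
    using sets_lebesgue_outer_open[of E \<eta>] E(2) \<open>\<eta> > 0\<close> by (auto simp: fmeasurableD)
  define T where "T = T0 \<inter> {u0<..<v0}"
  have T: "open T" "E \<subseteq> T" "T \<subseteq> {u0..v0}"
    using T0 E by (auto simp: T_def)
  then have "T \<in> lmeasurable"
    by (intro lmeasurable_open bounded_subset[OF bounded_closed_interval[of u0 v0]])
  note T = T this
  have measT: "measure lebesgue T < m + \<eta>"
  proof -
    have "measure lebesgue T \<le> measure lebesgue (E \<union> (T0 - E))"
    proof (rule measure_mono_fmeasurable)
      show "E \<union> (T0 - E) \<in> lmeasurable"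
        using E(2) T0(3) by (rule fmeasurable.Un)
    qed (use T in \<open>auto simp: T_def fmeasurableD\<close>)
    also have "\<dots> \<le> measure lebesgue E + measure lebesgue (T0 - E)"
      by (rule measure_Un_le) (use E(2) T0(3) in \<open>simp_all only: fmeasurableD\<close>)
    also have "measure lebesgue (T0 - E) < \<eta>"
      using T0(3,4) \<open>\<eta> > 0\<close> by (simp add: emeasure_eq_measure2 ennreal_less_iff)
    finally show ?thesis
      by (simp add: m_def)
  qed
  obtain C1 where C1: "finite C1" "C1 \<subseteq> {(s, t). s < t \<and> {s..t} \<subseteq> T \<and> F t - F s \<le> a * (t - s)}"
    "disjoint_family_on (\<lambda>i. {fst i..snd i}) C1"
    "measure lebesgue E - \<eta> < measure lebesgue (E \<inter> (\<Union>i\<in>C1. {fst i..snd i}))"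
  proof (rule Vitali_finite_intervals[OF E(2) _ _ \<open>\<eta> > 0\<close>,
        of "{(s, t). s < t \<and> {s..t} \<subseteq> T \<and> F t - F s \<le> a * (t - s)}"])
    fix x e :: real assume x: "x \<in> E" and "e > 0"
    then obtain \<rho> where \<rho>: "\<rho> > 0" "ball x \<rho> \<subseteq> T"
      using T openE by blast
    then obtain s t where st: "s < t" "s \<le> x" "x \<le> t" "t - s < min e \<rho>" "F t - F s \<le> a * (t - s)"
      using lower[OF x, of "min e \<rho>"] \<open>e > 0\<close> by auto
    have "{s..t} \<subseteq> ball x \<rho>"
      using st by (auto simp: dist_real_def)
    with \<rho> st show "\<exists>s t. (s, t) \<in> {(s, t). s < t \<and> {s..t} \<subseteq> T \<and> F t - F s \<le> a * (t - s)} \<and>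
        s \<le> x \<and> x \<le> t \<and> t - s < e"
      by (intro exI[of _ s] exI[of _ t]) auto
  qed auto
  define U1 where "U1 = (\<Union>i\<in>C1. {fst i..snd i})"
  \<comment> \<open>The end points are removed so that small intervals around a point of \<open>E1\<close> stay inside one interval of \<open>C1\<close>.\<close>
  define E1 where "E1 = E \<inter> (\<Union>i\<in>C1. {fst i<..<snd i})"
  have E1: "E1 \<in> lmeasurable"
  proof -
    have "open (\<Union>i\<in>C1. {fst i<..<snd i})"
      by (intro open_UN ballI open_greaterThanLessThan)
    then show ?thesis
      unfolding E1_def by (intro fmeasurable_Int_fmeasurable E(2)) simp
  qed
  have measE1: "m - \<eta> < measure lebesgue E1"
  proof -
    have EU: "E \<inter> U1 \<in> lmeasurable"
      unfolding U1_def by (rule fmeasurable_Int_fmeasurable) (use E C1(1) in auto)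
    have "negligible (fst ` C1 \<union> snd ` C1)"
      using C1(1) by (intro negligible_finite) auto
    moreover have "E \<inter> U1 - E1 \<subseteq> fst ` C1 \<union> snd ` C1"
    proof
      fix x assume "x \<in> E \<inter> U1 - E1"
      then obtain i where "i \<in> C1" "x \<in> {fst i..snd i}" "x \<notin> {fst i<..<snd i}"
        by (auto simp: U1_def E1_def)
      then have "x = fst i \<or> x = snd i"
        by auto
      with \<open>i \<in> C1\<close> show "x \<in> fst ` C1 \<union> snd ` C1"
        by blast
    qed
    moreover have "E1 - E \<inter> U1 = {}"
      by (force simp: E1_def U1_def)
    ultimately have "negligible (E \<inter> U1 - E1 \<union> (E1 - E \<inter> U1))"
      by (metis Un_empty_right negligible_subset)
    then have "measure lebesgue E1 = measure lebesgue (E \<inter> U1)"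
      by (rule measure_negligible_symdiff[OF EU])
    then show ?thesis
      using C1(4) by (simp add: U1_def m_def)
  qed
  obtain C2 where C2: "finite C2"
    "C2 \<subseteq> {(s, t). s < t \<and> (\<exists>j\<in>C1. {s..t} \<subseteq> {fst j..snd j}) \<and> b * (t - s) \<le> F t - F s}"
    "disjoint_family_on (\<lambda>i. {fst i..snd i}) C2"
    "measure lebesgue E1 - \<eta> < measure lebesgue (E1 \<inter> (\<Union>i\<in>C2. {fst i..snd i}))"
  proof (rule Vitali_finite_intervals[OF E1 _ _ \<open>\<eta> > 0\<close>,
        of "{(s, t). s < t \<and> (\<exists>j\<in>C1. {s..t} \<subseteq> {fst j..snd j}) \<and> b * (t - s) \<le> F t - F s}"])
    fix x e :: real assume "x \<in> E1" and "e > 0"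
    then obtain j where x: "x \<in> E" and j: "j \<in> C1" "fst j < x" "x < snd j"
      by (auto simp: E1_def)
    then obtain s t where st: "s < t" "s \<le> x" "x \<le> t" "t - s < min e (min (x - fst j) (snd j - x))"
       "b * (t - s) \<le> F t - F s"
      using upper[OF x, of "min e (min (x - fst j) (snd j - x))"] \<open>e > 0\<close> by auto
    moreover from st have "{s..t} \<subseteq> {fst j..snd j}"
      by auto
    then have "\<exists>j\<in>C1. {s..t} \<subseteq> {fst j..snd j}"
      using j by blast
    ultimately show "\<exists>s t. (s, t) \<in> {(s, t). s < t \<and> (\<exists>j\<in>C1. {s..t} \<subseteq> {fst j..snd j}) \<and>
        b * (t - s) \<le> F t - F s} \<and> s \<le> x \<and> x \<le> t \<and> t - s < e"
      by (intro exI[of _ s] exI[of _ t] conjI CollectI) auto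
  qed auto
  define U2 where "U2 = (\<Union>i\<in>C2. {fst i..snd i})"
  have lt1: "fst i < snd i" and sub1: "{fst i..snd i} \<subseteq> T" and F1: "F (snd i) - F (fst i) \<le> a * (snd i - fst i)"
    if "i \<in> C1" for i
    using C1(2) that by (auto simp: case_prod_unfold)
  have lt2: "fst i < snd i" and sub2: "\<exists>j\<in>C1. {fst i..snd i} \<subseteq> {fst j..snd j}"
    and F2: "b * (snd i - fst i) \<le> F (snd i) - F (fst i)" if "i \<in> C2" for i
    using C2(2) that by (auto simp: case_prod_unfold)
  define \<Sigma>1 \<Sigma>2 where "\<Sigma>1 = (\<Sum>i\<in>C1. snd i - fst i)" and "\<Sigma>2 = (\<Sum>i\<in>C2. snd i - fst i)"
  have \<Sigma>1: "measure lebesgue U1 = \<Sigma>1" and \<Sigma>2: "measure lebesgue U2 = \<Sigma>2"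
    unfolding U1_def U2_def \<Sigma>1_def \<Sigma>2_def using C1 C2 lt1 lt2
    by (auto intro!: sum_interval_lengths_eq_measure simp: less_imp_le)
  have U: "U1 \<in> lmeasurable" "U2 \<in> lmeasurable"
    using C1(1) C2(1) by (auto simp: U1_def U2_def intro!: fmeasurable.finite_UN)
  have "U1 \<subseteq> T"
    using sub1 unfolding U1_def by blast
  then have "\<Sigma>1 \<le> measure lebesgue T"
    unfolding \<Sigma>1[symmetric] using T U by (intro measure_mono_fmeasurable) (auto simp: fmeasurableD)
  moreover have "m - 2 * \<eta> < \<Sigma>2"
  proof -
    have "measure lebesgue (E1 \<inter> U2) \<le> \<Sigma>2"
      unfolding \<Sigma>2[symmetric] using E1 U by (intro measure_mono_fmeasurable) (auto simp: fmeasurableD)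
    then show ?thesis
      using measE1 C2(4) by (simp add: U2_def)
  qed
  ultimately have gap: "\<Sigma>1 - \<Sigma>2 < 3 * \<eta>"
    using measT by simp
  have "U2 \<subseteq> U1"
    using sub2 unfolding U1_def U2_def by blast
  then have "\<Sigma>2 \<le> \<Sigma>1"
    unfolding \<Sigma>1[symmetric] \<Sigma>2[symmetric] using U
    by (intro measure_mono_fmeasurable) (auto simp: fmeasurableD)
  have \<Sigma>1_ge: "m / 2 \<le> \<Sigma>1"
  proof -
    have "measure lebesgue (E \<inter> U1) \<le> \<Sigma>1"
      unfolding \<Sigma>1[symmetric] using E U by (intro measure_mono_fmeasurable) (auto simp: fmeasurableD)
    then show ?thesis
      using C1(4) \<eta>(2) by (simp add: U1_def m_def)
  qed
  obtain G :: "((real \<times> real) \<times> real set) set" where G: "finite G"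
    "\<And>i. i \<in> G \<Longrightarrow> Inf (snd i) \<le> Sup (snd i) \<and> (\<exists>j\<in>C1. {Inf (snd i)..Sup (snd i)} \<subseteq> {fst j..snd j})"
    "disjoint_family_on (\<lambda>i. {Inf (snd i)<..<Sup (snd i)}) G"
    and Gsum: "\<And>h :: real \<Rightarrow> real. (\<Sum>j\<in>C1. h (snd j) - h (fst j))
        = (\<Sum>i\<in>C2. h (snd i) - h (fst i)) + (\<Sum>i\<in>G. h (Sup (snd i)) - h (Inf (snd i)))"
    by (rule interval_family_gaps[OF C1(1,3) lt1 C2(1,3) lt2 sub2]) blast+
  have "(\<Sum>i\<in>G. Sup (snd i) - Inf (snd i)) < d"
    using Gsum[of "\<lambda>x. x"] gap \<eta>(1) by (simp add: \<Sigma>1_def \<Sigma>2_def)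
  then have "(\<Sum>i\<in>G. norm (complex_of_real (F (Sup (snd i))) - complex_of_real (F (Inf (snd i))))) < \<epsilon>"
  proof (intro d[rule_format, OF G(1) _ G(3)])
    fix i assume "i \<in> G"
    then obtain j where "j \<in> C1" "{Inf (snd i)..Sup (snd i)} \<subseteq> {fst j..snd j}" "Inf (snd i) \<le> Sup (snd i)"
      using G(2) by blast
    then show "Inf (snd i) \<le> Sup (snd i) \<and> {Inf (snd i)..Sup (snd i)} \<subseteq> {u0..v0}"
      using sub1 T(3) by blast
  qed
  then have "(\<Sum>i\<in>G. norm (F (Sup (snd i)) - F (Inf (snd i)))) < \<epsilon>"
    by (simp flip: of_real_diff)
  then have "- \<epsilon> < (\<Sum>i\<in>G. F (Sup (snd i)) - F (Inf (snd i)))"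
    using sum_abs[of "\<lambda>i. F (Sup (snd i)) - F (Inf (snd i))" G] unfolding real_norm_def by linarith
  then have "(\<Sum>i\<in>C2. F (snd i) - F (fst i)) - \<epsilon> < (\<Sum>i\<in>C1. F (snd i) - F (fst i))"
    using Gsum[of F] by simp
  moreover have "(\<Sum>i\<in>C1. F (snd i) - F (fst i)) \<le> a * \<Sigma>1"
    unfolding \<Sigma>1_def sum_distrib_left by (rule sum_mono) (rule F1)
  moreover have "b * \<Sigma>2 \<le> (\<Sum>i\<in>C2. F (snd i) - F (fst i))"
    unfolding \<Sigma>2_def sum_distrib_left by (rule sum_mono) (rule F2)
  moreover have "b * \<Sigma>1 - \<epsilon> \<le> b * \<Sigma>2"
  proof -
    have "b * (\<Sigma>1 - \<Sigma>2) \<le> \<bar>b\<bar> * (3 * \<eta>)"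
      using gap \<open>\<Sigma>2 \<le> \<Sigma>1\<close> by (intro mult_mono) auto
    then show ?thesis
      using \<eta>(3) by (simp add: algebra_simps)
  qed
  ultimately have "(b - a) * \<Sigma>1 < 2 * \<epsilon>"
    by (simp add: algebra_simps)
  moreover have "(b - a) * (m / 2) \<le> (b - a) * \<Sigma>1"
    using \<Sigma>1_ge \<open>a < b\<close> by (intro mult_left_mono) auto
  moreover have "2 * \<epsilon> = (b - a) * (m / 2)"
    by (simp add: \<epsilon>_def)
  ultimately show False
    by linarith
qed

text \<open>
  Let \<open>d\<close> belong to the bound \<open>1\<close> in the definition of absolute continuity. The increments over
  disjoint intervals inside a set of diameter less than \<open>d\<close> add up to less than \<open>1\<close>. If \<open>E\<close> had
  measure \<open>m > 0\<close> in such a set, a Vitali family of intervals of slope at least \<open>2 / m\<close>, covering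
  half of it, would contradict this.
\<close>
lemma AC_infinite_slope_null:
  assumes AC: "absolutely_continuous_on {u0..v0} F"
    and E: "E \<subseteq> {u0<..<v0}" "E \<in> lmeasurable"
    and steep: "\<And>x d c. \<lbrakk>x \<in> E; d > 0\<rbrakk> \<Longrightarrow>
      \<exists>s t. s < t \<and> s \<le> x \<and> x \<le> t \<and> t - s < d \<and> c * (t - s) \<le> norm (F t - F s)"
  shows "negligible E"
proof -
  obtain d where "d > 0" and d: "\<forall>(A :: (real \<times> real) set) a b. finite A \<longrightarrow>
       (\<forall>i\<in>A. a i \<le> b i \<and> {a i..b i} \<subseteq> {u0..v0}) \<longrightarrow>
       disjoint_family_on (\<lambda>i. {a i<..<b i}) A \<longrightarrow> (\<Sum>i\<in>A. b i - a i) < d \<longrightarrow>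
       (\<Sum>i\<in>A. norm (F (b i) - F (a i))) < 1"
    using absolutely_continuous_on_finite_family[OF AC zero_less_one] by (elim exE conjE)
  have piece: "negligible (E \<inter> ball c (d / 4))" for c
  proof (rule ccontr)
    define E' where "E' = E \<inter> ball c (d / 4)"
    define m where "m = measure lebesgue E'"
    assume "\<not> negligible (E \<inter> ball c (d / 4))"
    moreover have E': "E' \<in> lmeasurable"
      unfolding E'_def by (rule fmeasurable_Int_fmeasurable) (use E in auto)
    ultimately have "m > 0"
      by (simp add: negligible_iff_measure E'_def m_def less_le)
    define T where "T = {u0<..<v0} \<inter> ball c (d / 4)"
    have T: "open T" "E' \<subseteq> T" "T \<subseteq> ball c (d / 4)" "T \<subseteq> {u0..v0}"
      using E by (auto simp: T_def E'_def)
    obtain C where C: "finite C"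
      "C \<subseteq> {(s, t). s < t \<and> {s..t} \<subseteq> T \<and> 2 / m * (t - s) \<le> norm (F t - F s)}"
      "disjoint_family_on (\<lambda>i. {fst i..snd i}) C"
      "measure lebesgue E' - m / 2 < measure lebesgue (E' \<inter> (\<Union>i\<in>C. {fst i..snd i}))"
    proof (rule Vitali_finite_intervals[OF E', of
          "{(s, t). s < t \<and> {s..t} \<subseteq> T \<and> 2 / m * (t - s) \<le> norm (F t - F s)}" "m / 2"])
      fix x e :: real assume x: "x \<in> E'" and "e > 0"
      then obtain \<rho> where \<rho>: "\<rho> > 0" "ball x \<rho> \<subseteq> T"
        using T openE by blast
      have "x \<in> E"
        using x by (simp add: E'_def)
      obtain s t where st: "s < t" "s \<le> x" "x \<le> t" "t - s < min e \<rho>" "2 / m * (t - s) \<le> norm (F t - F s)"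
        using steep[OF \<open>x \<in> E\<close>, of "min e \<rho>" "2 / m"] \<open>e > 0\<close> \<rho> by auto
      have "{s..t} \<subseteq> ball x \<rho>"
        using st by (auto simp: dist_real_def)
      with \<rho> st show "\<exists>s t. (s, t) \<in> {(s, t). s < t \<and> {s..t} \<subseteq> T \<and> 2 / m * (t - s) \<le> norm (F t - F s)} \<and>
          s \<le> x \<and> x \<le> t \<and> t - s < e"
        by (intro exI[of _ s] exI[of _ t]) auto
    qed (use \<open>m > 0\<close> in auto)
    have lt: "fst i < snd i" and sub: "{fst i..snd i} \<subseteq> T"
      and steep': "2 / m * (snd i - fst i) \<le> norm (F (snd i) - F (fst i))" if "i \<in> C" for i
      using C(2) that by (auto simp: case_prod_unfold)
    define U where "U = (\<Union>i\<in>C. {fst i..snd i})"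
    have sum: "(\<Sum>i\<in>C. snd i - fst i) = measure lebesgue U"
      unfolding U_def using C lt by (intro sum_interval_lengths_eq_measure[symmetric]) (auto simp: less_imp_le)
    have U: "U \<in> lmeasurable"
      using C(1) by (auto simp: U_def intro!: fmeasurable.finite_UN)
    have "U \<subseteq> ball c (d / 4)"
      using sub T(3) unfolding U_def by blast
    then have "measure lebesgue U \<le> measure lebesgue (ball c (d / 4))"
      using U by (intro measure_mono_fmeasurable) (auto simp: fmeasurableD)
    also have "\<dots> = d / 2"
      using \<open>d > 0\<close> by (simp add: ball_eq_greaterThanLessThan)
    finally have "(\<Sum>i\<in>C. snd i - fst i) < d"
      using \<open>d > 0\<close> sum by simp
    then have "(\<Sum>i\<in>C. norm (F (snd i) - F (fst i))) < 1"
    proof (intro d[rule_format, OF C(1) _ disjoint_intervals_open[OF C(3)]])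
      show "fst i \<le> snd i \<and> {fst i..snd i} \<subseteq> {u0..v0}" if "i \<in> C" for i
        using lt[OF that] sub[OF that] T(4) by (metis less_imp_le subset_trans)
    qed
    moreover have "2 / m * measure lebesgue U \<le> (\<Sum>i\<in>C. norm (F (snd i) - F (fst i)))"
      unfolding sum[symmetric] sum_distrib_left by (rule sum_mono) (rule steep')
    moreover have "m / 2 \<le> measure lebesgue U"
    proof -
      have "measure lebesgue (E' \<inter> U) \<le> measure lebesgue U"
        using E' U by (intro measure_mono_fmeasurable) (auto simp: fmeasurableD)
      then show ?thesis
        using C(4) by (simp add: U_def m_def)
    qed
    then have "1 \<le> 2 / m * measure lebesgue U"
      using \<open>m > 0\<close> by (simp add: field_simps)
    ultimately show False
      by linarith
  qed
  show ?thesis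
  proof (subst locally_negligible_alt, rule ballI)
    fix x assume "x \<in> E"
    then have "x \<in> E \<inter> ball x (d / 4)"
      using \<open>d > 0\<close> by simp
    moreover have "openin (top_of_set E) (E \<inter> ball x (d / 4))"
      by (rule openin_open_Int) simp
    ultimately show "\<exists>U. openin (top_of_set E) U \<and> x \<in> U \<and> negligible U"
      by (intro exI[of _ "E \<inter> ball x (d / 4)"] conjI piece)
  qed
qed

lemma open_difference_quotient:
  fixes F :: "real \<Rightarrow> real"
  assumes "continuous_on UNIV F" "open P" "open U"
  shows "open {x \<in> U. \<exists>h. h \<noteq> 0 \<and> \<bar>h\<bar> < \<rho> \<and> (F (x + h) - F x) / h \<in> P}"
proof -
  have "{x \<in> U. \<exists>h. h \<noteq> 0 \<and> \<bar>h\<bar> < \<rho> \<and> (F (x + h) - F x) / h \<in> P}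
      = U \<inter> (\<Union>h\<in>{h. h \<noteq> 0 \<and> \<bar>h\<bar> < \<rho>}. (\<lambda>x. (F (x + h) - F x) / h) -` P)"
    by auto
  moreover have "open ((\<lambda>x. (F (x + h) - F x) / h) -` P)" if "h \<noteq> 0" for h
  proof -
    have "continuous_on UNIV (\<lambda>x. F (x + h))"
      by (rule continuous_on_compose2[OF assms(1)]) (auto intro!: continuous_intros)
    then have "continuous_on UNIV (\<lambda>x. (F (x + h) - F x) / h)"
      using assms(1) that by (intro continuous_intros) auto
    then show ?thesis
      by (simp add: continuous_on_open_vimage assms(2))
  qed
  ultimately show ?thesis
    using assms(3) by (auto intro!: open_Int open_UN)
qed

lemma slope_interval:
  fixes F :: "real \<Rightarrow> real"
  assumes "h \<noteq> 0" "\<bar>h\<bar> < d"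
  obtains s t where "s < t" "s \<le> x" "x \<le> t" "t - s < d" "F t - F s = (F (x + h) - F x) / h * (t - s)"
proof (cases "h > 0")
  case True
  then show thesis
    using assms that[of x "x + h"] by simp
next
  case False
  then show thesis
    using assms that[of "x + h" x] by (simp add: field_simps)
qed

text \<open>
  The upper limit is the supremum of \<open>A\<close>. Rational levels suffice to separate it from the lower
  limit, which leaves countably many exceptional sets in the application.
\<close>
lemma difference_quotient_tendsto:
  fixes q :: "real \<Rightarrow> real"
  assumes bdd: "\<rho> > 0" "\<And>h. h \<noteq> 0 \<Longrightarrow> \<bar>h\<bar> < \<rho> \<Longrightarrow> \<bar>q h\<bar> \<le> B"
    and osc: "\<And>a b. a \<in> \<rat> \<Longrightarrow> b \<in> \<rat> \<Longrightarrow> a < b \<Longrightarrow>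
       \<not> ((\<exists>\<^sub>F h in at 0. q h < a) \<and> (\<exists>\<^sub>F h in at 0. q h > b))"
  shows "\<exists>l. (q \<longlongrightarrow> l) (at 0)"
proof -
  define A where "A = {b. \<exists>\<^sub>F h in at 0. q h > b}"
  have ev: "\<forall>\<^sub>F h in at 0. \<bar>q h\<bar> \<le> B"
    unfolding eventually_at using bdd by (intro exI[of _ \<rho>]) (auto simp: dist_real_def)
  have "B + 1 \<notin> A"
    using ev unfolding A_def frequently_def by (auto elim: eventually_mono)
  have A_le: "b' \<in> A" if "b \<in> A" "b' \<le> b" for b b'
    using that unfolding A_def by (auto elim: frequently_elim1)
  have bdd_A: "bdd_above A"
    using A_le \<open>B + 1 \<notin> A\<close> by (intro bdd_aboveI[of _ "B + 1"]) (meson linear)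
  have "- B - 1 \<in> A"
    unfolding A_def mem_Collect_eq
    by (rule eventually_frequently) (use ev in \<open>auto elim: eventually_mono\<close>)
  then have A_ne: "A \<noteq> {}"
    by blast
  have "(q \<longlongrightarrow> Sup A) (at 0)"
    unfolding tendsto_iff
  proof (intro allI impI)
    fix e :: real assume "e > 0"
    have "Sup A + e / 2 \<notin> A"
      using cSup_upper[OF _ bdd_A, of "Sup A + e / 2"] \<open>e > 0\<close> by auto
    then have up: "\<forall>\<^sub>F h in at 0. q h \<le> Sup A + e / 2"
      by (simp add: A_def frequently_def not_less)
    obtain b where b: "b \<in> A" "Sup A - e / 3 < b"
      using less_cSup_iff[OF A_ne bdd_A, of "Sup A - e / 3"] \<open>e > 0\<close> by auto
    obtain b' where b': "b' \<in> \<rat>" "Sup A - e / 3 < b'" "b' < b"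
      using Rats_dense_in_real[OF b(2)] by blast
    obtain a where a: "a \<in> \<rat>" "Sup A - e / 2 < a" "a < Sup A - e / 3"
      using Rats_dense_in_real[of "Sup A - e / 2" "Sup A - e / 3"] \<open>e > 0\<close> by auto
    have "\<exists>\<^sub>F h in at 0. q h > b'"
      using A_le[OF b(1), of b'] b' by (simp add: A_def)
    then have "\<not> (\<exists>\<^sub>F h in at 0. q h < a)"
      using osc[OF a(1) b'(1)] a b' by auto
    then have low: "\<forall>\<^sub>F h in at 0. a \<le> q h"
      by (simp add: frequently_def not_less)
    show "\<forall>\<^sub>F h in at 0. dist (q h) (Sup A) < e"
      using up low
    proof eventually_elim
      case (elim h)
      with a(2) \<open>e > 0\<close> have "q h - Sup A < e" "Sup A - q h < e"
        by linarith+
      then show ?case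
        by (simp add: dist_real_def abs_less_iff)
    qed
  qed
  then show ?thesis ..
qed

lemma frequently_at_0_iff:
  "(\<exists>\<^sub>F h in at (0::real). P h) \<longleftrightarrow> (\<forall>n::nat. \<exists>h. h \<noteq> 0 \<and> \<bar>h\<bar> < 1 / Suc n \<and> P h)"
proof -
  have "(\<exists>\<^sub>F h in at (0::real). P h) \<longleftrightarrow> (\<forall>d>0. \<exists>h. h \<noteq> 0 \<and> \<bar>h\<bar> < d \<and> P h)"
    by (simp add: frequently_at dist_real_def)
  also have "\<dots> \<longleftrightarrow> (\<forall>n::nat. \<exists>h. h \<noteq> 0 \<and> \<bar>h\<bar> < 1 / Suc n \<and> P h)"
  proof safe
    fix d :: real assume H: "\<forall>n::nat. \<exists>h. h \<noteq> 0 \<and> \<bar>h\<bar> < 1 / Suc n \<and> P h" and "d > 0"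
    then obtain n where n: "inverse (real (Suc n)) < d"
      using reals_Archimedean by blast
    from H obtain h where "h \<noteq> 0" "\<bar>h\<bar> < 1 / Suc n" "P h"
      by blast
    then show "\<exists>h. h \<noteq> 0 \<and> \<bar>h\<bar> < d \<and> P h"
      using n by (intro exI[of _ h]) (auto simp: inverse_eq_divide)
  qed auto
  finally show ?thesis .
qed

text \<open>
  Where the difference quotient has no limit, either it is unbounded for small increments, or it
  is below \<open>a\<close> and above \<open>b\<close> for arbitrarily small increments, with some rational \<open>a < b\<close>. These sets
  are countable intersections of open sets, hence measurable, and null sets by
  \<open>AC_infinite_slope_null\<close> and \<open>AC_two_slopes_null\<close>.
\<close>
lemma AC_real_differentiable_ae:
  fixes F :: "real \<Rightarrow> real"
  assumes cont: "continuous_on UNIV F"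
    and AC: "absolutely_continuous_on {u0..v0} (\<lambda>x. complex_of_real (F x))"
  shows "negligible {x \<in> {u0<..<v0}. \<not> (\<exists>l. ((\<lambda>h. (F (x + h) - F x) / h) \<longlongrightarrow> l) (at 0))}"
proof -
  define U where "U = {u0<..<v0}"
  define q where "q x h = (F (x + h) - F x) / h" for x h
  define V where "V P n = {x \<in> U. \<exists>h. h \<noteq> 0 \<and> \<bar>h\<bar> < 1 / Suc n \<and> q x h \<in> P}" for P and n :: nat
  have "open (V P n)" if "open P" for P n
    unfolding V_def q_def by (rule open_difference_quotient) (use cont that in \<open>auto simp: U_def\<close>)
  then have V_meas: "V P n \<in> sets lebesgue" if "open P" for P n
    using that by auto
  have meas: "S \<in> lmeasurable" if "S \<in> sets lebesgue" "S \<subseteq> U" for S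
    by (rule fmeasurableI2[of U]) (use that in \<open>auto simp: U_def\<close>)
  define E where "E a b = (\<Inter>n. V {..<a} n \<inter> V {b<..} n)" for a b :: real
  define E' where "E' = (\<Inter>n. V (- {- real n..real n}) n)"
  have "E a b \<subseteq> U" "E' \<subseteq> U" for a b
    by (auto simp: E_def E'_def V_def)
  then have E_meas: "E a b \<in> lmeasurable" and E'_meas: "E' \<in> lmeasurable" for a b
    unfolding E_def E'_def
    by (auto intro!: meas sets.countable_INT' sets.Int V_meas open_Compl)
  have interval: "\<exists>s t. s < t \<and> s \<le> x \<and> x \<le> t \<and> t - s < d \<and> (F t - F s) / (t - s) \<in> P"
    if x: "\<forall>n. \<exists>h. h \<noteq> 0 \<and> \<bar>h\<bar> < 1 / Suc n \<and> q x h \<in> P" and "d > 0" for x d P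
  proof -
    obtain n where "inverse (real (Suc n)) < d"
      using reals_Archimedean[OF \<open>d > 0\<close>] by blast
    moreover obtain h where h: "h \<noteq> 0" "\<bar>h\<bar> < 1 / Suc n" "q x h \<in> P"
      using x by blast
    ultimately have "\<bar>h\<bar> < d"
      by (simp add: inverse_eq_divide)
    from slope_interval[OF h(1) this, of x F] obtain s t
      where st: "s < t" "s \<le> x" "x \<le> t" "t - s < d" "F t - F s = q x h * (t - s)"
      by (auto simp: q_def)
    then have "(F t - F s) / (t - s) \<in> P"
      using h(3) by simp
    then show ?thesis
      using st by blast
  qed
  have "negligible (E a b)" if "a < b" for a b
  proof -
    have "measure lebesgue (E a b) = 0"
    proof (rule AC_two_slopes_null[OF AC \<open>a < b\<close>])
      fix x d :: real assume x: "x \<in> E a b" and "d > 0"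
      show "\<exists>s t. s < t \<and> s \<le> x \<and> x \<le> t \<and> t - s < d \<and> F t - F s \<le> a * (t - s)"
        using interval[of x "{..<a}" d] x \<open>d > 0\<close> by (force simp: E_def V_def field_simps)
      show "\<exists>s t. s < t \<and> s \<le> x \<and> x \<le> t \<and> t - s < d \<and> b * (t - s) \<le> F t - F s"
        using interval[of x "{b<..}" d] x \<open>d > 0\<close> by (force simp: E_def V_def field_simps)
    qed (use \<open>E a b \<subseteq> U\<close> E_meas in \<open>auto simp: U_def\<close>)
    then show ?thesis
      using E_meas by (simp add: negligible_iff_measure)
  qed
  then have "negligible (\<Union>(a, b)\<in>{(a, b). a \<in> \<rat> \<and> b \<in> \<rat> \<and> a < b}. E a b)"
  proof (intro negligible_countable_Union)
    have "countable (\<rat> \<times> \<rat> :: (real \<times> real) set)"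
      by (intro countable_SIGMA countable_rat)
    then show "countable ((\<lambda>(a, b). E a b) ` {(a, b). a \<in> \<rat> \<and> b \<in> \<rat> \<and> a < b})"
      by (intro countable_image) (auto elim: countable_subset[rotated])
  qed auto
  moreover have "negligible E'"
  proof (rule AC_infinite_slope_null[OF AC])
    fix x d c :: real assume x: "x \<in> E'" and "d > 0"
    obtain n where n: "\<bar>c\<bar> \<le> real n" "inverse (real (Suc n)) < d"
    proof -
      obtain n1 where "\<bar>c\<bar> \<le> real n1"
        using real_arch_simple by blast
      moreover obtain n2 where "inverse (real (Suc n2)) < d"
        using reals_Archimedean[OF \<open>d > 0\<close>] by blast
      moreover have "inverse (real (Suc (max n1 n2))) \<le> inverse (real (Suc n2))"
        by (intro le_imp_inverse_le) auto
      moreover have "real n1 \<le> real (max n1 n2)"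
        by simp
      ultimately show thesis
        by (intro that[of "max n1 n2"]) linarith+
    qed
    obtain h where h: "h \<noteq> 0" "\<bar>h\<bar> < 1 / Suc n" "q x h \<in> - {- real n..real n}"
      using x unfolding E'_def V_def by blast
    then have "\<bar>h\<bar> < d"
      using n by (simp add: inverse_eq_divide)
    from slope_interval[OF h(1) this, of x F] obtain s t
      where st: "s < t" "s \<le> x" "x \<le> t" "t - s < d" "F t - F s = q x h * (t - s)"
      by (auto simp: q_def)
    have "c \<le> \<bar>q x h\<bar>"
      using h(3) n(1) by auto
    then have "c * (t - s) \<le> \<bar>q x h\<bar> * (t - s)"
      using st(1) by (intro mult_right_mono) auto
    also have "\<dots> = \<bar>F t - F s\<bar>"
      using st(1,5) by (simp add: abs_mult)
    also have "\<dots> = norm (complex_of_real (F t) - complex_of_real (F s))"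
      by (metis of_real_diff norm_of_real)
    finally have "c * (t - s) \<le> norm (complex_of_real (F t) - complex_of_real (F s))" .
    with st show "\<exists>s t. s < t \<and> s \<le> x \<and> x \<le> t \<and> t - s < d \<and>
        c * (t - s) \<le> norm (complex_of_real (F t) - complex_of_real (F s))"
      by blast
  qed (use \<open>E' \<subseteq> U\<close> E'_meas in \<open>auto simp: U_def\<close>)
  ultimately have "negligible (E' \<union> (\<Union>(a, b)\<in>{(a, b). a \<in> \<rat> \<and> b \<in> \<rat> \<and> a < b}. E a b))"
    by simp
  moreover have "{x \<in> {u0<..<v0}. \<not> (\<exists>l. (q x \<longlongrightarrow> l) (at 0))}
      \<subseteq> E' \<union> (\<Union>(a, b)\<in>{(a, b). a \<in> \<rat> \<and> b \<in> \<rat> \<and> a < b}. E a b)"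
  proof (rule subsetI, rule ccontr)
    fix x
    assume x: "x \<in> {x \<in> {u0<..<v0}. \<not> (\<exists>l. (q x \<longlongrightarrow> l) (at 0))}"
      and nx: "x \<notin> E' \<union> (\<Union>(a, b)\<in>{(a, b). a \<in> \<rat> \<and> b \<in> \<rat> \<and> a < b}. E a b)"
    then obtain n where n: "x \<notin> V (- {- real n..real n}) n"
      by (auto simp: E'_def)
    have "\<exists>l. (q x \<longlongrightarrow> l) (at 0)"
    proof (rule difference_quotient_tendsto[of "1 / Suc n" _ "real n"])
      show "\<bar>q x h\<bar> \<le> real n" if "h \<noteq> 0" "\<bar>h\<bar> < 1 / Suc n" for h
        using n that x by (auto simp: V_def U_def abs_le_iff)
      fix a b :: real assume ab: "a \<in> \<rat>" "b \<in> \<rat>" "a < b"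
      then have "x \<notin> E a b"
        using nx by auto
      then show "\<not> ((\<exists>\<^sub>F h in at 0. q x h < a) \<and> (\<exists>\<^sub>F h in at 0. q x h > b))"
      proof -
        obtain n where "x \<notin> V {..<a} n \<or> x \<notin> V {b<..} n"
          using \<open>x \<notin> E a b\<close> by (auto simp: E_def)
        then have "\<not> (\<exists>h. h \<noteq> 0 \<and> \<bar>h\<bar> < 1 / Suc n \<and> q x h < a)
            \<or> \<not> (\<exists>h. h \<noteq> 0 \<and> \<bar>h\<bar> < 1 / Suc n \<and> q x h > b)"
          using x by (auto simp: V_def U_def)
        then show ?thesis
          unfolding frequently_at_0_iff by blast
      qed
    qed simp
    with x show False by simp
  qed
  ultimately show ?thesis
    unfolding q_def by (rule negligible_subset)
qed

section \<open>The fundamental theorem of calculus for absolutely continuous functions\<close>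

text \<open>
  Covers restriction to subsets, translation, and the passage to real and imaginary parts.
\<close>
lemma absolutely_continuous_on_transfer:
  assumes AC: "absolutely_continuous_on S F"
    and sub: "\<And>x. x \<in> T \<Longrightarrow> x - c \<in> S"
    and le: "\<And>x y. norm (G x - G y) \<le> norm (F (x - c) - F (y - c))"
  shows "absolutely_continuous_on T G"
  unfolding absolutely_continuous_on_def
proof (intro allI impI)
  fix e :: real assume "e > 0"
  from AC[unfolded absolutely_continuous_on_def, THEN spec[of _ e], THEN mp, OF this]
  obtain d where "d > 0" and d: "\<forall>(n::nat) (a :: nat \<Rightarrow> real) b.
        (\<forall>i<n. a i \<le> b i \<and> {a i..b i} \<subseteq> S) \<and>
        disjoint_family_on (\<lambda>i. {a i<..<b i}) {..<n} \<and>
        (\<Sum>i<n. b i - a i) < d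
        \<longrightarrow> (\<Sum>i<n. norm (F (b i) - F (a i))) < e"
    by (elim exE conjE)
  show "\<exists>d>0. \<forall>(n::nat) (a :: nat \<Rightarrow> real) b.
        (\<forall>i<n. a i \<le> b i \<and> {a i..b i} \<subseteq> T) \<and>
        disjoint_family_on (\<lambda>i. {a i<..<b i}) {..<n} \<and>
        (\<Sum>i<n. b i - a i) < d
        \<longrightarrow> (\<Sum>i<n. norm (G (b i) - G (a i))) < e"
  proof (intro exI[of _ d] conjI \<open>d > 0\<close> allI impI)
    fix n :: nat and a b :: "nat \<Rightarrow> real"
    assume ab: "(\<forall>i<n. a i \<le> b i \<and> {a i..b i} \<subseteq> T) \<and>
        disjoint_family_on (\<lambda>i. {a i<..<b i}) {..<n} \<and> (\<Sum>i<n. b i - a i) < d"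
    have "{a i - c..b i - c} \<subseteq> S" if "i < n" for i
    proof
      fix x assume "x \<in> {a i - c..b i - c}"
      then have "x + c \<in> {a i..b i}"
        by auto
      then have "x + c \<in> T"
        using ab \<open>i < n\<close> by blast
      then show "x \<in> S"
        using sub[of "x + c"] by simp
    qed
    moreover have "disjoint_family_on (\<lambda>i. {a i - c<..<b i - c}) {..<n}"
      unfolding disjoint_family_on_def
    proof (intro ballI impI equals0I)
      fix i j x assume ij: "i \<in> {..<n}" "j \<in> {..<n}" "i \<noteq> j"
        and x: "x \<in> {a i - c<..<b i - c} \<inter> {a j - c<..<b j - c}"
      then have "x + c \<in> {a i<..<b i} \<inter> {a j<..<b j}"
        by auto
      with ij ab show False
        unfolding disjoint_family_on_def by blast
    qed
    ultimately have "(\<Sum>i<n. norm (F (b i - c) - F (a i - c))) < e"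
      using ab by (intro d[THEN spec, THEN spec, THEN spec, THEN mp] conjI allI impI) auto
    moreover have "(\<Sum>i<n. norm (G (b i) - G (a i))) \<le> (\<Sum>i<n. norm (F (b i - c) - F (a i - c)))"
      by (intro sum_mono le)
    ultimately show "(\<Sum>i<n. norm (G (b i) - G (a i))) < e"
      by linarith
  qed
qed

lemma absolutely_continuous_on_imp_continuous:
  assumes AC: "absolutely_continuous_on {u..v} F"
  shows "continuous_on {u..v} F"
  unfolding continuous_on_iff
proof (intro ballI allI impI)
  fix x e :: real assume x: "x \<in> {u..v}" and "e > 0"
  obtain d where "d > 0" and d: "\<forall>(A :: unit set) a b. finite A \<longrightarrow>
       (\<forall>i\<in>A. a i \<le> b i \<and> {a i..b i} \<subseteq> {u..v}) \<longrightarrow>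
       disjoint_family_on (\<lambda>i. {a i<..<b i}) A \<longrightarrow> (\<Sum>i\<in>A. b i - a i) < d \<longrightarrow>
       (\<Sum>i\<in>A. norm (F (b i) - F (a i))) < e"
    using absolutely_continuous_on_finite_family[OF AC \<open>e > 0\<close>] by (elim exE conjE)
  have lt: "norm (F t - F s) < e" if "s \<le> t" "{s..t} \<subseteq> {u..v}" "t - s < d" for s t
    using d[rule_format, of "{()}" "\<lambda>_. s" "\<lambda>_. t"] that by (simp add: disjoint_family_on_def)
  show "\<exists>d>0. \<forall>y\<in>{u..v}. dist y x < d \<longrightarrow> dist (F y) (F x) < e"
  proof (intro exI[of _ d] conjI \<open>d > 0\<close> ballI impI)
    fix y assume y: "y \<in> {u..v}" "dist y x < d"
    show "dist (F y) (F x) < e"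
    proof (cases "x \<le> y")
      case True
      then show ?thesis
        using lt[of x y] x y by (auto simp: dist_norm)
    next
      case False
      then show ?thesis
        using lt[of y x] x y by (auto simp: dist_norm norm_minus_commute)
    qed
  qed
qed

lemma AC_circle_cell:
  assumes "F \<in> AC_circle"
  shows "absolutely_continuous_on {of_int m * (2 * pi)..of_int m * (2 * pi) + 2 * pi} F"
proof -
  have "F (x - of_int m * (2 * pi)) = F x" for x
    using periodic_of_int[of F "2 * pi" "x - of_int m * (2 * pi)" m] assms
    by (simp add: AC_circle_def periodic_def)
  then show ?thesis
    using assms
    by (rule_tac absolutely_continuous_on_transfer[of "{0..2 * pi}" F _ "of_int m * (2 * pi)"])
       (auto simp: AC_circle_def)
qed

lemma cell_exists:
  fixes x :: real
  obtains m :: int where "of_int m * (2 * pi) \<le> x" "x < of_int m * (2 * pi) + 2 * pi"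
proof
  show "of_int \<lfloor>x / (2 * pi)\<rfloor> * (2 * pi) \<le> x" "x < of_int \<lfloor>x / (2 * pi)\<rfloor> * (2 * pi) + 2 * pi"
    using floor_divide_lower[of "2 * pi" x] floor_divide_upper[of "2 * pi" x]
    by (simp_all add: distrib_right)
qed

text \<open>
  Absolute continuity is given on one period. A point at the end of a period is interior to the
  union of two adjacent ones.
\<close>
lemma AC_circle_continuous:
  assumes "F \<in> AC_circle"
  shows "continuous_on UNIV F"
proof -
  have "isCont F x" for x
  proof -
    obtain m :: int where m: "of_int m * (2 * pi) \<le> x" "x < of_int m * (2 * pi) + 2 * pi"
      by (rule cell_exists)
    define c where "c = of_int m * (2 * pi)"
    have "continuous_on {c..c + 2 * pi} F" "continuous_on {c - 2 * pi..c} F"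
      using absolutely_continuous_on_imp_continuous[OF AC_circle_cell[OF assms, of m]]
        absolutely_continuous_on_imp_continuous[OF AC_circle_cell[OF assms, of "m - 1"]]
      by (simp_all add: c_def algebra_simps)
    then have "continuous_on ({c - 2 * pi..c} \<union> {c..c + 2 * pi}) F"
      by (intro continuous_on_closed_Un) auto
    moreover have "{c - 2 * pi..c} \<union> {c..c + 2 * pi} = {c - 2 * pi..c + 2 * pi}"
      by (rule ivl_disj_un_two_touch) auto
    ultimately have "continuous_on {c - 2 * pi<..<c + 2 * pi} F"
      by (auto elim: continuous_on_subset)
    moreover have "c - 2 * pi < x" "x < c + 2 * pi"
      using m pi_gt_zero unfolding c_def by linarith+
    ultimately show ?thesis
      by (simp add: continuous_on_eq_continuous_at)
  qed
  then show ?thesis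
    by (simp add: continuous_on_eq_continuous_at)
qed

lemma AC_differentiable_ae:
  fixes F :: "real \<Rightarrow> complex"
  assumes cont: "continuous_on UNIV F" and AC: "absolutely_continuous_on {u0..v0} F"
  shows "negligible {x \<in> {u0<..<v0}. \<not> (\<exists>l. (F has_vector_derivative l) (at x))}"
proof -
  define D where "D \<phi> = {x \<in> {u0<..<v0}. \<not> (\<exists>l. ((\<lambda>h. (\<phi> (x + h) - \<phi> x) / h) \<longlongrightarrow> l) (at 0))}"
    for \<phi> :: "real \<Rightarrow> real"
  have "negligible (D (\<lambda>x. Re (F x)))" "negligible (D (\<lambda>x. Im (F x)))"
    unfolding D_def
  proof (rule_tac [!] AC_real_differentiable_ae)
    show "absolutely_continuous_on {u0..v0} (\<lambda>x. complex_of_real (Re (F x)))"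
    proof (rule absolutely_continuous_on_transfer[OF AC, of _ 0])
      show "norm (complex_of_real (Re (F x)) - complex_of_real (Re (F y))) \<le> norm (F (x - 0) - F (y - 0))" for x y
        using abs_Re_le_cmod[of "F x - F y"] by (simp flip: of_real_diff)
    qed auto
    show "absolutely_continuous_on {u0..v0} (\<lambda>x. complex_of_real (Im (F x)))"
    proof (rule absolutely_continuous_on_transfer[OF AC, of _ 0])
      show "norm (complex_of_real (Im (F x)) - complex_of_real (Im (F y))) \<le> norm (F (x - 0) - F (y - 0))" for x y
        using abs_Im_le_cmod[of "F x - F y"] by (simp flip: of_real_diff)
    qed auto
  qed (use cont in \<open>auto intro!: continuous_intros\<close>)
  then have "negligible (D (\<lambda>x. Re (F x)) \<union> D (\<lambda>x. Im (F x)))"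
    by simp
  moreover have "{x \<in> {u0<..<v0}. \<not> (\<exists>l. (F has_vector_derivative l) (at x))}
      \<subseteq> D (\<lambda>x. Re (F x)) \<union> D (\<lambda>x. Im (F x))"
  proof (rule subsetI, rule ccontr)
    fix x assume x: "x \<in> {x \<in> {u0<..<v0}. \<not> (\<exists>l. (F has_vector_derivative l) (at x))}"
      and "x \<notin> D (\<lambda>x. Re (F x)) \<union> D (\<lambda>x. Im (F x))"
    then obtain l1 l2 where "((\<lambda>x. Re (F x)) has_field_derivative l1) (at x)"
        "((\<lambda>x. Im (F x)) has_field_derivative l2) (at x)"
      by (auto simp: D_def DERIV_def)
    then have "((\<lambda>x. complex_of_real (Re (F x)) + \<i> * complex_of_real (Im (F x)))
        has_vector_derivative of_real l1 + \<i> * of_real l2) (at x)"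
      by (intro has_vector_derivative_add has_vector_derivative_mult_right has_vector_derivative_of_real)
    then show False
      using x by (auto simp flip: complex_eq)
  qed
  ultimately show ?thesis
    by (rule negligible_subset)
qed

text \<open>
  The gauge at a point outside \<open>N\<close> makes the increment of \<open>F\<close> close to the Riemann term. At a point
  of \<open>N\<close>, where the integrand may be taken to be zero, it confines the interval to an open set of
  small measure, and absolute continuity bounds the sum of the increments over all such
  intervals.
\<close>
lemma AC_has_integral:
  fixes F g :: "real \<Rightarrow> complex"
  assumes AC: "absolutely_continuous_on {a..b} F" and "a \<le> b" and N: "negligible N"
    and deriv: "\<And>x. x \<in> {a..b} - N \<Longrightarrow> (F has_vector_derivative g x) (at x)"
  shows "(g has_integral F b - F a) {a..b}"
proof -
  define g' where "g' x = (if x \<in> N then 0 else g x)" for x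
  have "(g' has_integral F b - F a) {a..b}"
    unfolding has_integral_real
  proof (intro allI impI)
    fix e :: real assume "e > 0"
    define e' where "e' = e / (2 * (b - a + 1))"
    have e': "e' > 0" "e' * (b - a) < e / 2"
      using \<open>a \<le> b\<close> \<open>e > 0\<close> by (auto simp: e'_def field_simps)
    obtain d where "d > 0" and d: "\<forall>(A :: (real \<times> real set) set) a' b'. finite A \<longrightarrow>
         (\<forall>i\<in>A. a' i \<le> b' i \<and> {a' i..b' i} \<subseteq> {a..b}) \<longrightarrow>
         disjoint_family_on (\<lambda>i. {a' i<..<b' i}) A \<longrightarrow> (\<Sum>i\<in>A. b' i - a' i) < d \<longrightarrow>
         (\<Sum>i\<in>A. norm (F (b' i) - F (a' i))) < e / 2"
      using absolutely_continuous_on_finite_family[OF AC half_gt_zero[OF \<open>e > 0\<close>]] by (elim exE conjE)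
    obtain V where V: "open V" "N \<subseteq> V" "V - N \<in> lmeasurable" "emeasure lebesgue (V - N) < ennreal d"
      using sets_lebesgue_outer_open[of N d] N \<open>d > 0\<close> by (auto simp: negligible_imp_sets)
    have Vm: "V \<in> lmeasurable" "measure lebesgue V < d"
    proof -
      have N': "N \<in> lmeasurable" "measure lebesgue N = 0"
        using N by (auto simp: negligible_iff_measure)
      have eq: "V = N \<union> (V - N)"
        using V(2) by blast
      show "V \<in> lmeasurable"
        by (subst eq, rule fmeasurable.Un[OF N'(1) V(3)])
      have "measure lebesgue V \<le> measure lebesgue N + measure lebesgue (V - N)"
        by (subst eq, rule measure_Un_le) (use N'(1) V(3) in \<open>simp_all only: fmeasurableD\<close>)
      also have "measure lebesgue (V - N) < d"
        using V(3,4) \<open>d > 0\<close> by (simp add: emeasure_eq_measure2 ennreal_less_iff)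
      finally show "measure lebesgue V < d"
        using N' by simp
    qed
    have "\<exists>\<delta>>0. \<forall>y. norm (y - x) < \<delta> \<longrightarrow> norm (F y - F x - (y - x) *\<^sub>R g x) \<le> e' * norm (y - x)"
      if "x \<in> {a..b} - N" for x
      using deriv[OF that] \<open>e' > 0\<close> unfolding has_vector_derivative_def has_derivative_at_alt by blast
    then obtain \<delta> where \<delta>: "\<And>x. x \<in> {a..b} - N \<Longrightarrow> \<delta> x > 0"
      "\<And>x y. x \<in> {a..b} - N \<Longrightarrow> norm (y - x) < \<delta> x \<Longrightarrow>
        norm (F y - F x - (y - x) *\<^sub>R g x) \<le> e' * norm (y - x)"
      by metis
    define \<gamma> where "\<gamma> x = (if x \<in> N then V else if x \<in> {a..b} then ball x (\<delta> x) else UNIV)" for x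
    have "gauge \<gamma>"
      unfolding gauge_def \<gamma>_def using V \<delta>(1) by auto
    moreover have "norm ((\<Sum>(x, K)\<in>\<D>. measure lborel K *\<^sub>R g' x) - (F b - F a)) < e"
      if \<D>: "\<D> tagged_division_of {a..b}" and fine: "\<gamma> fine \<D>" for \<D>
    proof -
      have fin: "finite \<D>"
        using \<D> by blast
      have K: "K = {Inf K..Sup K}" "Inf K \<le> x" "x \<le> Sup K" "{Inf K..Sup K} \<subseteq> {a..b}"
        "{Inf K..Sup K} \<subseteq> \<gamma> x" "measure lborel K = Sup K - Inf K" if xK: "(x, K) \<in> \<D>" for x K
      proof -
        obtain c c' where cc: "K = {c..c'}"
          using tagged_division_ofD(4)[OF \<D> xK] by (auto simp: cbox_interval)
        have x: "x \<in> K" "K \<subseteq> {a..b}"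
          using tagged_division_ofD(2,3)[OF \<D> xK] by auto
        have "K \<subseteq> \<gamma> x"
          using fine xK by (auto simp: fine_def)
        with x cc show "K = {Inf K..Sup K}" "Inf K \<le> x" "x \<le> Sup K" "{Inf K..Sup K} \<subseteq> {a..b}"
          "{Inf K..Sup K} \<subseteq> \<gamma> x" "measure lborel K = Sup K - Inf K"
          by auto
      qed
      define B where "B = {(x, K) \<in> \<D>. x \<in> N}"
      have "B \<subseteq> \<D>"
        by (auto simp: B_def)
      have finB: "finite B"
        using fin \<open>B \<subseteq> \<D>\<close> by (rule finite_subset[rotated])
      have disj: "disjoint_family_on (\<lambda>i. {Inf (snd i)<..<Sup (snd i)}) B"
        unfolding disjoint_family_on_def
      proof (intro ballI impI)
        fix i j assume ij: "i \<in> B" "j \<in> B" "i \<noteq> j"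
        have "interior (snd i) = {Inf (snd i)<..<Sup (snd i)}" if "i \<in> B" for i
          using K(1)[of "fst i" "snd i"] that \<open>B \<subseteq> \<D>\<close> interior_atLeastAtMost_real
          by (metis prod.collapse subsetD)
        moreover have "interior (snd i) \<inter> interior (snd j) = {}"
        proof -
          have "i \<in> \<D>" "j \<in> \<D>"
            using ij \<open>B \<subseteq> \<D>\<close> by blast+
          then show ?thesis
            using ij(3) tagged_division_ofD(5)[OF \<D>, of "fst i" "snd i" "fst j" "snd j"] by simp
        qed
        ultimately show "{Inf (snd i)<..<Sup (snd i)} \<inter> {Inf (snd j)<..<Sup (snd j)} = {}"
          using ij by simp
      qed
      have KB: "Inf (snd i) \<le> Sup (snd i)" "{Inf (snd i)..Sup (snd i)} \<subseteq> {a..b}" "{Inf (snd i)..Sup (snd i)} \<subseteq> V"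
        if "i \<in> B" for i
      proof -
        have "(fst i, snd i) \<in> \<D>" "fst i \<in> N"
          using that by (auto simp: B_def)
        with K[of "fst i" "snd i"]
        show "Inf (snd i) \<le> Sup (snd i)" "{Inf (snd i)..Sup (snd i)} \<subseteq> {a..b}" "{Inf (snd i)..Sup (snd i)} \<subseteq> V"
          by (auto simp: \<gamma>_def)
      qed
      have "(\<Sum>i\<in>B. Sup (snd i) - Inf (snd i)) = (\<Sum>i\<in>B. measure lebesgue {Inf (snd i)<..<Sup (snd i)})"
        using KB(1) by (intro sum.cong) auto
      also have "\<dots> = measure lebesgue (\<Union>i\<in>B. {Inf (snd i)<..<Sup (snd i)})"
        by (rule measure_finite_Union[symmetric]) (use finB disj in \<open>auto dest: KB(1)\<close>)
      also have "\<dots> \<le> measure lebesgue V"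
      proof (rule measure_mono_fmeasurable[OF _ _ Vm(1)])
        have "{Inf (snd i)<..<Sup (snd i)} \<subseteq> {Inf (snd i)..Sup (snd i)}" for i :: "real \<times> real set"
          by auto
        then show "(\<Union>i\<in>B. {Inf (snd i)<..<Sup (snd i)}) \<subseteq> V"
          using KB(3) by blast
        show "(\<Union>i\<in>B. {Inf (snd i)<..<Sup (snd i)}) \<in> sets lebesgue"
          by (intro sets.finite_UN finB) auto
      qed
      finally have "(\<Sum>i\<in>B. Sup (snd i) - Inf (snd i)) < d"
        using Vm(2) by simp
      then have B_small: "(\<Sum>i\<in>B. norm (F (Sup (snd i)) - F (Inf (snd i)))) < e / 2"
        by (intro d[rule_format, OF finB _ disj]) (use KB in auto)
      have good: "norm (measure lborel K *\<^sub>R g' x - (F (Sup K) - F (Inf K))) \<le> e' * measure lborel K"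
        if xK: "(x, K) \<in> \<D> - B" for x K
      proof -
        have "(x, K) \<in> \<D>" "x \<notin> N"
          using xK by (auto simp: B_def)
        note K = K[OF this(1)]
        have x: "x \<in> {a..b} - N"
          using K(2,3,4) \<open>x \<notin> N\<close> by auto
        have sub: "{Inf K..Sup K} \<subseteq> ball x (\<delta> x)"
          using K(5) x by (simp add: \<gamma>_def)
        have "Inf K \<in> ball x (\<delta> x)" "Sup K \<in> ball x (\<delta> x)"
          by (rule subsetD[OF sub]; use K(2,3) in simp)+
        then have ends: "norm (F (Sup K) - F x - (Sup K - x) *\<^sub>R g x) \<le> e' * (Sup K - x)"
          "norm (F (Inf K) - F x - (Inf K - x) *\<^sub>R g x) \<le> e' * (x - Inf K)"
          using \<delta>(2)[OF x, of "Sup K"] \<delta>(2)[OF x, of "Inf K"] K(2,3)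
          by (auto simp: dist_real_def)
        have eq: "measure lborel K *\<^sub>R g' x - (F (Sup K) - F (Inf K))
            = (F (Inf K) - F x - (Inf K - x) *\<^sub>R g x) - (F (Sup K) - F x - (Sup K - x) *\<^sub>R g x)"
          using \<open>x \<notin> N\<close> by (simp add: K(6) g'_def algebra_simps)
        have "norm (measure lborel K *\<^sub>R g' x - (F (Sup K) - F (Inf K)))
            \<le> e' * (x - Inf K) + e' * (Sup K - x)"
          unfolding eq by (rule order_trans[OF norm_triangle_ineq4 add_mono[OF ends(2,1)]])
        then show ?thesis
          by (simp add: K(6) algebra_simps)
      qed
      have "(\<Sum>(x, K)\<in>\<D>. F (Sup K) - F (Inf K)) = F b - F a"
        by (rule additive_tagged_division_1[OF \<open>a \<le> b\<close> \<D>])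
      then have "(\<Sum>(x, K)\<in>\<D>. measure lborel K *\<^sub>R g' x) - (F b - F a)
          = (\<Sum>(x, K)\<in>\<D>. measure lborel K *\<^sub>R g' x - (F (Sup K) - F (Inf K)))"
        by (simp add: sum_subtractf case_prod_unfold)
      also have "\<dots> = (\<Sum>(x, K)\<in>\<D> - B. measure lborel K *\<^sub>R g' x - (F (Sup K) - F (Inf K)))
          + (\<Sum>(x, K)\<in>B. measure lborel K *\<^sub>R g' x - (F (Sup K) - F (Inf K)))"
        by (rule sum.subset_diff[OF \<open>B \<subseteq> \<D>\<close> fin])
      finally have "norm ((\<Sum>(x, K)\<in>\<D>. measure lborel K *\<^sub>R g' x) - (F b - F a))
          \<le> norm (\<Sum>(x, K)\<in>\<D> - B. measure lborel K *\<^sub>R g' x - (F (Sup K) - F (Inf K)))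
          + norm (\<Sum>(x, K)\<in>B. measure lborel K *\<^sub>R g' x - (F (Sup K) - F (Inf K)))"
        by (simp add: norm_triangle_ineq)
      also have "norm (\<Sum>(x, K)\<in>\<D> - B. measure lborel K *\<^sub>R g' x - (F (Sup K) - F (Inf K)))
          \<le> (\<Sum>(x, K)\<in>\<D> - B. e' * measure lborel K)"
        by (rule sum_norm_le) (use good in auto)
      also have "\<dots> \<le> (\<Sum>(x, K)\<in>\<D>. e' * measure lborel K)"
        by (rule sum_mono2) (use fin \<open>e' > 0\<close> in auto)
      also have "\<dots> = e' * (b - a)"
        using additive_content_tagged_division[of \<D> a b] \<D> \<open>a \<le> b\<close>
        by (simp add: sum_distrib_left[symmetric] case_prod_unfold cbox_interval)
      also have "norm (\<Sum>(x, K)\<in>B. measure lborel K *\<^sub>R g' x - (F (Sup K) - F (Inf K)))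
          \<le> (\<Sum>(x, K)\<in>B. norm (F (Sup K) - F (Inf K)))"
        by (rule sum_norm_le) (auto simp: B_def g'_def norm_minus_commute)
      also have "\<dots> < e / 2"
        using B_small by (simp add: case_prod_unfold)
      finally show ?thesis
        using e'(2) by linarith
    qed
    ultimately show "\<exists>\<gamma>. gauge \<gamma> \<and> (\<forall>\<D>. \<D> tagged_division_of {a..b} \<and> \<gamma> fine \<D> \<longrightarrow>
        norm ((\<Sum>(x, K)\<in>\<D>. measure lborel K *\<^sub>R g' x) - (F b - F a)) < e)"
      by (intro exI[of _ \<gamma>] conjI allI impI) (auto simp only:)
  qed
  then show ?thesis
    by (rule has_integral_spike[OF N, rotated]) (auto simp: g'_def)
qed

lemma sum_division_AC_le:
  assumes AC: "absolutely_continuous_on {u..v} F" and "e > 0"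
  shows "\<exists>d>0. \<forall>a b D. u \<le> a \<longrightarrow> a \<le> b \<longrightarrow> b \<le> v \<longrightarrow> b - a < d \<longrightarrow> D division_of {a..b} \<longrightarrow>
    (\<Sum>K\<in>D. norm (F (Sup K) - F (Inf K))) < e"
proof -
  obtain d where "d > 0" and d: "\<forall>(A :: real set set) a' b'. finite A \<longrightarrow>
       (\<forall>i\<in>A. a' i \<le> b' i \<and> {a' i..b' i} \<subseteq> {u..v}) \<longrightarrow>
       disjoint_family_on (\<lambda>i. {a' i<..<b' i}) A \<longrightarrow> (\<Sum>i\<in>A. b' i - a' i) < d \<longrightarrow>
       (\<Sum>i\<in>A. norm (F (b' i) - F (a' i))) < e"
    using absolutely_continuous_on_finite_family[OF AC \<open>e > 0\<close>] by (elim exE conjE)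
  show ?thesis
  proof (intro exI[of _ d] conjI \<open>d > 0\<close> allI impI)
    fix a b :: real and D
    assume ab: "u \<le> a" "a \<le> b" "b \<le> v" "b - a < d" and D: "D division_of {a..b}"
    have K: "K = {Inf K..Sup K}" "Inf K \<le> Sup K" "K \<subseteq> {a..b}" if "K \<in> D" for K
      using division_ofD(2,3,4)[OF D that] by (auto simp: cbox_interval)
    show "(\<Sum>K\<in>D. norm (F (Sup K) - F (Inf K))) < e"
    proof (rule d[rule_format])
      show "finite D"
        using D by blast
      show "Inf K \<le> Sup K \<and> {Inf K..Sup K} \<subseteq> {u..v}" if "K \<in> D" for K
      proof -
        have "{Inf K..Sup K} \<subseteq> {a..b}"
          using K(1,3)[OF that] by metis
        also have "\<dots> \<subseteq> {u..v}"
          using ab by auto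
        finally show ?thesis
          using K(2)[OF that] by simp
      qed
      show "disjoint_family_on (\<lambda>K. {Inf K<..<Sup K}) D"
        unfolding disjoint_family_on_def
      proof (intro ballI impI)
        fix K K' assume KK: "K \<in> D" "K' \<in> D" "K \<noteq> K'"
        have "interior K = {Inf K<..<Sup K}" if "K \<in> D" for K
          using K(1)[OF that] interior_atLeastAtMost_real by metis
        then show "{Inf K<..<Sup K} \<inter> {Inf K'<..<Sup K'} = {}"
          using division_ofD(5)[OF D KK] KK by simp
      qed
      show "(\<Sum>K\<in>D. Sup K - Inf K) < d"
        using sum_division_differences[OF ab(2) D, of "\<lambda>x. x"] ab by simp
    qed
  qed
qed

lemma periodic_has_vector_derivative:
  assumes "periodic F"
  shows "(F has_vector_derivative l) (at (x + of_int m * (2 * pi))) \<longleftrightarrow> (F has_vector_derivative l) (at x)"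
proof -
  have per: "F (y + of_int m * (2 * pi)) = F y" for y and m :: int
    using periodic_of_int[of F "2 * pi" y m] assms by (simp add: periodic_def)
  have shift: "(F has_vector_derivative l) (at x)"
    if "(F has_vector_derivative l) (at (x + of_int m * (2 * pi)))" for x and m :: int
  proof -
    have "((\<lambda>y. y + of_int m * (2 * pi)) has_vector_derivative 1) (at x)"
      by (auto intro!: derivative_eq_intros)
    from vector_diff_chain_at[OF this that]
    have "((F \<circ> (\<lambda>y. y + of_int m * (2 * pi))) has_vector_derivative l) (at x)"
      by simp
    then show ?thesis
      by (simp add: o_def per)
  qed
  show ?thesis
    using shift[of x m] shift[of "x + of_int m * (2 * pi)" "- m"] by auto
qed

definition primitive :: "(real \<Rightarrow> complex) \<Rightarrow> (real \<Rightarrow> complex) \<Rightarrow> bool" where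
  "primitive \<phi> \<psi> \<longleftrightarrow> (\<forall>a b. a \<le> b \<longrightarrow> (\<psi> has_integral \<phi> b - \<phi> a) {a..b})"

text \<open>
  The derivative is taken as the limit of the quotients with step \<open>1 / (n + 1)\<close>, which is Borel
  measurable and periodic everywhere. It is absolutely integrable, since on short intervals the
  sums over divisions of the norms of its integrals are variation sums of \<open>F\<close>, bounded by \<open>1\<close>.
\<close>
lemma AC_circle_derivative:
  assumes "F \<in> AC_circle"
  obtains g where "g \<in> borel_measurable borel" "periodic g"
    "AE x in lborel. (F has_vector_derivative g x) (at x)"
    "primitive F g" "Lpow 1 g < \<infinity>"
proof -
  have per: "periodic F" and AC: "absolutely_continuous_on {0..2 * pi} F"
    using assms by (simp_all add: AC_circle_def)
  have cont: "continuous_on UNIV F"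
    by (rule AC_circle_continuous[OF assms])
  have [measurable]: "F \<in> borel_measurable borel"
    using cont by (rule borel_measurable_continuous_onI)
  define q where "q n x = real (Suc n) *\<^sub>R (F (x + 1 / real (Suc n)) - F x)" for n x
  define g where "g x = lim (\<lambda>n. q n x)" for x
  have g_eq: "g x = l" if "(F has_vector_derivative l) (at x)" for x l
  proof -
    have lim: "((\<lambda>h. norm (F (x + h) - F x - h *\<^sub>R l) / norm h) \<longlongrightarrow> 0) (at 0)"
      using that by (simp add: has_vector_derivative_def has_derivative_at)
    have "((\<lambda>h. norm ((F (x + h) - F x) /\<^sub>R h - l)) \<longlongrightarrow> 0) (at 0)"
    proof (rule Lim_transform_eventually[OF lim])
      have "norm (F (x + h) - F x - h *\<^sub>R l) / norm h = norm ((F (x + h) - F x) /\<^sub>R h - l)"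
        if "h \<noteq> 0" for h
      proof -
        have "(F (x + h) - F x) /\<^sub>R h - l = (F (x + h) - F x - h *\<^sub>R l) /\<^sub>R h"
          using that by (simp add: scaleR_diff_right)
        then show ?thesis
          by (simp add: divide_inverse_commute)
      qed
      then show "\<forall>\<^sub>F h in at 0. norm (F (x + h) - F x - h *\<^sub>R l) / norm h
          = norm ((F (x + h) - F x) /\<^sub>R h - l)"
        unfolding eventually_at by (intro exI[of _ 1]) auto
    qed
    then have "((\<lambda>h. (F (x + h) - F x) /\<^sub>R h) \<longlongrightarrow> l) (at 0)"
      by (rule LIM_zero_cancel[OF tendsto_norm_zero_cancel])
    moreover have "filterlim (\<lambda>n. 1 / real (Suc n)) (at 0) sequentially"
      unfolding filterlim_at using LIMSEQ_Suc[OF lim_1_over_n] by auto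
    ultimately have "(\<lambda>n. (F (x + 1 / real (Suc n)) - F x) /\<^sub>R (1 / real (Suc n))) \<longlonglongrightarrow> l"
      by (rule filterlim_compose)
    then have "(\<lambda>n. q n x) \<longlonglongrightarrow> l"
      by (simp add: q_def)
    then show ?thesis
      unfolding g_def by (rule limI)
  qed
  show thesis
  proof
    show g_meas: "g \<in> borel_measurable borel"
      unfolding g_def[abs_def] q_def by measurable
    have "F (x + 2 * pi + s) = F (x + s)" for x s
      using per unfolding periodic_def by (metis add.assoc add.commute)
    moreover have "F (x + 2 * pi) = F x" for x
      using per by (simp add: periodic_def)
    ultimately show "periodic g"
      by (simp add: periodic_def g_def q_def)
    define N where "N = {x. \<not> (F has_vector_derivative g x) (at x)}"
    have N_alt: "N = {x. \<not> (\<exists>l. (F has_vector_derivative l) (at x))}"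
      using g_eq by (auto simp: N_def)
    \<comment> \<open>The end point \<open>0\<close> of the period is simply added to the exceptional set.\<close>
    define N0 where "N0 = insert 0 {x \<in> {0<..<2 * pi}. \<not> (\<exists>l. (F has_vector_derivative l) (at x))}"
    have N0: "negligible N0"
      unfolding N0_def using AC_differentiable_ae[OF cont AC] by simp
    have N: "negligible N"
    proof (rule negligible_subset)
      show "negligible (\<Union>m::int. (+) (of_int m * (2 * pi)) ` N0)"
        by (rule negligible_countable_Union) (auto intro: negligible_translation N0)
      show "N \<subseteq> (\<Union>m::int. (+) (of_int m * (2 * pi)) ` N0)"
      proof
        fix x assume "x \<in> N"
        obtain m :: int where m: "of_int m * (2 * pi) \<le> x" "x < of_int m * (2 * pi) + 2 * pi"
          by (rule cell_exists)
        have "x - of_int m * (2 * pi) \<in> N0"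
          using \<open>x \<in> N\<close> m periodic_has_vector_derivative[OF per, of _ "x - of_int m * (2 * pi)" m]
          by (auto simp: N_alt N0_def)
        moreover have "x = (of_int m * (2 * pi)) + (x - of_int m * (2 * pi))"
          by simp
        ultimately show "x \<in> (\<Union>m::int. (+) (of_int m * (2 * pi)) ` N0)"
          by blast
      qed
    qed
    then obtain N' where "N' \<in> null_sets lborel" "N \<subseteq> N'"
      by (auto simp: negligible_iff_null_sets null_sets_completion_iff2)
    then show "AE x in lborel. (F has_vector_derivative g x) (at x)"
      by (intro AE_I'[of N']) (auto simp: N_def)
    have cell: "(g has_integral F b - F a) {a..b}"
      if "a \<le> b" "of_int m * (2 * pi) \<le> a" "b \<le> of_int m * (2 * pi) + 2 * pi" for a b and m :: int
    proof (rule AC_has_integral[OF _ \<open>a \<le> b\<close> N])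
      show "absolutely_continuous_on {a..b} F"
        by (rule absolutely_continuous_on_transfer[OF AC_circle_cell[OF assms, of m], of _ 0])
           (use that in auto)
      show "(F has_vector_derivative g x) (at x)" if "x \<in> {a..b} - N" for x
        using that by (simp add: N_def)
    qed
    have int: "(g has_integral F b - F a) {a..b}" if "a \<le> b" for a b
      using that
    proof (induction a b rule: Bolzano)
      case (trans a b c)
      from has_integral_combine[OF trans(3,4,1,2)] show ?case
        by simp
    next
      case (local x)
      obtain m :: int where m: "of_int m * (2 * pi) \<le> x" "x < of_int m * (2 * pi) + 2 * pi"
        by (rule cell_exists)
      define c where "c = of_int m * (2 * pi)"
      define d where "d = min (2 * pi) (c + 2 * pi - x)"
      have "d > 0"
        using m by (simp add: d_def c_def)
      moreover have "(g has_integral F b - F a) {a..b}" if ab: "a \<le> x \<and> x \<le> b \<and> b - a < d" for a b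
      proof (cases "c \<le> a")
        case True
        then show ?thesis
          using ab by (intro cell[of a b m]) (auto simp: c_def d_def)
      next
        case False
        have ac: "(g has_integral F c - F a) {a..c}"
          using ab False m by (intro cell[of a c "m - 1"]) (auto simp: c_def d_def algebra_simps)
        have cb: "(g has_integral F b - F c) {c..b}"
          using ab False m by (intro cell[of c b m]) (auto simp: c_def d_def algebra_simps)
        have "a \<le> c" "c \<le> b"
          using False ab m by (auto simp: c_def)
        from has_integral_combine[OF this ac cb] show ?thesis
          by simp
      qed
      ultimately show ?case
        by blast
    qed
    then show "primitive F g"
      by (simp add: primitive_def)
    obtain d where "d > 0" and d: "\<forall>a b D. 0 \<le> a \<longrightarrow> a \<le> b \<longrightarrow> b \<le> 2 * pi \<longrightarrow> b - a < d \<longrightarrow>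
        D division_of {a..b} \<longrightarrow> (\<Sum>K\<in>D. norm (F (Sup K) - F (Inf K))) < 1"
      using sum_division_AC_le[OF AC zero_less_one] by (elim exE conjE)
    have "(0::real) \<le> 0 \<and> 2 * pi \<le> 2 * pi \<longrightarrow> (\<lambda>x. norm (g x)) integrable_on {0..2 * pi}"
    proof (rule Bolzano[where P = "\<lambda>a b. 0 \<le> a \<and> b \<le> 2 * pi \<longrightarrow> (\<lambda>x. norm (g x)) integrable_on {a..b}"])
      fix a b c :: real
      assume "0 \<le> a \<and> b \<le> 2 * pi \<longrightarrow> (\<lambda>x. norm (g x)) integrable_on {a..b}"
        "0 \<le> b \<and> c \<le> 2 * pi \<longrightarrow> (\<lambda>x. norm (g x)) integrable_on {b..c}" "a \<le> b" "b \<le> c"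
      then show "0 \<le> a \<and> c \<le> 2 * pi \<longrightarrow> (\<lambda>x. norm (g x)) integrable_on {a..c}"
        using Henstock_Kurzweil_Integration.integrable_combine[of a b c "\<lambda>x. norm (g x)"] by auto
    next
      fix x :: real
      have "(\<lambda>x. norm (g x)) integrable_on {a..b}"
        if ab: "a \<le> b" "b - a < d" "0 \<le> a" "b \<le> 2 * pi" for a b
      proof -
        have "g absolutely_integrable_on cbox a b"
        proof (rule bounded_variation_absolutely_integrable_interval)
          show "g integrable_on cbox a b"
            using int[OF ab(1)] by (auto simp: cbox_interval)
          fix D assume D: "D division_of cbox a b"
          have "integral K g = F (Sup K) - F (Inf K)" if "K \<in> D" for K
          proof -
            have "K = {Inf K..Sup K}" "Inf K \<le> Sup K"
              using division_ofD(3,4)[OF D that] by (auto simp: cbox_interval)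
            then show ?thesis
              using integral_unique[OF int[of "Inf K" "Sup K"]] by metis
          qed
          then have "(\<Sum>K\<in>D. norm (integral K g)) = (\<Sum>K\<in>D. norm (F (Sup K) - F (Inf K)))"
            by simp
          also have "\<dots> < 1"
            using D ab by (intro d[rule_format, of a b]) (auto simp: cbox_interval)
          finally show "(\<Sum>K\<in>D. norm (integral K g)) \<le> 1"
            by simp
        qed
        then show ?thesis
          by (auto simp: absolutely_integrable_on_def cbox_interval)
      qed
      then show "\<exists>d>0. \<forall>a b. a \<le> x \<and> x \<le> b \<and> b - a < d \<longrightarrow> 0 \<le> a \<and> b \<le> 2 * pi \<longrightarrow>
          (\<lambda>x. norm (g x)) integrable_on {a..b}"
        using \<open>d > 0\<close> by (intro exI[of _ d]) auto
    qed simp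
    then have "(\<lambda>x. norm (g x)) integrable_on {0..2 * pi}"
      by simp
    then have "g absolutely_integrable_on {0..2 * pi}"
      using int[of 0 "2 * pi"] by (auto simp: absolutely_integrable_on_def)
    then have "(\<integral>\<^sup>+x. ennreal (norm (indicator {0..2 * pi} x *\<^sub>R g x)) \<partial>lebesgue) < \<infinity>"
      unfolding set_integrable_def integrable_iff_bounded by simp
    moreover have "Lpow 1 g \<le> (\<integral>\<^sup>+x. ennreal (norm (indicator {0..2 * pi} x *\<^sub>R g x)) \<partial>lebesgue)"
      unfolding Lpow_def nn_integral_completion by (intro nn_integral_mono) (auto simp: indicator_def)
    ultimately show "Lpow 1 g < \<infinity>"
      by simp
  qed
qed

section \<open>Convergence of the corrected averages in the mean\<close>

lemma primitive_translate:
  assumes "primitive \<phi> \<psi>"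
  shows "primitive (\<lambda>x. \<phi> (x + c)) (\<lambda>x. \<psi> (x + c))"
  unfolding primitive_def
proof (intro allI impI)
  fix a b :: real assume "a \<le> b"
  then have "(\<psi> has_integral \<phi> (b + c) - \<phi> (a + c)) (cbox (a + c) (b + c))"
    using assms by (simp add: primitive_def cbox_interval)
  from has_integral_affinity'[OF this zero_less_one, of c]
  show "((\<lambda>x. \<psi> (x + c)) has_integral \<phi> (b + c) - \<phi> (a + c)) {a..b}"
    by (simp add: cbox_interval)
qed

lemma primitive_fwd_diff:
  assumes "primitive \<phi> \<psi>"
  shows "primitive (fwd_diff s t \<phi>) (fwd_diff s t \<psi>)"
  unfolding primitive_def
proof (intro allI impI)
  fix a b :: real assume "a \<le> b"
  have "((\<lambda>x. \<Sum>\<nu>\<le>s. of_nat (s choose \<nu>) * (-1) ^ \<nu> * \<psi> (x + real \<nu> * t)) has_integral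
      (\<Sum>\<nu>\<le>s. of_nat (s choose \<nu>) * (-1) ^ \<nu> * (\<phi> (b + real \<nu> * t) - \<phi> (a + real \<nu> * t)))) {a..b}"
    using primitive_translate[OF assms] \<open>a \<le> b\<close>
    by (intro has_integral_sum has_integral_mult_right) (auto simp: primitive_def)
  then show "(fwd_diff s t \<psi> has_integral fwd_diff s t \<phi> b - fwd_diff s t \<phi> a) {a..b}"
    by (simp add: fwd_diff_def[abs_def] right_diff_distrib sum_subtractf)
qed

lemma norm_primitive_diff_le:
  assumes "primitive \<phi> \<psi>" and [measurable]: "\<psi> \<in> borel_measurable borel" and "a \<le> b"
  shows "ennreal (norm (\<phi> b - \<phi> a)) \<le> (\<integral>\<^sup>+x\<in>{a..b}. ennreal (norm (\<psi> x)) \<partial>lborel)"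
proof (cases "(\<integral>\<^sup>+x\<in>{a..b}. ennreal (norm (\<psi> x)) \<partial>lborel) = \<infinity>")
  case False
  have norm_eq: "ennreal (norm (indicator {a..b} x *\<^sub>R \<psi> x)) = ennreal (norm (\<psi> x)) * indicator {a..b} x" for x
    by (auto simp: indicator_def)
  have int: "set_integrable lborel {a..b} \<psi>"
    unfolding set_integrable_def integrable_iff_bounded norm_eq
    using False by (auto simp: less_top)
  have "(\<psi> has_integral \<phi> b - \<phi> a) {a..b}"
    using assms(1,3) by (simp add: primitive_def)
  then have "\<phi> b - \<phi> a = integral {a..b} \<psi>"
    by (rule integral_unique[symmetric])
  also have "\<dots> = (LINT x:{a..b}|lborel. \<psi> x)"
    using set_borel_integral_eq_integral(2)[OF int] by simp
  finally have eq: "\<phi> b - \<phi> a = (LINT x:{a..b}|lborel. \<psi> x)" .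
  show ?thesis
    using integral_norm_bound_ennreal[OF int[unfolded set_integrable_def]]
    unfolding eq set_lebesgue_integral_def norm_eq .
qed simp

lemma fwd_diff_1: "fwd_diff 1 t \<phi> x = \<phi> x - \<phi> (x + t)"
  by (simp add: fwd_diff_def)

lemma fwd_diff_Suc: "fwd_diff (Suc s) t \<phi> x = fwd_diff s t \<phi> x - fwd_diff s t \<phi> (x + t)"
proof -
  have "fwd_diff (Suc s) t \<phi> x = shift_op [:1, -1:] t (fwd_diff s t \<phi>) x"
    by (simp add: fwd_diff_as_shift_op shift_op_mult[symmetric])
  also have "\<dots> = fwd_diff s t \<phi> x - fwd_diff s t \<phi> (x + t)"
    by (simp add: shift_op_def)
  finally show ?thesis .
qed

lemma Lpow_1: "Lpow 1 \<phi> = (\<integral>\<^sup>+x\<in>{0..<2 * pi}. ennreal (norm (\<phi> x)) \<partial>lborel)"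
  by (simp add: Lpow_def)

text \<open>
  The increment is at most the integral of \<open>|\<psi>|\<close> over \<open>[x, x + t]\<close>. By Fubini's theorem one may
  integrate over \<open>x\<close> first, and every translate of \<open>\<psi>\<close> has the same \<open>L\<^sup>1\<close> norm.
\<close>
lemma Lpow_1_increment_le:
  assumes prim: "primitive \<phi> \<psi>" and [measurable]: "\<psi> \<in> borel_measurable borel"
    and per: "periodic \<psi>" and "t \<ge> 0"
  shows "Lpow 1 (\<lambda>x. \<phi> x - \<phi> (x + t)) \<le> ennreal t * Lpow 1 \<psi>"
proof -
  have inner: "ennreal (norm (\<phi> x - \<phi> (x + t)))
      \<le> (\<integral>\<^sup>+s. ennreal (norm (\<psi> (x + s))) * indicator {0..t} s \<partial>lborel)" for x
  proof -
    have "ennreal (norm (\<phi> x - \<phi> (x + t))) \<le> (\<integral>\<^sup>+y\<in>{x..x + t}. ennreal (norm (\<psi> y)) \<partial>lborel)"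
      using norm_primitive_diff_le[OF prim, of x "x + t"] \<open>t \<ge> 0\<close> by (simp add: norm_minus_commute)
    also have "\<dots> = (\<integral>\<^sup>+s. ennreal (norm (\<psi> (x + s))) * indicator {0..t} s \<partial>lborel)"
      by (subst nn_integral_real_affine[where c = 1 and t = x])
         (auto simp: indicator_def intro!: nn_integral_cong)
    finally show ?thesis .
  qed
  have "Lpow 1 (\<lambda>x. \<phi> x - \<phi> (x + t))
      \<le> (\<integral>\<^sup>+x. (\<integral>\<^sup>+s. ennreal (norm (\<psi> (x + s))) * indicator {0..t} s * indicator {0..<2 * pi} x \<partial>lborel) \<partial>lborel)"
    unfolding Lpow_1
  proof (rule nn_integral_mono)
    fix x :: real
    show "ennreal (norm (\<phi> x - \<phi> (x + t))) * indicator {0..<2 * pi} x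
        \<le> (\<integral>\<^sup>+s. ennreal (norm (\<psi> (x + s))) * indicator {0..t} s * indicator {0..<2 * pi} x \<partial>lborel)"
      using inner[of x] by (cases "x \<in> {0..<2 * pi}") simp_all
  qed
  also have "\<dots> = (\<integral>\<^sup>+s. (\<integral>\<^sup>+x. ennreal (norm (\<psi> (x + s))) * indicator {0..t} s * indicator {0..<2 * pi} x \<partial>lborel) \<partial>lborel)"
    by (rule lborel_pair.Fubini') measurable
  also have "\<dots> = (\<integral>\<^sup>+s. Lpow 1 \<psi> * indicator {0..t} s \<partial>lborel)"
  proof (rule nn_integral_cong)
    fix s :: real
    show "(\<integral>\<^sup>+x. ennreal (norm (\<psi> (x + s))) * indicator {0..t} s * indicator {0..<2 * pi} x \<partial>lborel)
        = Lpow 1 \<psi> * indicator {0..t} s"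
      using Lpow_translate[of \<psi> 1 s] per
      by (cases "s \<in> {0..t}") (simp_all add: Lpow_1)
  qed
  also have "\<dots> = ennreal t * Lpow 1 \<psi>"
    using \<open>t \<ge> 0\<close> by (simp add: nn_integral_cmult_indicator mult.commute)
  finally show ?thesis .
qed

text \<open>
  The function \<open>u 0\<close> with its derivatives \<open>u 1, \<dots>, u r\<close>. The last one exists only almost everywhere;
  \<open>u r\<close> is a Borel measurable version of it.
\<close>
locale derivative_chain =
  fixes u :: "nat \<Rightarrow> real \<Rightarrow> complex" and r :: nat
  assumes r: "r \<ge> 1"
    and meas [measurable]: "\<And>i. i \<le> r \<Longrightarrow> u i \<in> borel_measurable borel"
    and per: "\<And>i. i \<le> r \<Longrightarrow> periodic (u i)"
    and prim: "\<And>i. i < r \<Longrightarrow> primitive (u i) (u (Suc i))"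
    and deriv: "AE x in lborel. (u (r - 1) has_vector_derivative u r x) (at x)"
    and fin: "\<And>i. i \<le> r \<Longrightarrow> Lpow 1 (u i) < \<infinity>"
begin

lemma Lpow_1_fwd_diff_le:
  assumes "t > 0" "i + s \<le> r"
  shows "Lpow 1 (fwd_diff s t (u i)) \<le> ennreal (t ^ s) * Lpow 1 (u (i + s))"
  using assms(2)
proof (induction s arbitrary: i)
  case 0
  show ?case by (simp add: fwd_diff_def)
next
  case (Suc s)
  have "Lpow 1 (fwd_diff (Suc s) t (u i)) = Lpow 1 (\<lambda>x. fwd_diff s t (u i) x - fwd_diff s t (u i) (x + t))"
    by (simp add: fwd_diff_Suc[abs_def])
  also have "\<dots> \<le> ennreal t * Lpow 1 (fwd_diff s t (u (Suc i)))"
    by (rule Lpow_1_increment_le)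
       (use Suc.prems \<open>t > 0\<close> in \<open>auto intro!: primitive_fwd_diff prim fwd_diff_measurable meas periodic_fwd_diff per\<close>)
  also have "\<dots> \<le> ennreal t * (ennreal (t ^ s) * Lpow 1 (u (Suc i + s)))"
    using Suc.prems by (intro mult_left_mono Suc.IH) auto
  finally show ?case
    using \<open>t > 0\<close> by (simp add: ennreal_mult mult.assoc)
qed

text \<open>
  The difference of order \<open>i + 1\<close> of \<open>u m\<close> is an \<open>i\<close>-fold integral over intervals of length \<open>t\<close> of first
  differences of \<open>u (r - 1)\<close>, up to sign. So it is close to \<open>c (-t)\<^sup>i\<^sup>+\<^sup>1\<close> if these first differences
  are close to \<open>c (-t)\<close>.
\<close>
lemma fwd_diff_near_power:
  assumes "t > 0" and "m + i = r - 1"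
    and B: "\<And>\<xi>. y \<le> \<xi> \<Longrightarrow> \<xi> \<le> y + real i * t \<Longrightarrow> norm (fwd_diff 1 t (u (r - 1)) \<xi> - c * of_real (-t)) \<le> B"
  shows "norm (fwd_diff (Suc i) t (u m) y - c * of_real ((-t) ^ Suc i)) \<le> t ^ i * B"
  using assms(2) B
proof (induction i arbitrary: m y)
  case 0
  then show ?case
    using 0(2)[of y] by simp
next
  case (Suc i)
  define D D' where "D = fwd_diff (Suc i) t (u m)" and "D' = fwd_diff (Suc i) t (u (Suc m))"
  define w where "w = c * of_real ((-t) ^ Suc i)"
  have "primitive (u m) (u (Suc m))"
    using Suc.prems(1) r by (intro prim) auto
  then have "(D' has_integral D (y + t) - D y) {y..y + t}"
    using primitive_fwd_diff \<open>t > 0\<close> by (simp add: primitive_def D_def D'_def)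
  then have "((\<lambda>x. D' x - w) has_integral (D (y + t) - D y) - t *\<^sub>R w) (cbox y (y + t))"
    using has_integral_const_real[of w y "y + t"] \<open>t > 0\<close>
    by (intro has_integral_diff) (auto simp: cbox_interval)
  moreover have le: "norm (D' x - w) \<le> t ^ i * B" if "x \<in> cbox y (y + t)" for x
    unfolding D'_def w_def
  proof (rule Suc.IH)
    fix \<xi> assume "x \<le> \<xi>" "\<xi> \<le> x + real i * t"
    with that show "norm (fwd_diff 1 t (u (r - 1)) \<xi> - c * of_real (-t)) \<le> B"
      by (intro Suc.prems(2)) (auto simp: cbox_interval algebra_simps)
  qed (use Suc.prems in auto)
  moreover have "0 \<le> t ^ i * B"
    using order_trans[OF norm_ge_zero le[of y]] \<open>t > 0\<close> by (simp add: cbox_interval)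
  ultimately have "norm ((D (y + t) - D y) - t *\<^sub>R w) \<le> t ^ i * B * measure lborel (cbox y (y + t))"
    by (rule_tac has_integral_bound)
  then have "norm ((D (y + t) - D y) - t *\<^sub>R w) \<le> t ^ Suc i * B"
    using \<open>t > 0\<close> by (simp add: cbox_interval mult_ac)
  moreover have "fwd_diff (Suc (Suc i)) t (u m) y - c * of_real ((-t) ^ Suc (Suc i))
      = - ((D (y + t) - D y) - t *\<^sub>R w)"
    by (simp add: fwd_diff_Suc[of "Suc i"] D_def w_def scaleR_conv_of_real)
  ultimately show ?case
    by (simp only: norm_minus_cancel)
qed

text \<open>
  Near \<open>x\<close> all first differences of \<open>u (r - 1)\<close> with a small step \<open>\<tau>\<close> are \<open>-\<tau> c + o(\<tau>)\<close>, because
  \<open>u (r - 1)\<close> is differentiable at \<open>x\<close> and both end points are within \<open>r \<tau>\<close> of \<open>x\<close>.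
\<close>
lemma fwd_diff_quotient_tendsto:
  assumes x: "(u (r - 1) has_vector_derivative c) (at x)"
    and t: "\<And>n. t n > 0" "t \<longlonglongrightarrow> 0"
  shows "(\<lambda>n. fwd_diff r (t n) (u 0) x / of_real ((- t n) ^ r)) \<longlonglongrightarrow> c"
proof (rule LIMSEQ_I)
  fix e :: real assume "e > 0"
  define e' where "e' = e / (4 * real r)"
  have "e' > 0"
    using \<open>e > 0\<close> r by (simp add: e'_def)
  then obtain \<rho> where "\<rho> > 0" and \<rho>: "\<And>y. norm (y - x) < \<rho> \<Longrightarrow>
      norm (u (r - 1) y - u (r - 1) x - (y - x) *\<^sub>R c) \<le> e' * norm (y - x)"
    using x unfolding has_vector_derivative_def has_derivative_at_alt by blast
  have "\<forall>\<^sub>F n in sequentially. t n < \<rho> / (real r + 1)"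
    using \<open>\<rho> > 0\<close> by (intro order_tendstoD(2)[OF t(2)]) auto
  then obtain n0 where n0: "\<And>n. n \<ge> n0 \<Longrightarrow> t n < \<rho> / (real r + 1)"
    by (auto simp: eventually_sequentially)
  have "norm (fwd_diff r (t n) (u 0) x / of_real ((- t n) ^ r) - c) < e" if n: "n \<ge> n0" for n
  proof -
    define \<tau> where "\<tau> = t n"
    have "\<tau> > 0"
      using t by (simp add: \<tau>_def)
    have "real r * \<tau> < \<rho>"
      using n0[OF n] \<open>\<tau> > 0\<close> by (simp add: \<tau>_def field_simps)
    have bound: "norm (fwd_diff 1 \<tau> (u (r - 1)) \<xi> - c * of_real (-\<tau>)) \<le> 2 * e' * (real r * \<tau>)"
      if "x \<le> \<xi>" "\<xi> \<le> x + real (r - 1) * \<tau>" for \<xi>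
    proof -
      have "real (r - 1) * \<tau> = real r * \<tau> - \<tau>"
        using r by (simp add: of_nat_diff left_diff_distrib)
      with that have "\<xi> + \<tau> \<le> x + real r * \<tau>"
        by simp
      then have near: "norm (\<xi> - x) < \<rho>" "norm (\<xi> + \<tau> - x) < \<rho>"
          "norm (\<xi> - x) \<le> real r * \<tau>" "norm (\<xi> + \<tau> - x) \<le> real r * \<tau>"
        using that \<open>\<tau> > 0\<close> \<open>real r * \<tau> < \<rho>\<close> by auto
      have "fwd_diff 1 \<tau> (u (r - 1)) \<xi> - c * of_real (-\<tau>)
          = (u (r - 1) \<xi> - u (r - 1) x - (\<xi> - x) *\<^sub>R c)
            - (u (r - 1) (\<xi> + \<tau>) - u (r - 1) x - (\<xi> + \<tau> - x) *\<^sub>R c)"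
        by (simp add: fwd_diff_1[unfolded One_nat_def] scaleR_conv_of_real algebra_simps)
      also have "norm \<dots> \<le> e' * norm (\<xi> - x) + e' * norm (\<xi> + \<tau> - x)"
        by (rule order_trans[OF norm_triangle_ineq4 add_mono[OF \<rho>[OF near(1)] \<rho>[OF near(2)]]])
      also have "\<dots> \<le> e' * (real r * \<tau>) + e' * (real r * \<tau>)"
        using \<open>e' > 0\<close> near by (intro add_mono mult_left_mono) auto
      finally show ?thesis
        by (simp add: mult_ac)
    qed
    have near_power: "norm (fwd_diff (Suc (r - 1)) \<tau> (u 0) x - c * of_real ((-\<tau>) ^ Suc (r - 1)))
        \<le> \<tau> ^ (r - 1) * (2 * e' * (real r * \<tau>))"
      by (rule fwd_diff_near_power[OF \<open>\<tau> > 0\<close> _ bound]) auto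
    have "norm (fwd_diff r \<tau> (u 0) x - c * of_real ((-\<tau>) ^ r)) \<le> (e / 2) * \<tau> ^ r"
    proof -
      have "\<tau> ^ (r - 1) * (2 * e' * (real r * \<tau>)) = e / 2 * (\<tau> ^ (r - 1) * \<tau>)"
        using r by (simp add: e'_def field_simps)
      moreover have "\<tau> ^ (r - 1) * \<tau> = \<tau> ^ r" "Suc (r - 1) = r"
        using r power_minus_mult[of r \<tau>] by simp_all
      ultimately show ?thesis
        using near_power by metis
    qed
    then have "norm (fwd_diff r \<tau> (u 0) x - c * of_real ((-\<tau>) ^ r)) / \<tau> ^ r \<le> (e / 2 * \<tau> ^ r) / \<tau> ^ r"
      using \<open>\<tau> > 0\<close> by (intro divide_right_mono) auto
    moreover have "fwd_diff r \<tau> (u 0) x / of_real ((-\<tau>) ^ r) - c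
        = (fwd_diff r \<tau> (u 0) x - c * of_real ((-\<tau>) ^ r)) / of_real ((-\<tau>) ^ r)"
      using \<open>\<tau> > 0\<close> by (simp add: field_simps)
    moreover have "norm (complex_of_real ((-\<tau>) ^ r)) = \<tau> ^ r"
      using \<open>\<tau> > 0\<close> by (simp add: norm_power)
    ultimately have "norm (fwd_diff r \<tau> (u 0) x / of_real ((-\<tau>) ^ r) - c) \<le> (e / 2 * \<tau> ^ r) / \<tau> ^ r"
      by (simp only: norm_divide)
    also have "\<dots> < e"
      using \<open>e > 0\<close> \<open>\<tau> > 0\<close> by simp
    finally show ?thesis
      by (simp add: \<tau>_def)
  qed
  then show "\<exists>n0. \<forall>n\<ge>n0. norm (fwd_diff r (t n) (u 0) x / of_real ((- t n) ^ r) - c) < e"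
    by blast
qed

text \<open>
  Convergence holds almost everywhere and the \<open>L\<^sup>1\<close> norms are at most that of the limit, so
  Scheffe's lemma applies.
\<close>
lemma fwd_diff_quotient_tendsto_L1:
  assumes t: "\<And>n. t n > 0" "t \<longlonglongrightarrow> 0"
  shows "(\<lambda>n. Lpow 1 (\<lambda>x. fwd_diff r (t n) (u 0) x / of_real ((- t n) ^ r) - u r x)) \<longlonglongrightarrow> 0"
proof -
  define Q where "Q n x = fwd_diff r (t n) (u 0) x / of_real ((- t n) ^ r)" for n x
  define I where "I x = (indicator {0..<2 * pi} x :: real)" for x :: real
  have [measurable]: "Q n \<in> borel_measurable borel" "u r \<in> borel_measurable borel"
    "I \<in> borel_measurable borel" for n
    unfolding Q_def[abs_def] I_def[abs_def] by auto
  have Lpow_I: "(\<integral>\<^sup>+x. ennreal (norm (I x *\<^sub>R \<phi> x)) \<partial>lborel) = Lpow 1 \<phi>" for \<phi> :: "real \<Rightarrow> complex"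
    unfolding Lpow_1 by (intro nn_integral_cong) (auto simp: I_def indicator_def)
  have Q_le: "Lpow 1 (Q n) \<le> Lpow 1 (u r)" for n
  proof -
    have "Lpow 1 (Q n) = Lpow 1 (\<lambda>x. inverse (of_real ((- t n) ^ r)) * fwd_diff r (t n) (u 0) x)"
      by (simp add: Q_def[abs_def] field_simps)
    also have "\<dots> = ennreal (inverse (t n ^ r)) * Lpow 1 (fwd_diff r (t n) (u 0))"
      using t(1)[of n] by (subst Lpow_cmult) (auto simp: norm_inverse norm_power)
    also have "\<dots> \<le> ennreal (inverse (t n ^ r)) * (ennreal (t n ^ r) * Lpow 1 (u (0 + r)))"
      by (intro mult_left_mono Lpow_1_fwd_diff_le) (use t in auto)
    also have "\<dots> = Lpow 1 (u r)"
      using t(1)[of n] by (simp add: mult.assoc[symmetric] ennreal_mult[symmetric])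
    finally show ?thesis .
  qed
  have "(\<lambda>n. \<integral>\<^sup>+x. norm (I x *\<^sub>R Q n x - I x *\<^sub>R u r x) \<partial>lborel) \<longlonglongrightarrow> 0"
  proof (rule Scheffe_lemma1)
    show "integrable lborel (\<lambda>x. I x *\<^sub>R Q n x)" for n
      unfolding integrable_iff_bounded Lpow_I using le_less_trans[OF Q_le fin[of r]] by auto
    show "integrable lborel (\<lambda>x. I x *\<^sub>R u r x)"
      unfolding integrable_iff_bounded Lpow_I using fin[of r] by auto
    show "AE x in lborel. (\<lambda>n. I x *\<^sub>R Q n x) \<longlonglongrightarrow> I x *\<^sub>R u r x"
      using deriv
    proof eventually_elim
      case (elim x)
      then show ?case
        unfolding Q_def by (intro tendsto_scaleR tendsto_const fwd_diff_quotient_tendsto t)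
    qed
    show "limsup (\<lambda>n. \<integral>\<^sup>+x. norm (I x *\<^sub>R Q n x) \<partial>lborel) \<le> (\<integral>\<^sup>+x. norm (I x *\<^sub>R u r x) \<partial>lborel)"
      unfolding Lpow_I by (intro Limsup_bounded always_eventually allI Q_le)
  qed
  then show ?thesis
    unfolding scaleR_diff_right[symmetric] Lpow_I by (simp only: Q_def)
qed

text \<open>
  By \<open>geometric_avg_poly\<close>, \<open>H\<close> is exactly the uncorrected average, on the fine grid, of the
  difference quotients of order \<open>r\<close> with the fine step. Replacing these by \<open>u r\<close> produces an error
  controlled by \<open>E n\<close>, uniformly in the number of grid points, since averages do not increase the
  \<open>L\<^sup>1\<close> norm. The correction contributes \<open>M - 1\<close> applied to \<open>H\<close>; it is divisible by \<open>1 - X\<close>, and a first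
  difference of \<open>H\<close> is \<open>O(t)\<close> in \<open>L\<^sup>1\<close>.
\<close>
lemma quadrature_tendsto_L1:
  fixes h :: real and k :: nat
  assumes M: "poly M 1 = 1" and "h > 0"
  defines "H \<equiv> \<lambda>x. fwd_diff (r + k) h (u 0) x / of_real ((- h) ^ r)"
  shows "(\<lambda>n. Lpow 1 (\<lambda>x. H x - quadrature (2 ^ n) r M h (fwd_diff k h (u r)) x)) \<longlonglongrightarrow> 0"
proof -
  define t where "t n = h / 2 ^ n" for n
  have t: "t n > 0" for n
    using \<open>h > 0\<close> by (simp add: t_def)
  have "(\<lambda>n. h * (1 / 2) ^ n) \<longlonglongrightarrow> h * 0"
    by (intro tendsto_mult tendsto_const LIMSEQ_power_zero) auto
  then have t_lim: "t \<longlonglongrightarrow> 0"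
    by (simp add: t_def[abs_def] power_divide)
  have [measurable]: "u 0 \<in> borel_measurable borel" "u r \<in> borel_measurable borel"
    "u 1 \<in> borel_measurable borel"
    using r by auto
  have [measurable]: "H \<in> borel_measurable borel"
    unfolding H_def by measurable
  define E where "E n x = fwd_diff r (t n) (u 0) x / of_real ((- t n) ^ r) - u r x" for n x
  have E_lim: "(\<lambda>n. Lpow 1 (E n)) \<longlonglongrightarrow> 0"
    unfolding E_def using fwd_diff_quotient_tendsto_L1[OF t t_lim] .
  have [measurable]: "E n \<in> borel_measurable borel" for n
    unfolding E_def[abs_def] by measurable
  have perE: "periodic (E n)" for n
    using periodic_fwd_diff[OF per, of 0 r "t n"] per[of r] r by (simp add: periodic_def E_def)
  obtain Q where Q: "M - 1 = [:1, -1:] * Q"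
  proof -
    have "poly (M - 1) 1 = 0"
      using M by simp
    then have "[:-1, 1:] dvd M - 1"
      by (simp only: poly_eq_0_iff_dvd)
    moreover have "[:-1, 1:] = - ([:1, -1:] :: complex poly)"
      by simp
    ultimately show thesis
      using that by (metis minus_dvd_iff dvdE)
  qed
  define C where "C = coeff_psum 1 Q * (coeff_psum 1 ([:1, -1:] ^ (r + k)) / h ^ r)"
  define C' where "C' = coeff_psum 1 M * coeff_psum 1 ([:1, -1:] ^ k)"
  have C_nonneg: "C \<ge> 0" "C' \<ge> 0"
    using \<open>h > 0\<close> by (auto simp: C_def C'_def coeff_psum_nonneg)
  have bound: "Lpow 1 (\<lambda>x. H x - quadrature (2 ^ n) r M h (fwd_diff k h (u r)) x)
      \<le> ennreal C * (ennreal (t n) * Lpow 1 (u 1)) + ennreal C' * Lpow 1 (E n)" for n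
  proof -
    define N where "N = (2 ^ n :: nat)"
    have N: "N > 0" "h = real N * t n" "h / real N = t n"
      by (auto simp: N_def t_def)
    have H_eq: "H = shift_op (avg_poly N ^ r) (t n) (\<lambda>x. fwd_diff k h (fwd_diff r (t n) (u 0)) x / of_real ((- t n) ^ r))"
    proof
      fix x
      have dil: "dilate N [:1, -1:] = smult (of_nat N) ([:1, -1:] * avg_poly N)"
        using geometric_avg_poly[OF \<open>N > 0\<close>] \<open>N > 0\<close> by simp
      have "fwd_diff (r + k) h (u 0) x = fwd_diff r h (fwd_diff k h (u 0)) x"
        by (simp add: fwd_diff_as_shift_op power_add shift_op_mult)
      also have "\<dots> = shift_op (dilate N [:1, -1:] ^ r) (t n) (fwd_diff k h (u 0)) x"
        unfolding fwd_diff_as_shift_op[of r] by (simp add: N(2) flip: shift_op_dilate dilate_power)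
      also have "dilate N [:1, -1:] ^ r = smult (of_nat N ^ r) (avg_poly N ^ r * [:1, -1:] ^ r)"
        by (simp only: dil smult_power power_mult_distrib mult.commute)
      also have "shift_op \<dots> (t n) (fwd_diff k h (u 0)) x
          = of_nat N ^ r * shift_op (avg_poly N ^ r) (t n) (fwd_diff r (t n) (fwd_diff k h (u 0))) x"
        by (simp add: shift_op_smult shift_op_mult fwd_diff_as_shift_op[of r])
      also have "fwd_diff r (t n) (fwd_diff k h (u 0)) = fwd_diff k h (fwd_diff r (t n) (u 0))"
        by (simp add: fun_eq_iff fwd_diff_as_shift_op shift_op_commute_steps[of _ "t n" _ h])
      finally have "H x = shift_op (avg_poly N ^ r) (t n) (fwd_diff k h (fwd_diff r (t n) (u 0))) x
          * (of_nat N ^ r / of_real ((- h) ^ r))"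
        by (simp add: H_def)
      also have "of_nat N ^ r / of_real ((- h) ^ r) = (1 / of_real ((- t n) ^ r) :: complex)"
        using N(1) by (simp add: N(2) power_minus[of "of_real _"] power_mult_distrib minus_mult_right[symmetric] power_minus')
      finally show "H x = shift_op (avg_poly N ^ r) (t n)
          (\<lambda>x. fwd_diff k h (fwd_diff r (t n) (u 0)) x / of_real ((- t n) ^ r)) x"
        using shift_op_fun_scale[of "avg_poly N ^ r" "t n" "1 / of_real ((- t n) ^ r)"]
        by (simp add: mult.commute)
    qed
    have "H x - quadrature N r M h (fwd_diff k h (u r)) x
        = - shift_op Q (t n) (fwd_diff 1 (t n) H) x
          + shift_op (avg_poly N ^ r * M) (t n) (fwd_diff k h (E n)) x" for x
    proof -
      have "shift_op M (t n) H x = shift_op (avg_poly N ^ r * M) (t n)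
          (\<lambda>x. fwd_diff k h (fwd_diff r (t n) (u 0)) x / of_real ((- t n) ^ r)) x"
        unfolding H_eq by (simp add: shift_op_mult[symmetric] mult.commute)
      moreover have "fwd_diff k h (E n) = (\<lambda>x. fwd_diff k h (fwd_diff r (t n) (u 0)) x / of_real ((- t n) ^ r)
          - fwd_diff k h (u r) x)"
        unfolding fwd_diff_as_shift_op[of k] E_def[abs_def] fun_eq_iff shift_op_fun_diff
        using shift_op_fun_scale[of _ _ "1 / of_real ((- t n) ^ r)"] by simp
      ultimately have "shift_op M (t n) H x - quadrature N r M h (fwd_diff k h (u r)) x
          = shift_op (avg_poly N ^ r * M) (t n) (fwd_diff k h (E n)) x"
        by (simp add: quadrature_def N(3) shift_op_fun_diff)
      moreover have "shift_op M (t n) H x - H x = shift_op Q (t n) (fwd_diff 1 (t n) H) x"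
      proof -
        have "shift_op M (t n) H x - H x = shift_op (M - 1) (t n) H x"
          by (simp add: shift_op_diff)
        also have "\<dots> = shift_op (Q * [:1, -1:]) (t n) H x"
          by (simp only: Q mult.commute)
        finally show ?thesis
          by (simp only: shift_op_mult fwd_diff_as_shift_op power_one_right)
      qed
      ultimately show ?thesis
        by (simp add: algebra_simps)
    qed
    then have "Lpow 1 (\<lambda>x. H x - quadrature N r M h (fwd_diff k h (u r)) x)
        \<le> Lpow 1 (\<lambda>x. - shift_op Q (t n) (fwd_diff 1 (t n) H) x)
          + Lpow 1 (shift_op (avg_poly N ^ r * M) (t n) (fwd_diff k h (E n)))"
      by (simp only:) (rule Lpow_add_le, auto)
    also have "Lpow 1 (\<lambda>x. - shift_op Q (t n) (fwd_diff 1 (t n) H) x) \<le> ennreal C * (ennreal (t n) * Lpow 1 (u 1))"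
    proof -
      have per0: "periodic (u 0)"
        using per by simp
      then have perH: "periodic H"
        using periodic_fwd_diff[OF per0, of "r + k" h] by (simp add: periodic_def H_def)
      define c where "c = coeff_psum 1 ([:1, -1:] ^ (r + k))"
      have "c \<ge> 0"
        by (simp add: c_def coeff_psum_nonneg)
      have "fwd_diff 1 (t n) H = (\<lambda>x. (1 / of_real ((- h) ^ r)) * shift_op ([:1, -1:] ^ (r + k)) h (fwd_diff 1 (t n) (u 0)) x)"
        by (simp add: fun_eq_iff H_def fwd_diff_1[unfolded One_nat_def, abs_def]
            fwd_diff_as_shift_op[of "r + k"] diff_divide_distrib shift_op_fun_diff shift_op_translate)
      then have "Lpow 1 (fwd_diff 1 (t n) H) = ennreal (1 / h ^ r) * Lpow 1 (shift_op ([:1, -1:] ^ (r + k)) h (fwd_diff 1 (t n) (u 0)))"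
        using \<open>h > 0\<close> by (simp only:) (subst Lpow_cmult, auto simp: norm_divide norm_power)
      also have "\<dots> \<le> ennreal (1 / h ^ r) * (ennreal c * Lpow 1 (fwd_diff 1 (t n) (u 0)))"
        unfolding c_def by (intro mult_left_mono Lpow_shift_op_le) (auto intro: periodic_fwd_diff per0)
      also have "\<dots> \<le> ennreal (1 / h ^ r) * (ennreal c * (ennreal (t n) * Lpow 1 (u 1)))"
        using Lpow_1_fwd_diff_le[OF t, of 0 1 n] r by (intro mult_left_mono) auto
      also have "\<dots> = ennreal (c / h ^ r) * (ennreal (t n) * Lpow 1 (u 1))"
        using \<open>h > 0\<close> \<open>c \<ge> 0\<close> by (simp add: mult.assoc[symmetric] ennreal_mult[symmetric])
      finally have H_le: "Lpow 1 (fwd_diff 1 (t n) H) \<le> ennreal (c / h ^ r) * (ennreal (t n) * Lpow 1 (u 1))" .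
      have "Lpow 1 (\<lambda>x. - shift_op Q (t n) (fwd_diff 1 (t n) H) x) = Lpow 1 (shift_op Q (t n) (fwd_diff 1 (t n) H))"
        unfolding Lpow_1 norm_minus_cancel ..
      also have "\<dots> \<le> ennreal (coeff_psum 1 Q) * Lpow 1 (fwd_diff 1 (t n) H)"
        by (rule Lpow_shift_op_le) (auto intro: periodic_fwd_diff perH)
      also have "\<dots> \<le> ennreal (coeff_psum 1 Q) * (ennreal (c / h ^ r) * (ennreal (t n) * Lpow 1 (u 1)))"
        by (intro mult_left_mono H_le) auto
      also have "\<dots> = ennreal C * (ennreal (t n) * Lpow 1 (u 1))"
        using \<open>h > 0\<close> \<open>c \<ge> 0\<close>
        by (simp add: C_def c_def[symmetric] coeff_psum_nonneg mult.assoc[symmetric] ennreal_mult[symmetric])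
      finally show ?thesis .
    qed
    also have "Lpow 1 (shift_op (avg_poly N ^ r * M) (t n) (fwd_diff k h (E n))) \<le> ennreal C' * Lpow 1 (E n)"
    proof -
      have "Lpow 1 (shift_op (avg_poly N ^ r * M) (t n) (fwd_diff k h (E n)))
          \<le> ennreal (coeff_psum 1 (avg_poly N ^ r * M)) * Lpow 1 (fwd_diff k h (E n))"
        by (rule Lpow_shift_op_le) (auto intro: periodic_fwd_diff perE)
      also have "\<dots> \<le> ennreal (coeff_psum 1 M) * (ennreal (coeff_psum 1 ([:1, -1:] ^ k)) * Lpow 1 (E n))"
      proof (intro mult_mono ennreal_leI)
        have "coeff_psum 1 (avg_poly N ^ r * M) \<le> coeff_psum 1 (avg_poly N ^ r) * coeff_psum 1 M"
          by (rule coeff_psum_mult_le) auto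
        also have "\<dots> \<le> 1 * coeff_psum 1 M"
          by (intro mult_right_mono coeff_psum_avg_power_le_1 coeff_psum_nonneg)
        finally show "coeff_psum 1 (avg_poly N ^ r * M) \<le> coeff_psum 1 M"
          by simp
        show "Lpow 1 (fwd_diff k h (E n)) \<le> ennreal (coeff_psum 1 ([:1, -1:] ^ k)) * Lpow 1 (E n)"
          unfolding fwd_diff_as_shift_op by (rule Lpow_shift_op_le) (auto intro: perE)
      qed auto
      finally show ?thesis
        by (simp add: C'_def ennreal_mult'' coeff_psum_nonneg mult.assoc)
    qed
    finally show ?thesis
      by (simp add: N_def add_mono)
  qed
  have "(\<lambda>n. ennreal C * (ennreal (t n) * Lpow 1 (u 1)) + ennreal C' * Lpow 1 (E n))
      \<longlonglongrightarrow> ennreal C * (ennreal 0 * Lpow 1 (u 1)) + ennreal C' * 0"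
  proof (intro tendsto_add ennreal_tendsto_cmult E_lim)
    have "(\<lambda>n. Lpow 1 (u 1) * ennreal (t n)) \<longlonglongrightarrow> Lpow 1 (u 1) * ennreal 0"
      using fin[of 1] r by (intro ennreal_tendsto_cmult tendsto_ennrealI t_lim) auto
    then show "(\<lambda>n. ennreal (t n) * Lpow 1 (u 1)) \<longlonglongrightarrow> ennreal 0 * Lpow 1 (u 1)"
      by (simp add: mult.commute)
  qed auto
  then have "(\<lambda>n. ennreal C * (ennreal (t n) * Lpow 1 (u 1)) + ennreal C' * Lpow 1 (E n)) \<longlonglongrightarrow> 0"
    by simp
  then show ?thesis
    by (rule tendsto_sandwich[rotated 2, OF tendsto_const])
       (use bound in \<open>auto intro!: always_eventually\<close>)
qed

end

section \<open>The inequality for moduli of smoothness\<close>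

lemma nth_deriv_0: "nth_deriv 0 f = f"
  by (simp add: nth_deriv_def)

lemma nth_deriv_Suc: "nth_deriv (Suc j) f = (\<lambda>x. vector_derivative (nth_deriv j f) (at x))"
  by (simp add: nth_deriv_def)

lemma periodic_vector_derivative:
  assumes "periodic F"
  shows "periodic (\<lambda>x. vector_derivative F (at x))"
  using periodic_has_vector_derivative[OF assms, of _ _ 1]
  by (simp add: periodic_def vector_derivative_def)

lemma periodic_nth_deriv: "periodic f \<Longrightarrow> periodic (nth_deriv j f)"
  by (induction j) (simp_all add: nth_deriv_0 nth_deriv_Suc periodic_vector_derivative)

lemma Lpow_1_continuous_finite:
  assumes "continuous_on UNIV \<phi>"
  shows "Lpow 1 \<phi> < \<infinity>"
proof -
  have "compact (\<phi> ` {0..2 * pi})"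
    by (intro compact_continuous_image continuous_on_subset[OF assms]) auto
  then have "bounded (\<phi> ` {0..2 * pi})"
    by (rule compact_imp_bounded)
  then obtain B where "\<forall>y\<in>\<phi> ` {0..2 * pi}. norm y \<le> B"
    unfolding bounded_iff ..
  then have B: "norm (\<phi> x) \<le> B" if "x \<in> {0..2 * pi}" for x
    using that by blast
  have "Lpow 1 \<phi> \<le> (\<integral>\<^sup>+x. ennreal B * indicator {0..<2 * pi} x \<partial>lborel)"
    unfolding Lpow_1 using B by (intro nn_integral_mono) (auto simp: indicator_def intro!: ennreal_leI)
  also have "\<dots> < \<infinity>"
    by (simp add: nn_integral_cmult_indicator ennreal_mult_less_top)
  finally show ?thesis .
qed

lemma deriv_AC_derivative_chain:
  assumes f: "deriv_AC r f" and "r \<ge> 1"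
  obtains u where "derivative_chain u r" "u 0 = f" "AE x in lborel. nth_deriv r f x = u r x"
proof -
  have per_f: "periodic f" and diff: "\<And>j x. j < r - 1 \<Longrightarrow> nth_deriv j f differentiable (at x)"
    and AC: "nth_deriv (r - 1) f \<in> AC_circle"
    using f by (simp_all add: deriv_AC_def)
  obtain g where g: "g \<in> borel_measurable borel" "periodic g"
    "AE x in lborel. (nth_deriv (r - 1) f has_vector_derivative g x) (at x)"
    "primitive (nth_deriv (r - 1) f) g" "Lpow 1 g < \<infinity>"
    by (rule AC_circle_derivative[OF AC])
  define u where "u i = (if i < r then nth_deriv i f else g)" for i
  have cont: "continuous_on UNIV (nth_deriv i f)" if "i < r" for i
  proof (cases "i = r - 1")
    case True
    then show ?thesis
      using AC_circle_continuous[OF AC] by simp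
  next
    case False
    then have "i < r - 1"
      using that by simp
    have "continuous (at x) (nth_deriv i f)" for x
      by (rule differentiable_imp_continuous_within[OF diff[OF \<open>i < r - 1\<close>]])
    then show ?thesis
      by (simp add: continuous_on_eq_continuous_at)
  qed
  have deriv: "(nth_deriv i f has_vector_derivative nth_deriv (Suc i) f x) (at x)" if "i < r - 1" for i x
    using diff[OF that] by (simp add: nth_deriv_Suc vector_derivative_works)
  have "derivative_chain u r"
  proof
    fix i assume "i \<le> r"
    show "u i \<in> borel_measurable borel"
      using g(1) borel_measurable_continuous_onI[OF cont[of i]] by (simp add: u_def)
    show "periodic (u i)"
      using g(2) periodic_nth_deriv[OF per_f] by (simp add: u_def)
    show "Lpow 1 (u i) < \<infinity>"
      using g(5) Lpow_1_continuous_finite[OF cont] by (simp add: u_def)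
  next
    fix i assume "i < r"
    show "primitive (u i) (u (Suc i))"
    proof (cases "i = r - 1")
      case True
      then show ?thesis
        using g(4) \<open>r \<ge> 1\<close> by (simp add: u_def)
    next
      case False
      with \<open>i < r\<close> have "i < r - 1" "Suc i < r"
        by auto
      show ?thesis
        unfolding primitive_def
      proof (intro allI impI)
        fix a b :: real assume "a \<le> b"
        have "(nth_deriv (Suc i) f has_integral nth_deriv i f b - nth_deriv i f a) {a..b}"
          by (rule fundamental_theorem_of_calculus[OF \<open>a \<le> b\<close>])
             (rule has_vector_derivative_at_within[OF deriv[OF \<open>i < r - 1\<close>]])
        then show "(u (Suc i) has_integral u i b - u i a) {a..b}"
          using \<open>i < r\<close> \<open>Suc i < r\<close> by (simp add: u_def)
      qed
    qed
  next
    show "AE x in lborel. (u (r - 1) has_vector_derivative u r x) (at x)"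
      using g(3) \<open>r \<ge> 1\<close> by (simp add: u_def)
  qed fact
  moreover have "u 0 = f"
    using \<open>r \<ge> 1\<close> by (simp add: u_def nth_deriv_0)
  moreover have "AE x in lborel. nth_deriv r f x = u r x"
    using g(3)
  proof eventually_elim
    case (elim x)
    have "nth_deriv r f x = vector_derivative (nth_deriv (r - 1) f) (at x)"
      using \<open>r \<ge> 1\<close> nth_deriv_Suc[of "r - 1" f] by simp
    then show ?case
      using vector_derivative_at[OF elim] by (simp add: u_def)
  qed
  ultimately show thesis
    by (rule that)
qed

lemma ennreal_powr_mono: "x \<le> y \<Longrightarrow> a > 0 \<Longrightarrow> ennreal_powr x a \<le> ennreal_powr y a"
  by (auto simp: ennreal_powr_def top_unique less_top[symmetric] intro!: ennreal_leI powr_mono2 enn2real_mono)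

lemma ennreal_powr_cancel: "a > 0 \<Longrightarrow> ennreal_powr (ennreal_powr x (1 / a)) a = x"
  by (auto simp: ennreal_powr_def powr_powr less_top)

lemma ennreal_powr_cmult:
  assumes "c > 0" "a > 0"
  shows "ennreal_powr (ennreal c * x) a = ennreal (c powr a) * ennreal_powr x a"
proof (cases "x = \<infinity>")
  case False
  then have "ennreal c * x \<noteq> \<infinity>"
    by (simp add: ennreal_mult_eq_top_iff)
  with False show ?thesis
    using assms by (simp add: ennreal_powr_def enn2real_mult powr_mult ennreal_mult)
qed (use assms in \<open>simp add: ennreal_powr_def ennreal_mult_top\<close>)

lemma Lp_circle_eq: "Lp_circle p f = ennreal_powr (Lpow p f) (1 / p)"
  by (simp add: Lp_circle_def Lpow_def nn_integral_completion)

text \<open>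
  The modulus of the pointwise derivative equals that of its Borel version: finitely many
  translates of a null set form a null set.
\<close>
lemma Lpow_fwd_diff_cong_AE:
  assumes "AE x in lborel. f x = g x"
  shows "Lpow p (fwd_diff s t f) = Lpow p (fwd_diff s t g)"
proof -
  obtain N where N: "N \<in> null_sets lborel" "{x. f x \<noteq> g x} \<subseteq> N"
    using assms by (auto elim: AE_E simp: eventually_ae_filter)
  have "AE x in lborel. x + c \<notin> N" for c
  proof -
    have "AE x in lborel. x \<notin> N"
      using N(1) by (rule AE_not_in)
    moreover have "Measurable.pred borel (\<lambda>x. x \<notin> N)"
      using N(1) by (auto simp: null_sets_def)
    ultimately have "AE x in lborel. c + 1 * x \<notin> N"
      by (intro AE_borel_affine) auto
    then show ?thesis
      by (simp add: add.commute)
  qed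
  then have "AE x in lborel. \<forall>\<nu>\<in>{..s}. x + real \<nu> * t \<notin> N"
    by (intro AE_finite_allI) auto
  then have "AE x in lborel. fwd_diff s t f x = fwd_diff s t g x"
  proof eventually_elim
    case (elim x)
    then have "f (x + real \<nu> * t) = g (x + real \<nu> * t)" if "\<nu> \<le> s" for \<nu>
      using N(2) that by blast
    then show ?case
      by (simp add: fwd_diff_def)
  qed
  then show ?thesis
    unfolding Lpow_def by (intro nn_integral_cong_AE) (auto elim: eventually_mono)
qed

lemma modulus_mono: "s \<le> t \<Longrightarrow> modulus k f s p \<le> modulus k f t p"
  unfolding modulus_def by (rule SUP_subset_mono) auto

lemma Lpow_fwd_diff_le_modulus:
  assumes "0 < t" "0 < p"
  shows "Lpow p (fwd_diff k t f) \<le> ennreal_powr (modulus k f t p) p"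
proof -
  have "Lp_circle p (fwd_diff k t f) \<le> modulus k f t p"
    unfolding modulus_def by (rule SUP_upper) (use assms in auto)
  then have "ennreal_powr (ennreal_powr (Lpow p (fwd_diff k t f)) (1 / p)) p \<le> ennreal_powr (modulus k f t p) p"
    using assms by (intro ennreal_powr_mono) (auto simp: Lp_circle_eq)
  then show ?thesis
    using assms by (simp add: ennreal_powr_cancel)
qed

theorem corollary2p2:
  fixes p :: real and k r :: nat
  assumes "0 < p" and "p < 1" and "k \<ge> 1" and "r \<ge> 1"
  shows "\<exists>C::real. C > 0 \<and>
    (\<forall>(f :: real \<Rightarrow> complex) (\<delta>::real). deriv_AC r f \<longrightarrow> \<delta> > 0 \<longrightarrow>
      modulus (r + k) f \<delta> p
        \<le> ennreal (C * \<delta> powr (real r + 1 / p - 1)) *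
          ennreal_powr
            (\<integral>\<^sup>+t\<in>{0<..<\<delta>}.
               ennreal_powr (modulus k (nth_deriv r f) t p) p / ennreal (t powr (2 - p)) \<partial>lebesgue)
            (1 / p))"
proof -
  obtain M q where M: "poly M 1 = 1" "[:1/2, 1/2:] ^ r * M - dilate 2 M = [:1, -1:] ^ k * q"
    using richardson_poly[OF \<open>k \<ge> 1\<close>, of r] by blast
  obtain C where "C > 0" and C: "\<forall>g W h \<delta> n. g \<in> borel_measurable borel \<longrightarrow> periodic g \<longrightarrow>
      (\<forall>t>0. Lpow p (fwd_diff k t g) \<le> W t) \<longrightarrow> (\<forall>s t. 0 < s \<longrightarrow> s \<le> t \<longrightarrow> W s \<le> W t) \<longrightarrow>
      0 < h \<longrightarrow> h \<le> \<delta> \<longrightarrow>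
      Lpow p (quadrature (2 ^ n) r M h (fwd_diff k h g))
        \<le> ennreal (C * h powr (1 - p)) * (\<integral>\<^sup>+t\<in>{0<..<\<delta>}. W t / ennreal (t powr (2 - p)) \<partial>lebesgue)"
    using Lpow_quadrature_le[OF \<open>k \<ge> 1\<close> \<open>r \<ge> 1\<close> \<open>0 < p\<close> \<open>p < 1\<close> M(2)] by (elim exE conjE)
  have "modulus (r + k) f \<delta> p
        \<le> ennreal (C powr (1 / p) * \<delta> powr (real r + 1 / p - 1)) *
          ennreal_powr
            (\<integral>\<^sup>+t\<in>{0<..<\<delta>}.
               ennreal_powr (modulus k (nth_deriv r f) t p) p / ennreal (t powr (2 - p)) \<partial>lebesgue)
            (1 / p)"
    if f: "deriv_AC r f" and "\<delta> > 0" for f \<delta>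
  proof -
    obtain u where u: "derivative_chain u r" "u 0 = f" and ae: "AE x in lborel. nth_deriv r f x = u r x"
      by (rule deriv_AC_derivative_chain[OF f \<open>r \<ge> 1\<close>])
    interpret derivative_chain u r by fact
    define W where "W t = ennreal_powr (modulus k (nth_deriv r f) t p) p" for t
    define I where "I = (\<integral>\<^sup>+t\<in>{0<..<\<delta>}. W t / ennreal (t powr (2 - p)) \<partial>lebesgue)"
    have W: "Lpow p (fwd_diff k t (u r)) \<le> W t" if "t > 0" for t
      using Lpow_fwd_diff_le_modulus[OF that \<open>0 < p\<close>, of k "nth_deriv r f"]
      by (simp add: W_def Lpow_fwd_diff_cong_AE[OF ae])
    have W_mono: "W s \<le> W t" if "s \<le> t" for s t
      unfolding W_def using modulus_mono[OF that] \<open>0 < p\<close> by (intro ennreal_powr_mono)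
    have "Lp_circle p (fwd_diff (r + k) h f)
        \<le> ennreal (C powr (1 / p) * \<delta> powr (real r + 1 / p - 1)) * ennreal_powr I (1 / p)"
      if h: "0 < h" "h \<le> \<delta>" for h
    proof -
      define H where "H = (\<lambda>x. fwd_diff (r + k) h (u 0) x / of_real ((- h) ^ r))"
      have [measurable]: "u 0 \<in> borel_measurable borel" "u r \<in> borel_measurable borel"
        by auto
      have [measurable]: "H \<in> borel_measurable borel"
        unfolding H_def by measurable
      have "Lpow p H \<le> ennreal (C * h powr (1 - p)) * I"
      proof (rule Lpow_le_of_L1_limit)
        show "(\<lambda>n. Lpow 1 (\<lambda>x. H x - quadrature (2 ^ n) r M h (fwd_diff k h (u r)) x)) \<longlonglongrightarrow> 0"
          unfolding H_def by (rule quadrature_tendsto_L1[OF M(1) h(1)])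
        show "Lpow p (quadrature (2 ^ n) r M h (fwd_diff k h (u r))) \<le> ennreal (C * h powr (1 - p)) * I" for n
          unfolding I_def using W W_mono h per[of r]
          by (intro C[rule_format]) auto
        show "quadrature (2 ^ n) r M h (fwd_diff k h (u r)) \<in> borel_measurable borel" for n
          unfolding quadrature_def by measurable
      qed (use \<open>0 < p\<close> \<open>p < 1\<close> in auto)
      moreover have "fwd_diff (r + k) h f = (\<lambda>x. of_real ((- h) ^ r) * H x)"
        using h by (simp add: H_def u(2) fun_eq_iff)
      then have "Lpow p (fwd_diff (r + k) h f) = ennreal ((h ^ r) powr p) * Lpow p H"
        using h by (simp only:) (subst Lpow_cmult, auto simp: norm_power)
      ultimately have "Lpow p (fwd_diff (r + k) h f)
          \<le> ennreal ((h ^ r) powr p) * (ennreal (C * h powr (1 - p)) * I)"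
        by (simp add: mult_left_mono)
      also have "\<dots> = ennreal (C * h powr (real r * p + 1 - p)) * I"
      proof -
        have "(h ^ r) powr p * (C * h powr (1 - p)) = C * h powr (real r * p + 1 - p)"
          using h by (simp add: powr_realpow[symmetric] powr_powr powr_add[symmetric] algebra_simps)
        moreover have "ennreal ((h ^ r) powr p) * (ennreal (C * h powr (1 - p)) * I)
            = ennreal ((h ^ r) powr p * (C * h powr (1 - p))) * I"
          using \<open>C > 0\<close> by (subst ennreal_mult) (auto simp: mult.assoc)
        ultimately show ?thesis
          by (simp only:)
      qed
      also have "\<dots> \<le> ennreal (C * \<delta> powr (real r * p + 1 - p)) * I"
      proof -
        have "0 \<le> real r * p"
          using \<open>0 < p\<close> by simp
        then have "0 \<le> real r * p + 1 - p"
          using \<open>p < 1\<close> by linarith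
        then show ?thesis
          using h \<open>C > 0\<close> by (intro mult_right_mono ennreal_leI mult_left_mono powr_mono2) auto
      qed
      finally have "Lp_circle p (fwd_diff (r + k) h f)
          \<le> ennreal_powr (ennreal (C * \<delta> powr (real r * p + 1 - p)) * I) (1 / p)"
        unfolding Lp_circle_eq using \<open>0 < p\<close> by (intro ennreal_powr_mono) auto
      also have "\<dots> = ennreal ((C * \<delta> powr (real r * p + 1 - p)) powr (1 / p)) * ennreal_powr I (1 / p)"
        using \<open>C > 0\<close> \<open>\<delta> > 0\<close> \<open>0 < p\<close> by (intro ennreal_powr_cmult) auto
      also have "(C * \<delta> powr (real r * p + 1 - p)) powr (1 / p) = C powr (1 / p) * \<delta> powr (real r + 1 / p - 1)"
      proof -
        have "(real r * p + 1 - p) * (1 / p) = real r + 1 / p - 1"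
          using \<open>0 < p\<close> by (simp add: field_simps)
        then show ?thesis
          using \<open>C > 0\<close> by (simp add: powr_mult powr_powr)
      qed
      finally show ?thesis .
    qed
    then show ?thesis
      unfolding modulus_def[of "r + k"] I_def W_def by (intro SUP_least) auto
  qed
  then show ?thesis
    using \<open>C > 0\<close> by (intro exI[of _ "C powr (1 / p)"]) auto
qed

end
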